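(* Let $f_0$ be a probability density function on $\mathbb{R}$ with finite fourth moment, $\int_{\mathbb{R}} v^4 f_0(v)\,dv < +\infty$, and suppose that its Fourier transform $\varphi_0(\xi) := \int_{\mathbb{R}} e^{i\xi x} f_0(x)\,dx$ satisfies $$|\varphi_0(\xi)| = o(|\xi|^{-p}) \qquad (|\xi| \to +\infty)$$ for some strictly positive $p$. Let $f(\cdot,t)$, $t \geq 0$, be the solution of Kac's equation with initial datum $f_0$, and let $\sigma^2 := \int_{\mathbb{R}} v^2 f_0(v)\,dv$. Then there is a constant $C$, depending only on $f_0$ (in particular, not on $t$), for which $$\int_{\mathbb{R}} |f(v,t) - g_\sigma(v)|\,dv \leq C e^{-t/4} \qquad \text{for all } t \geq 0,$$ where $g_\sigma(v) = (\sigma\sqrt{2\pi})^{-1} \exp\{-v^2/(2\sigma^2)\}$ for $v \in \mathbb{R}$.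
   Context: Kac's equation with initial datum a probability density function $f_0$ on $\mathbb{R}$ is the Cauchy problem $$\frac{\partial f}{\partial t}(v,t) = \frac{1}{2\pi} \int_0^{2\pi} \int_{\mathbb{R}} \bigl[f(v\cos\theta - w\sin\theta, t)\, f(v\sin\theta + w\cos\theta, t) - f(v,t)\, f(w,t)\bigr] \, dw \, d\theta, \qquad f(\cdot,0^+) = f_0(\cdot),$$ where for each $t \ge 0$ the unknown $f(\cdot,t)$ is a probability density function on $\mathbb{R}$. For any initial probability density function this problem admits a unique solution. Its Fourier transform $\varphi(\xi,t) := \int_{\mathbb{R}} e^{i\xi x} f(x,t)\,dx$ is given by Wild's series $$\varphi(\xi,t) = \sum_{n\geq 1} e^{-t}(1-e^{-t})^{n-1}\hat q_n(\xi;\varphi_0),$$ where $\hat q_1(\xi;\varphi_0) := \varphi_0(\xi)$, $\hat q_n(\xi;\varphi_0) := \frac{1}{n-1}\sum_{k=1}^{n-1} \hat q_k(\xi;\varphi_0)\star \hat q_{n-k}(\xi;\varphi_0)$ for $n\geq 2$, and $g_1(\xi)\star g_2(\xi) := \frac{1}{2\pi}\int_0^{2\pi} g_1(\xi\cos\theta)\, g_2(\xi\sin\theta)\,d\theta$. *)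

theory Defs
  imports "HOL-Probability.Probability"
begin

definition prob_density :: "(real \<Rightarrow> real) \<Rightarrow> bool" where
  "prob_density g \<longleftrightarrow> (\<forall>x. 0 \<le> g x) \<and> has_bochner_integral lborel g 1"

definition fourier :: "(real \<Rightarrow> real) \<Rightarrow> real \<Rightarrow> complex" where
  "fourier g \<xi> = (CLBINT x. exp (\<i> * complex_of_real (\<xi> * x)) * complex_of_real (g x))"

definition kac_integrand :: "(real \<Rightarrow> real) \<Rightarrow> real \<Rightarrow> real \<Rightarrow> real \<Rightarrow> real" where
  "kac_integrand g v \<theta> w =
     g (v * cos \<theta> - w * sin \<theta>) * g (v * sin \<theta> + w * cos \<theta>) - g v * g w"

definition kac_collision :: "(real \<Rightarrow> real) \<Rightarrow> real \<Rightarrow> real" where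
  "kac_collision g v =
     1 / (2 * pi) * (LBINT \<theta>:{0..2*pi}. (LBINT w. kac_integrand g v \<theta> w))"

text \<open>
  For a density \<open>g\<close>, the collision integral at \<open>v\<close> converges only for almost every \<open>v\<close>, so the
  equation is imposed for almost every velocity. The exceptional null set of velocities must not
  depend on \<open>t\<close>; otherwise the Cauchy problem would not determine \<open>f\<close>. The integrability conjunct
  says that the collision integral converges; without it, a divergent integral would
  count as \<open>0\<close>. The initial condition \<open>f(\<cdot>, 0+) = f\<^sub>0\<close> is likewise a pointwise limit almost
  everywhere, and the value at time \<open>0\<close> agrees with it.
\<close>

definition kac_solution :: "(real \<Rightarrow> real) \<Rightarrow> (real \<Rightarrow> real \<Rightarrow> real) \<Rightarrow> bool" where
  "kac_solution f0 f \<longleftrightarrow>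
     (\<forall>t\<ge>0. prob_density (\<lambda>v. f v t)) \<and>
     (AE v in lborel. \<forall>t>0.
        set_integrable (lborel \<Otimes>\<^sub>M lborel) ({0..2*pi} \<times> UNIV)
          (\<lambda>(\<theta>, w). kac_integrand (\<lambda>u. f u t) v \<theta> w) \<and>
        ((\<lambda>s. f v s) has_real_derivative kac_collision (\<lambda>u. f u t) v) (at t)) \<and>
     (AE v in lborel. f v 0 = f0 v \<and> ((\<lambda>t. f v t) \<longlongrightarrow> f0 v) (at_right 0))"

end

theory Submission
  imports Defs
begin

text \<open>
  On the Fourier side the gain term of Kac's equation is the angular convolution \<open>star\<close>, and
  the even part of the transform of the solution is Wild's series
  \<open>\<Sum>n. exp (- t) (1 - exp (- t))\<^sup>n Q\<^sub>n\<close>, while the odd part is just damped by \<open>exp (- t)\<close>. The initial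
  transform is dominated by a weight \<open>w(x) = (1 + c x\<^sup>2)\<^sup>-\<^sup>q\<close> with
  \<open>w(x cos \<theta>) w(x sin \<theta>) \<le> w(x)\<close>, hence so are all \<open>Q\<^sub>n\<close>. Since the Gaussian is a fixed point of
  \<open>star\<close> and the second moments agree, \<open>\<bar>Q\<^sub>n - gam\<bar> \<le> M p\<^sub>n x\<^sup>4 w(x)\<close>, where \<open>p\<^sub>n\<close> solves the
  recursion with contraction factor \<open>2 avg cos\<^sup>4 = 3/4\<close>; the Wild sum of \<open>p\<^sub>n\<close> is exactly
  \<open>exp (- t / 4)\<close>. Each further angular convolution gains the decay \<open>\<bar>x\<bar>\<^sup>-\<^sup>2\<^sup>q\<close>, so for all \<open>n\<close> beyond
  some \<open>N\<close> the differences \<open>Q\<^sub>n - gam\<close> and their derivatives are square integrable with the same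
  factor \<open>p\<^sub>n\<close>. That tail is bounded in \<open>L\<^sup>1\<close> through Bessel's inequality, and the first \<open>N\<close> terms
  carry total mass at most \<open>N exp (- t)\<close>.
\<close>

section \<open>The angular convolution\<close>

text \<open>The rate leaves no room for loss in \<open>n\<close>: \<open>exp (- t / 4)\<close>
  results only if every late difference \<open>Q\<^sub>n - gam\<close> keeps the factor
  \<open>p\<^sub>n\<close> itself. Decay at infinity is therefore gained in finitely many rounds,
  each of which may cost a constant but no power of n. The factor x^4 is carried through all rounds:
  it records the vanishing at 0 and offsets four powers of the singularity at cos \<theta> = 0 that
  the gain of decay produces. The target (1 + x^2)^(-3/8) has an exponent strictly between 1/4,
  above which its square is integrable, and 1/2, below which the angular singularity |sin
  \<theta>|^(-2l) is integrable. The derivative is handled as x d/dx, which costs one power of |x|,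
  so its target exponent is 3/8 - 1/2 = -1/8. The datum need be neither even nor centred. Only the
  first term of Wild's series has an odd part, and that part coincides with the odd part of the
  solution, so once this term is removed the remainder is governed by its cosine transform
  alone.\<close>

definition star :: "(real \<Rightarrow> real) \<Rightarrow> (real \<Rightarrow> real) \<Rightarrow> real \<Rightarrow> real" where
  "star g h x = integral {0..2*pi} (\<lambda>\<theta>. g (x * cos \<theta>) * h (x * sin \<theta>)) / (2 * pi)"

lemma continuous_star_integrand:
  fixes g h :: "real \<Rightarrow> real"
  assumes "continuous_on UNIV g" "continuous_on UNIV h"
  shows "continuous_on T (\<lambda>\<theta>. g (x * cos \<theta>) * h (x * sin \<theta>))"
  by (intro continuous_intros continuous_on_compose2[OF assms(1)]
      continuous_on_compose2[OF assms(2)]) auto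

lemma star_integrable:
  fixes g h :: "real \<Rightarrow> real"
  assumes "continuous_on UNIV g" "continuous_on UNIV h"
  shows "(\<lambda>\<theta>. g (x * cos \<theta>) * h (x * sin \<theta>)) integrable_on {0..2*pi}"
  by (intro integrable_continuous_real continuous_star_integrand assms)

lemma continuous_star [continuous_intros]:
  assumes "continuous_on UNIV g" "continuous_on UNIV h"
  shows "continuous_on UNIV (star g h)"
proof -
  have "continuous_on UNIV (\<lambda>x. integral (cbox 0 (2*pi)) (\<lambda>\<theta>. g (x * cos \<theta>) * h (x * sin \<theta>)))"
    by (rule integral_continuous_on_param)
      (auto simp: split_beta intro!: continuous_on_mult continuous_on_compose2[OF assms(1)]
      continuous_on_compose2[OF assms(2)] continuous_intros)
  then show ?thesis
    unfolding star_def by (auto intro!: continuous_intros)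
qed

lemma star_bound:
  assumes g: "continuous_on UNIV g" and h: "continuous_on UNIV h"
    and F: "F integrable_on {0..2*pi}"
    and le: "\<And>\<theta>. \<bar>g (x * cos \<theta>) * h (x * sin \<theta>)\<bar> \<le> F \<theta>"
  shows "\<bar>star g h x\<bar> \<le> integral {0..2*pi} F / (2*pi)"
proof -
  have "norm (integral {0..2*pi} (\<lambda>\<theta>. g (x * cos \<theta>) * h (x * sin \<theta>))) \<le> integral {0..2*pi} F"
    by (rule integral_norm_bound_integral[OF star_integrable[OF g h] F]) (use le in auto)
  then show ?thesis by (simp add: star_def divide_right_mono)
qed

lemma star_add_left:
  assumes "continuous_on UNIV g" "continuous_on UNIV g'" "continuous_on UNIV h"
  shows "star (\<lambda>x. g x + g' x) h x = star g h x + star g' h x"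
  unfolding star_def
  by (simp add: distrib_right integral_add star_integrable assms add_divide_distrib)

lemma star_add_right:
  assumes "continuous_on UNIV g" "continuous_on UNIV h" "continuous_on UNIV h'"
  shows "star g (\<lambda>x. h x + h' x) x = star g h x + star g h' x"
  unfolding star_def
  by (simp add: distrib_left integral_add star_integrable assms add_divide_distrib)

lemma star_diff_left:
  assumes "continuous_on UNIV g" "continuous_on UNIV g'" "continuous_on UNIV h"
  shows "star (\<lambda>x. g x - g' x) h x = star g h x - star g' h x"
  unfolding star_def
  by (simp add: left_diff_distrib integral_diff star_integrable assms diff_divide_distrib)

lemma star_diff_right:
  assumes "continuous_on UNIV g" "continuous_on UNIV h" "continuous_on UNIV h'"
  shows "star g (\<lambda>x. h x - h' x) x = star g h x - star g h' x"
  unfolding star_def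
  by (simp add: right_diff_distrib integral_diff star_integrable assms diff_divide_distrib)

lemma star_cmult_left: "star (\<lambda>x. c * g x) h x = c * star g h x"
  unfolding star_def by (simp add: mult.assoc)

lemma star_zero_left [simp]: "star (\<lambda>x. 0) h x = 0"
  by (simp add: star_def)

lemma star_sum_left:
  assumes "\<And>i. i \<in> I \<Longrightarrow> continuous_on UNIV (g i)" "continuous_on UNIV h"
  shows "star (\<lambda>x. \<Sum>i\<in>I. c i * g i x) h x = (\<Sum>i\<in>I. c i * star (g i) h x)"
  using assms(1)
proof (induction I rule: infinite_finite_induct)
  case (insert i I)
  have "star (\<lambda>x. c i * g i x + (\<Sum>i\<in>I. c i * g i x)) h x
      = star (\<lambda>x. c i * g i x) h x + star (\<lambda>x. \<Sum>i\<in>I. c i * g i x) h x"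
    using insert by (intro star_add_left continuous_intros assms(2)) auto
  with insert show ?case by (simp add: star_cmult_left)
qed simp_all

lemma integral_shift_real:
  fixes F :: "real \<Rightarrow> real"
  assumes "continuous_on UNIV F"
  shows "integral {a..b} (\<lambda>x. F (x + c)) = integral {a+c..b+c} F"
  using integral_shift[OF continuous_on_subset[OF assms], of a c b] by (simp add: o_def)

text \<open>Two reflections of the angle matter: \<open>a = pi/2\<close> exchanges cosine and sine
  and makes \<open>star\<close> commutative, \<open>a = 2*pi\<close> flips the sign of the sine and
  annihilates odd second factors.\<close>

lemma integral_periodic_reflect:
  fixes F :: "real \<Rightarrow> real"
  assumes cont: "continuous_on UNIV F" and per: "\<And>x. F (x + 2*pi) = F x"
    and a: "0 \<le> a" "a \<le> 2*pi"
  shows "integral {0..2*pi} (\<lambda>x. F (a - x)) = integral {0..2*pi} F"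
proof -
  have int: "F integrable_on {u..v}" for u v
    by (intro integrable_continuous_real continuous_on_subset[OF cont]) auto
  have "integral {0..2*pi} (\<lambda>x. F (a - x)) = integral {-(2*pi)..0} (\<lambda>x. F (x + a))"
    using Henstock_Kurzweil_Integration.integral_reflect_real[where a=0 and b="2*pi" and f="\<lambda>x. F (a - x)"]
    by (simp only: minus_minus minus_zero diff_minus_eq_add add.commute)
  also have "\<dots> = integral {a-2*pi..a} F"
    using integral_shift_real[OF cont, of "-(2*pi)" 0 a] by (simp add: algebra_simps)
  also have "\<dots> = integral {a-2*pi..0} F + integral {0..a} F"
    using a by (intro Henstock_Kurzweil_Integration.integral_combine[symmetric] int) auto
  also have "integral {a-2*pi..0} F = integral {a-2*pi..0} (\<lambda>x. F (x + 2*pi))"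
    by (simp add: per)
  also have "\<dots> = integral {a..2*pi} F"
    using integral_shift_real[OF cont, of "a-2*pi" 0 "2*pi"] by simp
  also have "integral {a..2*pi} F + integral {0..a} F = integral {0..2*pi} F"
    using Henstock_Kurzweil_Integration.integral_combine[OF a int] by simp
  finally show ?thesis .
qed

lemma star_commute:
  assumes "continuous_on UNIV g" "continuous_on UNIV h"
  shows "star g h x = star h g x"
proof -
  have "integral {0..2*pi} (\<lambda>\<theta>. g (x * cos (pi/2 - \<theta>)) * h (x * sin (pi/2 - \<theta>)))
      = integral {0..2*pi} (\<lambda>\<theta>. g (x * cos \<theta>) * h (x * sin \<theta>))"
    by (rule integral_periodic_reflect[OF continuous_star_integrand[OF assms]]) auto
  then show ?thesis
    unfolding star_def by (simp add: cos_diff sin_diff mult.commute)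
qed

lemma star_odd_right:
  assumes "continuous_on UNIV g" "continuous_on UNIV h" "\<And>x. h (- x) = - h x"
  shows "star g h x = 0"
  using integral_periodic_reflect[OF continuous_star_integrand[OF assms(1,2)], of x "2*pi"]
  unfolding star_def by (simp add: cos_diff sin_diff assms(3))

text \<open>Differentiation under the integral brings out a factor cos \<theta> or sin \<theta>;
  multiplication by x completes it to the argument of the differentiated factor, so the result can
  again be written with \<open>star\<close>.\<close>

lemma DERIV_star:
  assumes g: "\<And>x. (g has_real_derivative g' x) (at x)" and g': "continuous_on UNIV g'"
    and h: "\<And>x. (h has_real_derivative h' x) (at x)" and h': "continuous_on UNIV h'"
  obtains d where "\<And>x. (star g h has_real_derivative d x) (at x)" "continuous_on UNIV d"
    "\<And>x. x * d x = star (\<lambda>y. y * g' y) h x + star g (\<lambda>y. y * h' y) x"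
proof
  have cg: "continuous_on UNIV g" and ch: "continuous_on UNIV h"
    using g h by (meson DERIV_isCont continuous_at_imp_continuous_on)+
  have cf': "continuous_on (UNIV \<times> cbox 0 (2*pi)) (\<lambda>(x, \<theta>).
      g' (x * cos \<theta>) * cos \<theta> * h (x * sin \<theta>) + g (x * cos \<theta>) * (h' (x * sin \<theta>) * sin \<theta>))"
    unfolding split_beta
    by (intro continuous_intros continuous_on_compose2[OF cg] continuous_on_compose2[OF ch]
        continuous_on_compose2[OF g'] continuous_on_compose2[OF h']) auto
  let ?f' = "\<lambda>x \<theta>. g' (x * cos \<theta>) * cos \<theta> * h (x * sin \<theta>) + g (x * cos \<theta>) * (h' (x * sin \<theta>) * sin \<theta>)"
  have L: "((\<lambda>x. integral (cbox 0 (2*pi)) (\<lambda>\<theta>. g (x * cos \<theta>) * h (x * sin \<theta>))) has_field_derivative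
      integral (cbox 0 (2*pi)) (?f' x)) (at x within UNIV)" for x
  proof (rule leibniz_rule_field_derivative)
    fix x t :: real
    have "((\<lambda>x. g (x * cos t)) has_field_derivative g' (x * cos t) * cos t) (at x)"
      by (rule DERIV_chain'[where f="\<lambda>x. x * cos t", OF _ g]) (auto intro!: derivative_eq_intros)
    moreover have "((\<lambda>x. h (x * sin t)) has_field_derivative h' (x * sin t) * sin t) (at x)"
      by (rule DERIV_chain'[where f="\<lambda>x. x * sin t", OF _ h]) (auto intro!: derivative_eq_intros)
    ultimately show "((\<lambda>x. g (x * cos t) * h (x * sin t)) has_field_derivative ?f' x t) (at x within UNIV)"
      by (auto intro!: derivative_eq_intros simp: algebra_simps)
  next
    fix x :: real
    show "(\<lambda>\<theta>. g (x * cos \<theta>) * h (x * sin \<theta>)) integrable_on cbox 0 (2*pi)"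
      using star_integrable[OF cg ch] by simp
  next
    show "continuous_on (UNIV \<times> cbox 0 (2*pi)) (\<lambda>(x, \<theta>). ?f' x \<theta>)"
      by (rule cf')
  qed auto
  let ?d = "\<lambda>x. integral {0..2*pi} (?f' x) / (2*pi)"
  show "(star g h has_real_derivative ?d x) (at x)" for x
    unfolding star_def using L[of x] by (auto intro!: derivative_eq_intros)
  show "continuous_on UNIV ?d"
    using integral_continuous_on_param[OF cf'] by (auto intro!: continuous_intros)
  fix x
  have "x * (integral {0..2*pi} (?f' x) / (2*pi)) = integral {0..2*pi} (\<lambda>\<theta>. x * ?f' x \<theta>) / (2*pi)"
    by simp
  also have "(\<lambda>\<theta>. x * ?f' x \<theta>) = (\<lambda>\<theta>. ((x * cos \<theta>) * g' (x * cos \<theta>)) * h (x * sin \<theta>)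
      + g (x * cos \<theta>) * ((x * sin \<theta>) * h' (x * sin \<theta>)))"
    by (auto simp: algebra_simps)
  also have "integral {0..2*pi} \<dots> = integral {0..2*pi} (\<lambda>\<theta>. ((x * cos \<theta>) * g' (x * cos \<theta>)) * h (x * sin \<theta>))
      + integral {0..2*pi} (\<lambda>\<theta>. g (x * cos \<theta>) * ((x * sin \<theta>) * h' (x * sin \<theta>)))"
    by (intro integral_add star_integrable[of "\<lambda>y. y * g' y"] star_integrable[of _ "\<lambda>y. y * h' y"]
        continuous_intros cg ch g' h')
  finally show "x * ?d x =
      star (\<lambda>y. y * g' y) h x + star g (\<lambda>y. y * h' y) x"
    unfolding star_def by (simp add: add_divide_distrib)
qed

section \<open>Even powers of the cosine over a full period\<close>

lemma has_integral_cos2: "((\<lambda>x. cos x ^ 2) has_integral pi) {0..2*pi}"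
proof -
  have "((\<lambda>x. cos x ^ 2) has_integral ((sin (2*pi) * cos (2*pi) + 2*pi)/2 - (sin 0 * cos 0 + 0)/2)) {0..2*pi}"
  proof (rule fundamental_theorem_of_calculus)
    fix x :: real
    have "((\<lambda>x. (sin x * cos x + x)/2) has_real_derivative (cos x * cos x - sin x * sin x + 1) / 2)
        (at x within {0..2*pi})"
      by (auto intro!: derivative_eq_intros)
    also have "(cos x * cos x - sin x * sin x + 1) / 2 = cos x ^ 2"
      using sin_cos_squared_add[of x] unfolding power2_eq_square by simp
    finally show "((\<lambda>x. (sin x * cos x + x)/2) has_vector_derivative cos x ^ 2) (at x within {0..2*pi})"
      unfolding has_real_derivative_iff_has_vector_derivative .
  qed auto
  then show ?thesis by simp
qed

text \<open>Wallis recursion, read off from the derivative of \<open>sin x * cos x ^ (n+1)\<close>,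
  whose boundary values vanish.\<close>

lemma has_integral_cos_pow:
  assumes "((\<lambda>x. cos x ^ n) has_integral I) {0..2*pi}"
  shows "((\<lambda>x. cos x ^ (n+2)) has_integral (real (n+1) / real (n+2) * I)) {0..2*pi}"
proof -
  have "((\<lambda>x. real (n+2) * cos x ^ (n+2) - real (n+1) * cos x ^ n) has_integral
     (sin (2*pi) * cos (2*pi) ^ (n+1) - sin 0 * cos 0 ^ (n+1))) {0..2*pi}"
  proof (rule fundamental_theorem_of_calculus)
    fix x :: real
    have "((\<lambda>x. sin x * cos x ^ (n+1)) has_real_derivative
        (cos x * cos x ^ (n+1) - sin x * (real (n+1) * cos x ^ n * sin x))) (at x within {0..2*pi})"
      by (auto intro!: derivative_eq_intros simp del: power_Suc)
    also have "cos x * cos x ^ (n+1) - sin x * (real (n+1) * cos x ^ n * sin x) =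
       cos x ^ (n+2) - real (n+1) * cos x ^ n * (sin x)\<^sup>2"
      by (simp add: power2_eq_square)
    also have "\<dots> = real (n+2) * cos x ^ (n+2) - real (n+1) * cos x ^ n"
      by (simp only: sin_squared_eq) (simp add: algebra_simps power2_eq_square)
    finally show "((\<lambda>x. sin x * cos x ^ (n+1)) has_vector_derivative
       real (n+2) * cos x ^ (n+2) - real (n+1) * cos x ^ n) (at x within {0..2*pi})"
      unfolding has_real_derivative_iff_has_vector_derivative .
  qed auto
  from has_integral_add[OF this has_integral_mult_right[OF assms, of "real (n+1)"]]
  have "((\<lambda>x. real (n+2) * cos x ^ (n+2)) has_integral (real (n+1) * I)) {0..2*pi}"
    by simp
  from has_integral_mult_right[OF this, of "1/real (n+2)"] show ?thesis
    by simp
qed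

text \<open>Divided by 2\<pi> these are the means 3/8 and 5/16. Doubled, because
  \<open>Q n + gam \<sigma>\<close> is bounded by twice the weight, they become the contraction
  factors 3/4 and 5/8.\<close>

lemma integral_cos_pow:
  shows "((\<lambda>x. cos x ^ 4) has_integral (3*pi/4)) {0..2*pi}"
    and "((\<lambda>x. cos x ^ 6) has_integral (5*pi/8)) {0..2*pi}"
proof -
  show *: "((\<lambda>x. cos x ^ 4) has_integral (3*pi/4)) {0..2*pi}"
    using has_integral_cos_pow[OF has_integral_cos2] by simp
  show "((\<lambda>x. cos x ^ 6) has_integral (5*pi/8)) {0..2*pi}"
    using has_integral_cos_pow[OF *] by simp
qed

section \<open>Smoothing by the angular convolution\<close>

text \<open>Up to \<pi>/3 the cosine is at least 1/2, so the difference is monotone; beyond, the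
  sine is at least sqrt 3 / 2, hence at least 3/4, while x/3 is at most 2/3. Any positive slope
  would do for integrating the singularity.\<close>

lemma sin_ge_third:
  fixes x :: real
  assumes "0 \<le> x" "x \<le> pi/2"
  shows "x / 3 \<le> sin x"
proof (cases "x \<le> pi/3")
  case True
  have "0 / 3 - sin 0 \<ge> x / 3 - sin x"
  proof (rule DERIV_nonpos_imp_nonincreasing[OF assms(1)])
    fix y assume y: "0 \<le> y" "y \<le> x"
    have "cos (pi/3) \<le> cos y"
      using y True by (intro cos_monotone_0_pi_le) auto
    then have "1/3 - cos y \<le> 0" by (simp add: cos_60)
    moreover have "((\<lambda>x. x / 3 - sin x) has_real_derivative (1/3 - cos y)) (at y)"
      by (auto intro!: derivative_eq_intros)
    ultimately show "\<exists>D. ((\<lambda>x. x / 3 - sin x) has_real_derivative D) (at y) \<and> D \<le> 0" by blast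
  qed
  then show ?thesis by simp
next
  case False
  have "sin (pi/3) \<le> sin x"
    using False assms by (intro sin_monotone_2pi_le) auto
  moreover have "3/2 \<le> sqrt 3"
    by (rule real_le_rsqrt) (simp add: power2_eq_square)
  moreover have "x / 3 \<le> 2/3"
    using assms pi_less_4 by simp
  ultimately show ?thesis by (simp add: sin_60)
qed

text \<open>The modulus of the sine has period \<pi>, so y can be compared with its nearest zero,
  found by rounding \<open>y / pi\<close>.\<close>

lemma abs_sin_ge:
  fixes y :: real
  obtains k :: int where "\<bar>y - of_int k * pi\<bar> \<le> pi/2" "\<bar>y - of_int k * pi\<bar> / 3 \<le> \<bar>sin y\<bar>"
proof -
  define k where "k = round (y / pi)"
  define z where "z = y - of_int k * pi"
  have "\<bar>of_int k - y / pi\<bar> \<le> 1/2"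
    unfolding k_def by (rule of_int_round_abs_le)
  then have "pi * \<bar>of_int k - y / pi\<bar> \<le> pi * (1/2)"
    by (intro mult_left_mono) auto
  also have "pi * \<bar>of_int k - y / pi\<bar> = \<bar>pi * (of_int k - y / pi)\<bar>"
    by (simp add: abs_mult)
  also have "pi * (of_int k - y / pi) = - z"
    by (simp add: z_def algebra_simps)
  finally have z: "\<bar>z\<bar> \<le> pi/2" by simp
  have "\<bar>sin y\<bar> = \<bar>sin (z + of_int k * pi)\<bar>"
    by (simp add: z_def)
  also have "\<dots> = \<bar>sin z\<bar> * \<bar>cos (pi * of_int k)\<bar>"
    unfolding sin_add by (simp add: mult.commute[of _ pi] abs_mult sin_zero_iff_int2)
  also have "\<bar>cos (pi * of_int k)\<bar> = 1"
    by simp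
  also have "\<bar>sin z\<bar> = sin \<bar>z\<bar>"
    using z sin_ge_zero[of "\<bar>z\<bar>"] pi_gt_zero by (cases "z \<ge> 0") auto
  finally have "\<bar>z\<bar> / 3 \<le> \<bar>sin y\<bar>"
    using sin_ge_third[of "\<bar>z\<bar>"] z by simp
  with z that[of k] show ?thesis by (simp add: z_def)
qed

lemma abs_powr_integrable:
  fixes b c u v :: real
  assumes "b < 1"
  shows "(\<lambda>x. \<bar>x - c\<bar> powr (-b)) integrable_on {u..v}"
proof -
  define R where "R = \<bar>u - c\<bar> + \<bar>v - c\<bar>"
  have R: "R \<ge> 0" by (simp add: R_def)
  have 1: "(\<lambda>x. \<bar>x\<bar> powr (-b)) integrable_on {0..R}"
    using integrable_on_powr_from_0[of "-b" R] assms R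
    by (subst integrable_cong[where g="\<lambda>x. x powr (-b)"]) auto
  then have "(\<lambda>x. \<bar>x\<bar> powr (-b)) integrable_on {-R..0}"
    using Henstock_Kurzweil_Integration.integrable_reflect_real
      [where f="\<lambda>x. \<bar>x\<bar> powr (-b)" and a=0 and b=R] by simp
  with 1 have "(\<lambda>x. \<bar>x\<bar> powr (-b)) integrable_on {-R..R}"
    using R by (intro Henstock_Kurzweil_Integration.integrable_combine[of "-R" 0 R]) auto
  then have "(\<lambda>x. \<bar>x\<bar> powr (-b)) integrable_on {u - c..v - c}"
    by (rule integrable_on_subinterval) (auto simp: R_def)
  then show ?thesis
    using integrable_on_shift_cbox[of "\<lambda>x. \<bar>x\<bar> powr (-b)" "-c" u v] by (simp add: o_def)
qed

lemma abs_sin_powr_integrable: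
  fixes b c :: real
  assumes b: "0 \<le> b" "b < 1" and c: "0 \<le> c" "c \<le> pi/2"
  shows "(\<lambda>\<theta>. \<bar>sin (\<theta> - c)\<bar> powr (-b)) integrable_on {0..2*pi}"
proof (rule measurable_bounded_by_integrable_imp_integrable)
  \<comment> \<open>One singular term per zero of the shifted sine. Over [0, 2\<pi>] the nearest
    zero has index between -1 and 2, so the range has slack; the factor 3 bounds
    \<open>3 powr b\<close>.\<close>
  let ?G = "\<lambda>\<theta>. \<Sum>k\<in>{-2..3::int}. 3 * \<bar>\<theta> - (c + of_int k * pi)\<bar> powr (-b)"
  show "?G integrable_on {0..2*pi}"
    by (intro integrable_sum integrable_on_mult_right abs_powr_integrable b) auto
  show "(\<lambda>\<theta>. \<bar>sin (\<theta> - c)\<bar> powr (-b)) \<in> borel_measurable (lebesgue_on {0..2*pi})"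
    by (intro borel_measurable_if_D measurable_completion) measurable
  show "{0..2*pi} \<in> sets lebesgue" by simp
  fix \<theta> assume \<theta>: "\<theta> \<in> {0..2*pi}"
  obtain k :: int where k: "\<bar>\<theta> - c - of_int k * pi\<bar> \<le> pi/2"
    "\<bar>\<theta> - c - of_int k * pi\<bar> / 3 \<le> \<bar>sin (\<theta> - c)\<bar>"
    by (rule abs_sin_ge)
  let ?d = "\<bar>\<theta> - c - of_int k * pi\<bar>"
  have "\<bar>sin (\<theta> - c)\<bar> powr (-b) \<le> 3 * ?d powr (-b)"
  proof (cases "?d = 0")
    \<comment> \<open>At a zero of the sine both sides vanish, because
      \<open>0 powr _ = 0\<close>.\<close>
    case True
    then have "\<theta> - c = of_int k * pi" by simp
    then have "sin (\<theta> - c) = 0" by (auto simp: sin_zero_iff_int2)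
    then show ?thesis by simp
  next
    case False
    then have "\<bar>sin (\<theta> - c)\<bar> powr (-b) \<le> (?d/3) powr (-b)"
      using k(2) b by (intro powr_mono2') auto
    also have "\<dots> = 3 powr b * ?d powr (-b)"
      by (simp add: powr_divide powr_minus field_simps)
    also have "\<dots> \<le> 3 powr 1 * ?d powr (-b)"
      using b by (intro mult_right_mono powr_mono) auto
    finally show ?thesis by simp
  qed
  also have "\<dots> = 3 * \<bar>\<theta> - (c + of_int k * pi)\<bar> powr (-b)"
    by (simp add: algebra_simps)
  also have "\<dots> \<le> ?G \<theta>"
  proof (rule member_le_sum)
    have "of_int k * pi \<le> 2*pi + pi/2" "of_int k * pi \<ge> - pi"
      using abs_le_D1[OF k(1)] abs_le_D2[OF k(1)] \<theta> c unfolding atLeastAtMost_iff by linarith+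
    then have "of_int k * pi \<le> 3 * pi" "(-2) * pi \<le> of_int k * pi"
      using pi_gt_zero by linarith+
    then have "real_of_int k \<le> 3" "-2 \<le> real_of_int k"
      by (simp_all only: mult_le_cancel_right_pos[OF pi_gt_zero])
    then show "k \<in> {-2..3}" by auto
  qed auto
  finally show "norm (\<bar>sin (\<theta> - c)\<bar> powr (-b)) \<le> ?G \<theta>" by simp
qed

text \<open>The two singularities never meet: cosine and sine cannot both be below 1/2 in modulus,
  and a factor based on a value of at least 1/2 is at most 2. So twice the sum dominates the
  product.\<close>

lemma cos_sin_powr_integrable:
  fixes a b :: real
  assumes a: "0 \<le> a" "a < 1" and b: "0 \<le> b" "b < 1"
  shows "(\<lambda>\<theta>. \<bar>cos \<theta>\<bar> powr (-a) * \<bar>sin \<theta>\<bar> powr (-b)) integrable_on {0..2*pi}"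
proof (rule measurable_bounded_by_integrable_imp_integrable)
  have "(\<lambda>\<theta>. \<bar>sin (\<theta> - pi/2)\<bar> powr (-a)) integrable_on {0..2*pi}"
    by (rule abs_sin_powr_integrable) (use a pi_gt_zero in auto)
  moreover have "(\<lambda>\<theta>. \<bar>sin (\<theta> - 0)\<bar> powr (-b)) integrable_on {0..2*pi}"
    by (rule abs_sin_powr_integrable) (use b pi_gt_zero in auto)
  ultimately show "(\<lambda>\<theta>. 2 * (\<bar>cos \<theta>\<bar> powr (-a) + \<bar>sin \<theta>\<bar> powr (-b))) integrable_on {0..2*pi}"
    by (intro integrable_on_mult_right integrable_add) (simp_all add: sin_diff)
  show "(\<lambda>\<theta>. \<bar>cos \<theta>\<bar> powr (-a) * \<bar>sin \<theta>\<bar> powr (-b)) \<in> borel_measurable (lebesgue_on {0..2*pi})"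
    by (intro borel_measurable_if_D measurable_completion) measurable
  show "{0..2*pi} \<in> sets lebesgue" by simp
  have key: "s powr (-r) \<le> 2" if "s \<ge> 1/2" "0 \<le> r" "r < 1" for s r :: real
  proof -
    have "s powr (-r) \<le> (1/2) powr (-r)"
      using that by (intro powr_mono2') auto
    also have "\<dots> = 2 powr r" by (simp add: powr_divide powr_minus)
    also have "\<dots> \<le> 2 powr 1" using that by (intro powr_mono) auto
    finally show ?thesis by simp
  qed
  fix \<theta> :: real
  have "\<bar>cos \<theta>\<bar> \<ge> 1/2 \<or> \<bar>sin \<theta>\<bar> \<ge> 1/2"
  proof (rule ccontr)
    assume "\<not> ?thesis"
    then have "\<bar>cos \<theta>\<bar>^2 \<le> (1/2)^2" "\<bar>sin \<theta>\<bar>^2 \<le> (1/2)^2"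
      using power_mono[of "\<bar>cos \<theta>\<bar>" "1/2" 2] power_mono[of "\<bar>sin \<theta>\<bar>" "1/2" 2] by auto
    with sin_cos_squared_add[of \<theta>] show False by (simp add: power2_eq_square)
  qed
  then show "norm (\<bar>cos \<theta>\<bar> powr (-a) * \<bar>sin \<theta>\<bar> powr (-b)) \<le> 2 * (\<bar>cos \<theta>\<bar> powr (-a) + \<bar>sin \<theta>\<bar> powr (-b))"
  proof
    assume "\<bar>cos \<theta>\<bar> \<ge> 1/2"
    then have "\<bar>cos \<theta>\<bar> powr (-a) * \<bar>sin \<theta>\<bar> powr (-b) \<le> 2 * \<bar>sin \<theta>\<bar> powr (-b)"
      by (intro mult_right_mono key a) auto
    then show ?thesis by (simp add: abs_mult add_increasing)
  next
    assume "\<bar>sin \<theta>\<bar> \<ge> 1/2"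
    then have "\<bar>cos \<theta>\<bar> powr (-a) * \<bar>sin \<theta>\<bar> powr (-b) \<le> \<bar>cos \<theta>\<bar> powr (-a) * 2"
      by (intro mult_left_mono key b) auto
    then show ?thesis by (simp add: abs_mult add_increasing2 mult.commute)
  qed
qed

lemma negligible_sin_cos_zero: "negligible {\<theta>::real. sin \<theta> = 0 \<or> cos \<theta> = 0}"
proof -
  have "{\<theta>::real. sin \<theta> = 0 \<or> cos \<theta> = 0} \<subseteq>
      range (\<lambda>i::int. of_int i * pi) \<union> range (\<lambda>i::int. of_int i * pi + pi/2)"
    by (auto simp: sin_zero_iff_int2 cos_zero_iff_int2)
  then have "countable {\<theta>::real. sin \<theta> = 0 \<or> cos \<theta> = 0}"
    by (rule countable_subset) auto
  then show ?thesis
    unfolding negligible_iff_null_sets by (intro null_sets_completionI countable_imp_null_set_lborel)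
qed

text \<open>A majorant with negative powers of \<open>\<bar>cos \<theta>\<bar>\<close> and
  \<open>\<bar>sin \<theta>\<bar>\<close> takes the value 0 at the singular angles, not infinity, so
  the pointwise bound may fail there. Those angles are negligible and can be left out.\<close>

lemma star_bound':
  assumes g: "continuous_on UNIV g" and h: "continuous_on UNIV h"
    and F: "F integrable_on {0..2*pi}"
    and le: "\<And>\<theta>. sin \<theta> \<noteq> 0 \<Longrightarrow> cos \<theta> \<noteq> 0 \<Longrightarrow> \<bar>g (x * cos \<theta>) * h (x * sin \<theta>)\<bar> \<le> F \<theta>"
  shows "\<bar>star g h x\<bar> \<le> integral {0..2*pi} F / (2*pi)"
proof -
  let ?N = "{\<theta>::real. sin \<theta> = 0 \<or> cos \<theta> = 0}"
  let ?F = "\<lambda>\<theta>. if \<theta> \<in> ?N then \<bar>g (x * cos \<theta>) * h (x * sin \<theta>)\<bar> else F \<theta>"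
  have "?F integrable_on {0..2*pi}"
    by (rule integrable_spike[OF F negligible_sin_cos_zero]) auto
  then have "\<bar>star g h x\<bar> \<le> integral {0..2*pi} ?F / (2*pi)"
    by (rule star_bound[OF g h]) (use le in auto)
  also have "integral {0..2*pi} ?F = integral {0..2*pi} F"
    by (rule integral_spike[OF negligible_sin_cos_zero]) auto
  finally show ?thesis .
qed

text \<open>The truncation by \<open>max 0\<close> reflects that for negative k the power increases
  with \<open>1 + x\<^sup>2\<close>, so shrinking the argument costs nothing.\<close>

lemma powr_scale_bound:
  fixes s x k :: real
  assumes s: "0 < s" "s \<le> 1"
  shows "(1 + (x * s)\<^sup>2) powr (-k) \<le> s powr (- max 0 (2*k)) * (1 + x\<^sup>2) powr (-k)"
proof (cases "k \<ge> 0")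
  case True
  have "s\<^sup>2 * (1 + x\<^sup>2) \<le> 1 + (x * s)\<^sup>2"
    using power_mono[of s 1 2] s by (simp add: algebra_simps)
  moreover have "0 < s\<^sup>2 * (1 + x\<^sup>2)"
    using s by (intro mult_pos_pos add_pos_nonneg) auto
  ultimately have "(1 + (x * s)\<^sup>2) powr (-k) \<le> (s\<^sup>2 * (1 + x\<^sup>2)) powr (-k)"
    using True by (intro powr_mono2') auto
  also have "\<dots> = (s powr 2) powr (-k) * (1 + x\<^sup>2) powr (-k)"
    using s by (simp add: powr_mult)
  finally show ?thesis using True by (simp add: powr_powr)
next
  case False
  have "(x * s)\<^sup>2 \<le> x\<^sup>2"
    using power_mono[of s 1 2] s by (simp add: power_mult_distrib mult_left_le)
  then have "(1 + (x * s)\<^sup>2) powr (-k) \<le> (1 + x\<^sup>2) powr (-k)"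
    using False by (intro powr_mono2) auto
  with False s show ?thesis by simp
qed

text \<open>At infinity the bound is of order |x|^(m - 2k): the exponent counts powers of 1 + x^2,
  and a negative one permits growth. With m = 4 and exponent 2 + e it expresses fourth-order
  vanishing at 0 together with |x|^(-2e) at infinity.\<close>

definition bnd :: "nat \<Rightarrow> real \<Rightarrow> real \<Rightarrow> (real \<Rightarrow> real) \<Rightarrow> bool" where
  "bnd m C k g \<longleftrightarrow> (\<forall>x. \<bar>g x\<bar> \<le> C * \<bar>x\<bar> ^ m * (1 + x\<^sup>2) powr (- k))"

lemma bndD: "bnd m C k g \<Longrightarrow> \<bar>g x\<bar> \<le> C * \<bar>x\<bar> ^ m * (1 + x\<^sup>2) powr (- k)"
  by (simp add: bnd_def)

lemma bnd_mono:
  assumes "bnd m C k g" "0 \<le> C" "C \<le> C'" "k' \<le> k"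
  shows "bnd m C' k' g"
  unfolding bnd_def
proof
  fix x
  have "\<bar>g x\<bar> \<le> C * \<bar>x\<bar> ^ m * (1 + x\<^sup>2) powr (- k)" using assms bndD by auto
  also have "\<dots> \<le> C' * \<bar>x\<bar> ^ m * (1 + x\<^sup>2) powr (- k')"
    using assms by (intro mult_mono powr_mono) auto
  finally show "\<bar>g x\<bar> \<le> C' * \<bar>x\<bar> ^ m * (1 + x\<^sup>2) powr (- k')" .
qed

lemma bnd_add:
  assumes "bnd m C k g" "bnd m D k h"
  shows "bnd m (C + D) k (\<lambda>x. g x + h x)"
  unfolding bnd_def
proof
  fix x
  show "\<bar>g x + h x\<bar> \<le> (C + D) * \<bar>x\<bar> ^ m * (1 + x\<^sup>2) powr (- k)"
    using bndD[OF assms(1), of x] bndD[OF assms(2), of x] abs_triangle_ineq[of "g x" "h x"]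
    by (simp add: algebra_simps)
qed

text \<open>The angular average gains the decay of both factors, because
  \<open>1 + (x cos \<theta>)\<^sup>2 \<ge> cos\<^sup>2 \<theta> (1 + x\<^sup>2)\<close> and the resulting negative powers
  of \<open>\<bar>cos \<theta>\<bar>\<close> and \<open>\<bar>sin \<theta>\<bar>\<close> stay integrable.\<close>

lemma star_smoothing:
  fixes k l :: real
  assumes k: "k < 5/2" and l: "l < 1/2"
  obtains K where "K \<ge> 0"
    "\<And>C D g h. \<lbrakk>continuous_on UNIV g; continuous_on UNIV h; bnd 4 C k g; bnd 0 D l h; 0 \<le> C; 0 \<le> D\<rbrakk>
       \<Longrightarrow> bnd 4 (K * C * D) (k + l) (star g h)"
proof -
  \<comment> \<open>The factor \<open>\<bar>x * cos \<theta>\<bar>^4\<close> pays for four powers of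
    the singularity at cos \<theta> = 0 and leaves \<open>2*k - 4\<close>; nothing pays for the
    sine. Both exponents must stay below 1, which is where the limits 5/2 and 1/2 come from.\<close>
  define a where "a = max 0 (2*k - 4)"
  define b where "b = max 0 (2*l)"
  define F where "F = (\<lambda>\<theta>::real. \<bar>cos \<theta>\<bar> powr (-a) * \<bar>sin \<theta>\<bar> powr (-b))"
  have a: "0 \<le> a" "a < 1" and b: "0 \<le> b" "b < 1"
    using k l by (auto simp: a_def b_def)
  have F: "F integrable_on {0..2*pi}"
    unfolding F_def by (rule cos_sin_powr_integrable[OF a b])
  define K where "K = integral {0..2*pi} F / (2*pi)"
  have "K \<ge> 0"
    unfolding K_def by (intro divide_nonneg_pos integral_nonneg[OF F]) (auto simp: F_def)
  moreover have "bnd 4 (K * C * D) (k + l) (star g h)"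
    if g: "continuous_on UNIV g" and h: "continuous_on UNIV h"
      and gb: "bnd 4 C k g" and hb: "bnd 0 D l h" and C: "0 \<le> C" and D: "0 \<le> D" for C D g h
    unfolding bnd_def
  proof
    fix x :: real
    let ?E = "C * D * (\<bar>x\<bar>^4 * (1 + x\<^sup>2) powr (-(k+l)))"
    have "\<bar>star g h x\<bar> \<le> integral {0..2*pi} (\<lambda>\<theta>. ?E * F \<theta>) / (2*pi)"
    proof (rule star_bound'[OF g h])
      show "(\<lambda>\<theta>. ?E * F \<theta>) integrable_on {0..2*pi}"
        by (rule integrable_on_mult_right[OF F])
      fix \<theta> :: real assume nz: "sin \<theta> \<noteq> 0" "cos \<theta> \<noteq> 0"
      let ?c = "\<bar>cos \<theta>\<bar>" and ?s = "\<bar>sin \<theta>\<bar>"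
      have c: "0 < ?c" "?c \<le> 1" and s: "0 < ?s" "?s \<le> 1" using nz by auto
      have "?c ^ 4 * ?c powr (- max 0 (2*k)) = ?c powr (4 - max 0 (2*k))"
        using c by (simp add: powr_diff powr_minus field_simps)
      also have "\<dots> \<le> ?c powr (-a)"
        using c by (intro powr_mono') (auto simp: a_def)
      finally have cc: "?c ^ 4 * ?c powr (- max 0 (2*k)) \<le> ?c powr (-a)" .
      have "\<bar>g (x * cos \<theta>)\<bar> \<le> C * \<bar>x * cos \<theta>\<bar>^4 * (1 + (x * ?c)\<^sup>2) powr (-k)"
        using bndD[OF gb, of "x * cos \<theta>"] by (simp add: power_mult_distrib)
      also have "\<dots> \<le> C * \<bar>x * cos \<theta>\<bar>^4 * (?c powr (- max 0 (2*k)) * (1 + x\<^sup>2) powr (-k))"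
        using C c by (intro mult_left_mono powr_scale_bound) auto
      also have "\<dots> = C * \<bar>x\<bar>^4 * (1 + x\<^sup>2) powr (-k) * (?c ^ 4 * ?c powr (- max 0 (2*k)))"
        by (simp add: abs_mult power_mult_distrib)
      also have "\<dots> \<le> C * \<bar>x\<bar>^4 * (1 + x\<^sup>2) powr (-k) * ?c powr (-a)"
        using C by (intro mult_left_mono cc) auto
      finally have 1: "\<bar>g (x * cos \<theta>)\<bar> \<le> C * \<bar>x\<bar>^4 * (1 + x\<^sup>2) powr (-k) * ?c powr (-a)" .
      have "\<bar>h (x * sin \<theta>)\<bar> \<le> D * (1 + (x * ?s)\<^sup>2) powr (-l)"
        using bndD[OF hb, of "x * sin \<theta>"] by (simp add: power_mult_distrib)
      also have "\<dots> \<le> D * (?s powr (-b) * (1 + x\<^sup>2) powr (-l))"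
        using D s unfolding b_def by (intro mult_left_mono powr_scale_bound) auto
      finally have 2: "\<bar>h (x * sin \<theta>)\<bar> \<le> D * (?s powr (-b) * (1 + x\<^sup>2) powr (-l))" .
      have "\<bar>g (x * cos \<theta>) * h (x * sin \<theta>)\<bar> \<le>
        (C * \<bar>x\<bar>^4 * (1 + x\<^sup>2) powr (-k) * ?c powr (-a)) * (D * (?s powr (-b) * (1 + x\<^sup>2) powr (-l)))"
        unfolding abs_mult using C by (intro mult_mono 1 2) auto
      also have "\<dots> = ?E * F \<theta>"
      proof -
        have "(1 + x\<^sup>2) powr (-(k+l)) = (1 + x\<^sup>2) powr (-k) * (1 + x\<^sup>2) powr (-l)"
          by (simp flip: powr_add)
        then show ?thesis by (simp add: F_def)
      qed
      finally show "\<bar>g (x * cos \<theta>) * h (x * sin \<theta>)\<bar> \<le> ?E * F \<theta>" .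
    qed
    also have "\<dots> = K * C * D * \<bar>x\<bar>^4 * (1 + x\<^sup>2) powr (-(k+l))"
      by (simp add: K_def)
    finally show "\<bar>star g h x\<bar> \<le> K * C * D * \<bar>x\<bar>^4 * (1 + x\<^sup>2) powr (-(k+l))" .
  qed
  ultimately show ?thesis by (rule that)
qed

text \<open>The coefficients of \<open>(1 - z) powr (- 3/4)\<close>, characterised by
  \<open>(n + 1) p\<^sub>n\<^sub>+\<^sub>1 = 3/4 (p\<^sub>0 + \<dots> + p\<^sub>n)\<close>.\<close>

definition pc :: "nat \<Rightarrow> real" where
  "pc n = pochhammer (3/4) n / fact n"

lemma pc_pos: "0 < pc n"
  unfolding pc_def by (intro divide_pos_pos pochhammer_pos) auto

lemma pc_Suc: "real (Suc n) * pc (Suc n) = (3/4 + real n) * pc n"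
  by (simp add: pc_def pochhammer_Suc fact_Suc del: of_nat_Suc)

text \<open>Averaging \<open>pc\<close> over the indices up to n multiplies by 4/3 and shifts the
  index. The contraction factor 3/4 cancels this exactly, so a bound by a multiple of
  \<open>pc n\<close> passes through Wild's recursion with the same multiple.\<close>

lemma sum_pc: "(\<Sum>k\<le>n. pc k) = 4/3 * (real (Suc n) * pc (Suc n))"
proof (induction n)
  case 0
  show ?case using pc_Suc[of 0] by simp
next
  case (Suc n)
  then show ?case using pc_Suc[of "Suc n"] by (simp add: algebra_simps)
qed

text \<open>At \<open>z = 1 - exp (- t)\<close> the sum is exp (3 t / 4), which the prefactor exp (-
  t) of Wild's series turns into the final rate.\<close>

lemma pc_sums:
  assumes "0 \<le> z" "z < (1::real)"
  shows "(\<lambda>n. pc n * z ^ n) sums ((1 - z) powr (- 3/4))"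
proof -
  have "(\<lambda>n. ((-3/4) gchoose n) * (- z) ^ n) sums ((1 + (- z)) powr (- 3/4))"
    by (rule gen_binomial_real) (use assms in auto)
  also have "(\<lambda>n. ((-3/4) gchoose n) * (- z) ^ n) = (\<lambda>n. pc n * z ^ n)"
    by (simp add: gbinomial_pochhammer pc_def fun_eq_iff power_mult_distrib[symmetric])
  finally show ?thesis by simp
qed

section \<open>The coefficients of Wild's series\<close>

text \<open>Indices start at \<open>0\<close>: \<open>wild A n\<close> is the paper's coefficient of index \<open>n + 1\<close>.\<close>

fun wild :: "(real \<Rightarrow> real) \<Rightarrow> nat \<Rightarrow> real \<Rightarrow> real" where
  "wild A 0 = A"
| "wild A (Suc n) = (\<lambda>x. (\<Sum>k\<le>n. star (wild A k) (wild A (n - k)) x) / real (Suc n))"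

lemma continuous_wild:
  assumes "continuous_on UNIV A"
  shows "continuous_on UNIV (wild A n)"
proof (induction n rule: less_induct)
  case (less n)
  show ?case
  proof (cases n)
    case (Suc m)
    then show ?thesis using less by (auto intro!: continuous_intros simp del: of_nat_Suc)
  qed (use assms in simp)
qed

lemma sum_atMost_rev: "(\<Sum>k\<le>n. f (n - k)) = (\<Sum>k\<le>(n::nat). f k)"
  by (rule sum.reindex_bij_witness[where i="\<lambda>k. n - k" and j="\<lambda>k. n - k"]) auto

section \<open>A weight preserved by the angular convolution\<close>

definition wgt :: "real \<Rightarrow> real \<Rightarrow> real \<Rightarrow> real" where
  "wgt c q x = (1 + c * x\<^sup>2) powr (- q)"

lemma wgt_nonneg: "0 \<le> wgt c q x"
  by (simp add: wgt_def)

text \<open>This is (1 + a)(1 + b) \<ge> 1 + a + b with a + b = c x^2. It matters that the constant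
  is 1: a bound by the weight survives any number of convolutions, whereas a larger constant would
  be compounded as n grows.\<close>

lemma wgt_cos_sin:
  assumes "0 \<le> c" "0 \<le> q"
  shows "wgt c q (x * cos \<theta>) * wgt c q (x * sin \<theta>) \<le> wgt c q x"
proof -
  let ?a = "c * (x * cos \<theta>)\<^sup>2" and ?b = "c * (x * sin \<theta>)\<^sup>2"
  have "?a + ?b = c * x\<^sup>2 * ((cos \<theta>)\<^sup>2 + (sin \<theta>)\<^sup>2)"
    unfolding power_mult_distrib distrib_left by (simp only: mult.assoc)
  then have ab: "?a + ?b = c * x\<^sup>2" by simp
  have "0 \<le> ?a" "0 \<le> ?b" using assms by auto
  then have "1 + c * x\<^sup>2 \<le> (1 + ?a) * (1 + ?b)"
    using ab mult_nonneg_nonneg[of ?a ?b] by (simp add: algebra_simps)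
  then have "((1 + ?a) * (1 + ?b)) powr (-q) \<le> (1 + c * x\<^sup>2) powr (-q)"
    using assms by (intro powr_mono2') (auto intro!: add_pos_nonneg)
  then show ?thesis
    using \<open>0 \<le> ?a\<close> \<open>0 \<le> ?b\<close> by (simp add: wgt_def powr_mult)
qed

text \<open>The power of x in the first factor is averaged over the angle, and the mean of cos^m is
  the contraction. Two powers are treated together for the sake of \<open>V\<close>, whose bound
  mixes the orders 4 and 6.\<close>

lemma star_wgt_bound2:
  assumes g: "continuous_on UNIV g" and h: "continuous_on UNIV h"
    and gb: "\<And>y. \<bar>g y\<bar> \<le> (C * \<bar>y\<bar> ^ m + C' * \<bar>y\<bar> ^ m') * wgt c q y"
    and hb: "\<And>y. \<bar>h y\<bar> \<le> D * wgt c q y"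
    and "0 \<le> C" "0 \<le> C'" "0 \<le> D" "0 \<le> c" "0 \<le> q" "even m" "even m'"
    and I: "((\<lambda>\<theta>. cos \<theta> ^ m) has_integral I) {0..2*pi}"
    and I': "((\<lambda>\<theta>. cos \<theta> ^ m') has_integral I') {0..2*pi}"
  shows "\<bar>star g h x\<bar> \<le> D * (C * (I / (2*pi)) * \<bar>x\<bar> ^ m + C' * (I' / (2*pi)) * \<bar>x\<bar> ^ m') * wgt c q x"
proof -
  let ?E = "C * D * \<bar>x\<bar> ^ m * wgt c q x" and ?E' = "C' * D * \<bar>x\<bar> ^ m' * wgt c q x"
  have F: "((\<lambda>\<theta>. ?E * cos \<theta> ^ m + ?E' * cos \<theta> ^ m') has_integral (?E * I + ?E' * I')) {0..2*pi}"
    by (intro has_integral_add has_integral_mult_right I I')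
  have "\<bar>star g h x\<bar> \<le> integral {0..2*pi} (\<lambda>\<theta>. ?E * cos \<theta> ^ m + ?E' * cos \<theta> ^ m') / (2*pi)"
  proof (rule star_bound[OF g h has_integral_integrable[OF F]])
    fix \<theta>
    let ?P = "C * \<bar>x * cos \<theta>\<bar> ^ m + C' * \<bar>x * cos \<theta>\<bar> ^ m'"
    have "\<bar>g (x * cos \<theta>) * h (x * sin \<theta>)\<bar> \<le>
       (?P * wgt c q (x * cos \<theta>)) * (D * wgt c q (x * sin \<theta>))"
      unfolding abs_mult[of "g _"] using assms by (intro mult_mono gb hb) (auto simp: wgt_nonneg)
    also have "\<dots> = ?P * D * (wgt c q (x * cos \<theta>) * wgt c q (x * sin \<theta>))"
      by simp
    also have "\<dots> \<le> ?P * D * wgt c q x"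
      using assms by (intro mult_left_mono wgt_cos_sin) auto
    also have "\<dots> = ?E * cos \<theta> ^ m + ?E' * cos \<theta> ^ m'"
      using \<open>even m\<close> \<open>even m'\<close> by (simp add: abs_mult power_mult_distrib power_even_abs algebra_simps)
    finally show "\<bar>g (x * cos \<theta>) * h (x * sin \<theta>)\<bar> \<le> ?E * cos \<theta> ^ m + ?E' * cos \<theta> ^ m'" .
  qed
  also have "integral {0..2*pi} (\<lambda>\<theta>. ?E * cos \<theta> ^ m + ?E' * cos \<theta> ^ m') = ?E * I + ?E' * I'"
    by (rule integral_unique[OF F])
  also have "(?E * I + ?E' * I') / (2*pi) =
      D * (C * (I / (2*pi)) * \<bar>x\<bar> ^ m + C' * (I' / (2*pi)) * \<bar>x\<bar> ^ m') * wgt c q x"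
    by (simp add: add_divide_distrib algebra_simps)
  finally show ?thesis .
qed

lemma star_wgt_bound:
  assumes "continuous_on UNIV g" "continuous_on UNIV h"
    and "\<And>y. \<bar>g y\<bar> \<le> C * \<bar>y\<bar> ^ m * wgt c q y" "\<And>y. \<bar>h y\<bar> \<le> D * wgt c q y"
    and "0 \<le> C" "0 \<le> D" "0 \<le> c" "0 \<le> q" "even m"
    and "((\<lambda>\<theta>. cos \<theta> ^ m) has_integral I) {0..2*pi}"
  shows "\<bar>star g h x\<bar> \<le> D * (C * (I / (2*pi)) * \<bar>x\<bar> ^ m) * wgt c q x"
  using star_wgt_bound2[of g h C m 0 m c q D I I x] assms by simp

text \<open>Powers of cosine and sine are replaced by 1, so nothing contracts. For order 0 nothing
  is lost by this, and source terms can afford it.\<close>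

lemma star_wgt_bound_crude:
  assumes g: "continuous_on UNIV g" and h: "continuous_on UNIV h"
    and gb: "\<And>y. \<bar>g y\<bar> \<le> C * \<bar>y\<bar> ^ m * wgt c q y" and hb: "\<And>y. \<bar>h y\<bar> \<le> D * \<bar>y\<bar> ^ l * wgt c q y"
    and "0 \<le> C" "0 \<le> D" "0 \<le> c" "0 \<le> q"
  shows "\<bar>star g h x\<bar> \<le> C * D * \<bar>x\<bar> ^ (m + l) * wgt c q x"
proof -
  let ?E = "C * D * \<bar>x\<bar> ^ (m + l) * wgt c q x"
  have "\<bar>star g h x\<bar> \<le> integral {0..2*pi} (\<lambda>\<theta>. ?E) / (2*pi)"
  proof (rule star_bound[OF g h integrable_const_ivl])
    fix \<theta>
    have "\<bar>g (x * cos \<theta>) * h (x * sin \<theta>)\<bar> \<le>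
       (C * \<bar>x * cos \<theta>\<bar> ^ m * wgt c q (x * cos \<theta>)) * (D * \<bar>x * sin \<theta>\<bar> ^ l * wgt c q (x * sin \<theta>))"
      unfolding abs_mult[of "g _"] using assms by (intro mult_mono gb hb) (auto simp: wgt_nonneg)
    also have "\<dots> = (C * D * \<bar>x * cos \<theta>\<bar> ^ m * \<bar>x * sin \<theta>\<bar> ^ l) * (wgt c q (x * cos \<theta>) * wgt c q (x * sin \<theta>))"
      by simp
    also have "\<dots> \<le> (C * D * \<bar>x\<bar> ^ m * \<bar>x\<bar> ^ l) * wgt c q x"
      using assms by (intro mult_mono power_mono wgt_cos_sin)
        (auto simp: abs_mult mult_left_le wgt_nonneg)
    finally show "\<bar>g (x * cos \<theta>) * h (x * sin \<theta>)\<bar> \<le> ?E"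
      by (simp add: power_add)
  qed
  then show ?thesis by simp
qed

section \<open>The Gaussian fixed point\<close>

definition gam :: "real \<Rightarrow> real \<Rightarrow> real" where
  "gam \<sigma> x = exp (- (\<sigma>\<^sup>2 * x\<^sup>2 / 2))"

lemma gam_deriv: "(gam \<sigma> has_real_derivative (- (\<sigma>\<^sup>2 * x) * gam \<sigma> x)) (at x)"
  unfolding gam_def by (auto intro!: derivative_eq_intros)

lemma continuous_gam [continuous_intros]: "continuous_on S (gam \<sigma>)"
  unfolding gam_def by (intro continuous_intros) auto

lemma star_gam: "star (gam \<sigma>) (gam \<sigma>) x = gam \<sigma> x"
proof -
  have "gam \<sigma> (x * cos \<theta>) * gam \<sigma> (x * sin \<theta>) = gam \<sigma> x" for \<theta>
  proof -
    have "\<sigma>\<^sup>2 * (x * cos \<theta>)\<^sup>2 / 2 + \<sigma>\<^sup>2 * (x * sin \<theta>)\<^sup>2 / 2 = \<sigma>\<^sup>2 * x\<^sup>2 / 2 * ((cos \<theta>)\<^sup>2 + (sin \<theta>)\<^sup>2)"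
      unfolding power_mult_distrib distrib_left by simp
    then show ?thesis by (simp add: gam_def exp_add[symmetric])
  qed
  then show ?thesis by (simp add: star_def)
qed

text \<open>Decay of any order comes from \<open>(y / m)^m \<le> exp y\<close> at
  \<open>y = s * (1 + x\<^sup>2)\<close>; completing \<open>s * x\<^sup>2\<close> to y costs the
  factor \<open>exp s\<close>. Exponent \<open>l + 1\<close> is established first, because x times
  the derivative carries an additional x^2.\<close>

lemma gam_bnd:
  assumes "\<sigma> \<noteq> 0"
  obtains C where "C \<ge> 0" "bnd 0 C l (gam \<sigma>)" "bnd 0 C l (\<lambda>x. x * (- (\<sigma>\<^sup>2 * x) * gam \<sigma> x))"
proof -
  define n where "n = nat \<lceil>l + 2\<rceil>"
  define s where "s = \<sigma>\<^sup>2 / 2"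
  have s: "s > 0" using assms by (simp add: s_def)
  have n: "real n \<ge> l + 1" "n > 0 \<or> l \<le> -2" unfolding n_def by linarith+
  define m where "m = Suc n"
  have m: "real m \<ge> l + 1" "m > 0" using n by (auto simp: m_def)
  define G where "G = exp s * (real m / s) ^ m"
  have G: "G \<ge> 0" using s by (simp add: G_def)
  have *: "gam \<sigma> x \<le> G * (1 + x\<^sup>2) powr (- (l + 1))" for x
  proof -
    let ?y = "s * (1 + x\<^sup>2)"
    have pos: "1 + x\<^sup>2 > 0" by (intro add_pos_nonneg) auto
    have y: "?y > 0" using s pos by simp
    have "(?y / real m) ^ m \<le> (1 + ?y / real m) ^ m"
      using y by (intro power_mono) auto
    also have "\<dots> \<le> exp ?y"
      by (rule exp_ge_one_plus_x_over_n_power_n) (use m y in auto)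
    finally have "exp (- ?y) \<le> 1 / (?y / real m) ^ m"
      using y m unfolding exp_minus inverse_eq_divide by (intro divide_left_mono mult_pos_pos) auto
    also have "\<dots> = (real m / s) ^ m * (1 + x\<^sup>2) powr (- real m)"
      unfolding power_divide power_mult_distrib powr_minus powr_realpow[OF pos] inverse_eq_divide
      by simp
    also have "\<dots> \<le> (real m / s) ^ m * (1 + x\<^sup>2) powr (- (l + 1))"
      using m s by (intro mult_left_mono powr_mono) auto
    finally have "exp s * exp (- ?y) \<le> exp s * ((real m / s) ^ m * (1 + x\<^sup>2) powr (- (l + 1)))"
      by (rule mult_left_mono) auto
    moreover have "gam \<sigma> x = exp s * exp (- ?y)"
      by (simp add: gam_def s_def exp_add[symmetric] algebra_simps)
    ultimately show ?thesis by (simp add: G_def mult.assoc)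
  qed
  have **: "(1 + x\<^sup>2) * (1 + x\<^sup>2) powr (- (l + 1)) = (1 + x\<^sup>2) powr (- l)" for x :: real
  proof -
    have "1 + x\<^sup>2 > 0" by (intro add_pos_nonneg) auto
    then have "(1 + x\<^sup>2) * (1 + x\<^sup>2) powr (- (l + 1)) = (1 + x\<^sup>2) powr 1 * (1 + x\<^sup>2) powr (- (l + 1))"
      by simp
    also have "\<dots> = (1 + x\<^sup>2) powr (1 + - (l + 1))" by (rule powr_add[symmetric])
    finally show ?thesis by simp
  qed
  show ?thesis
  proof (rule that[of "G * (1 + \<sigma>\<^sup>2)"])
    show "G * (1 + \<sigma>\<^sup>2) \<ge> 0" using G by simp
    show "bnd 0 (G * (1 + \<sigma>\<^sup>2)) l (gam \<sigma>)"
      unfolding bnd_def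
    proof
      fix x
      have "gam \<sigma> x \<le> G * (1 + x\<^sup>2) powr (- (l + 1))" by (rule *)
      also have "\<dots> \<le> (G * (1 + \<sigma>\<^sup>2)) * (1 + x\<^sup>2) powr (- l)"
        using G by (intro mult_mono powr_mono) (auto simp: algebra_simps)
      finally show "\<bar>gam \<sigma> x\<bar> \<le> G * (1 + \<sigma>\<^sup>2) * \<bar>x\<bar> ^ 0 * (1 + x\<^sup>2) powr - l"
        by (simp add: gam_def)
    qed
    show "bnd 0 (G * (1 + \<sigma>\<^sup>2)) l (\<lambda>x. x * (- (\<sigma>\<^sup>2 * x) * gam \<sigma> x))"
      unfolding bnd_def
    proof
      fix x
      have "\<bar>x * (- (\<sigma>\<^sup>2 * x) * gam \<sigma> x)\<bar> = \<sigma>\<^sup>2 * x\<^sup>2 * gam \<sigma> x"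
        by (simp add: abs_mult gam_def power2_eq_square)
      also have "\<dots> \<le> (1 + \<sigma>\<^sup>2) * (1 + x\<^sup>2) * (G * (1 + x\<^sup>2) powr (- (l + 1)))"
        by (intro mult_mono *) (auto simp: gam_def)
      also have "\<dots> = G * (1 + \<sigma>\<^sup>2) * ((1 + x\<^sup>2) * (1 + x\<^sup>2) powr (- (l + 1)))"
        by simp
      finally show "\<bar>x * (- (\<sigma>\<^sup>2 * x) * gam \<sigma> x)\<bar> \<le> G * (1 + \<sigma>\<^sup>2) * \<bar>x\<bar> ^ 0 * (1 + x\<^sup>2) powr - l"
        unfolding ** by simp
    qed
  qed
qed

lemma pc_mono: "m \<le> n \<Longrightarrow> pc n \<le> pc m"
proof (induction n rule: dec_induct)
  case (step n)
  have "real (Suc n) * pc (Suc n) \<le> real (Suc n) * pc n"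
    unfolding pc_Suc using pc_pos[of n] by (intro mult_right_mono) auto
  then have "pc (Suc n) \<le> pc n"
    by (simp only: mult_le_cancel_left_pos of_nat_0_less_iff zero_less_Suc)
  with step show ?case by simp
qed simp

lemma pc_le_1: "pc n \<le> 1"
  using pc_mono[of 0 n] by (simp add: pc_def)

lemma avg_pc_bound:
  assumes "\<And>k. k \<le> n \<Longrightarrow> \<bar>F k\<bar> \<le> pc k * G"
  shows "\<bar>(\<Sum>k\<le>n. F k) / real (Suc n)\<bar> \<le> 4/3 * pc (Suc n) * G"
proof -
  have "\<bar>\<Sum>k\<le>n. F k\<bar> \<le> (\<Sum>k\<le>n. pc k * G)"
    by (rule order_trans[OF sum_abs sum_mono]) (use assms in auto)
  also have "\<dots> = 4/3 * (real (Suc n) * pc (Suc n)) * G"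
    by (simp add: sum_distrib_right[symmetric] sum_pc)
  finally have "\<bar>\<Sum>k\<le>n. F k\<bar> / real (Suc n) \<le> (4/3 * (real (Suc n) * pc (Suc n)) * G) / real (Suc n)"
    by (rule divide_right_mono) simp
  then show ?thesis by (simp add: abs_divide del: of_nat_Suc)
qed

lemma bnd_avg_pc:
  assumes "\<And>k. k \<le> n \<Longrightarrow> bnd m (C * pc k) l (F k)"
  shows "bnd m (4/3 * C * pc (Suc n)) l (\<lambda>x. (\<Sum>k\<le>n. F k x) / real (Suc n))"
  unfolding bnd_def
proof
  fix x
  have "\<bar>(\<Sum>k\<le>n. F k x) / real (Suc n)\<bar> \<le> 4/3 * pc (Suc n) * (C * \<bar>x\<bar> ^ m * (1 + x\<^sup>2) powr - l)"
    by (rule avg_pc_bound) (use bndD[OF assms] in \<open>auto simp: mult_ac\<close>)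
  then show "\<bar>(\<Sum>k\<le>n. F k x) / real (Suc n)\<bar> \<le> 4/3 * C * pc (Suc n) * \<bar>x\<bar> ^ m * (1 + x\<^sup>2) powr - l"
    by (simp add: mult_ac)
qed

lemma bnd_4_0:
  assumes "bnd 4 C (2 + e) g" "0 \<le> C"
  shows "bnd 0 C e g"
  unfolding bnd_def
proof
  fix x :: real
  have pos: "1 + x\<^sup>2 > 0" by (intro add_pos_nonneg) auto
  have "\<bar>g x\<bar> \<le> C * \<bar>x\<bar> ^ 4 * (1 + x\<^sup>2) powr (-(2 + e))" by (rule bndD[OF assms(1)])
  also have "\<bar>x\<bar> ^ 4 = (x\<^sup>2)\<^sup>2" by (simp flip: power_mult)
  also have "\<dots> \<le> (1 + x\<^sup>2)\<^sup>2" by (intro power_mono) auto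
  also have "C * (1 + x\<^sup>2)\<^sup>2 * (1 + x\<^sup>2) powr (-(2 + e)) = C * ((1 + x\<^sup>2) powr 2 * (1 + x\<^sup>2) powr (-(2 + e)))"
    using pos by simp
  also have "(1 + x\<^sup>2) powr 2 * (1 + x\<^sup>2) powr (-(2 + e)) = (1 + x\<^sup>2) powr (-e)"
    by (simp only: powr_add[symmetric]) simp
  finally show "\<bar>g x\<bar> \<le> C * \<bar>x\<bar> ^ 0 * (1 + x\<^sup>2) powr (- e)"
    using assms(2) by (simp add: mult_left_mono mult_right_mono)
qed

text \<open>The analytic input on the even part \<open>A\<close> of the initial transform, separated
  from the density it comes from. A single constant \<open>M\<close> serves all bounds, and
  \<open>q \<le> 3/8\<close> keeps \<open>2 + q\<close> and \<open>q\<close> within the range of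
  \<open>star_smoothing\<close>.\<close>

locale kac_fourier =
  fixes A A' :: "real \<Rightarrow> real" and \<sigma> c q M :: real
  assumes A_deriv: "(A has_real_derivative A' x) (at x)"
    and A'_cont: "continuous_on UNIV A'"
    and \<sigma>_nz: "\<sigma> \<noteq> 0" and \<sigma>_le: "\<sigma>\<^sup>2 \<le> M"
    and c: "0 < c" "c \<le> 1" and q: "0 < q" "q \<le> 3/8"
    and A_wgt: "\<bar>A x\<bar> \<le> wgt c q x"
    and gam_wgt: "gam \<sigma> x \<le> wgt c q x"
    and A_gam: "\<bar>A x - gam \<sigma> x\<bar> \<le> M * \<bar>x\<bar>^4 * wgt c q x"
    and A'_bound: "\<bar>A' x\<bar> \<le> M"
    and A'_wgt: "\<bar>x * A' x\<bar> \<le> M * \<bar>x\<bar>^2 * wgt c q x"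
    and A'_gam: "\<bar>x * A' x - x * (- (\<sigma>\<^sup>2 * x) * gam \<sigma> x)\<bar> \<le> M * \<bar>x\<bar>^4 * wgt c q x"
begin

abbreviation Q :: "nat \<Rightarrow> real \<Rightarrow> real" where "Q \<equiv> wild A"

text \<open>The operator \<open>x d/dx\<close> is a derivation for \<open>star\<close>, so \<open>D\<close> obeys the same kind of recursion as \<open>Q\<close>.\<close>

definition D :: "nat \<Rightarrow> real \<Rightarrow> real" where "D n x = x * deriv (Q n) x"

definition G :: "real \<Rightarrow> real" where "G x = x * (- (\<sigma>\<^sup>2 * x) * gam \<sigma> x)"

definition U :: "nat \<Rightarrow> real \<Rightarrow> real" where "U n x = Q n x - gam \<sigma> x"

definition V :: "nat \<Rightarrow> real \<Rightarrow> real" where "V n x = D n x - G x"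

lemma M_nonneg: "0 \<le> M"
  using \<sigma>_le by (meson order_trans zero_le_power2)

text \<open>The claims are proved in one induction because they feed each other: the recursion for
  \<open>D\<close> needs differentiable coefficients, and differentiating under the angular integral
  at the next index needs continuous derivatives.\<close>

lemma Q_deriv_aux:
  "(\<forall>x. (Q n has_real_derivative deriv (Q n) x) (at x)) \<and> continuous_on UNIV (deriv (Q n)) \<and>
   (\<forall>m x. n = Suc m \<longrightarrow> D n x = (\<Sum>k\<le>m. star (D k) (Q (m - k)) x + star (Q k) (D (m - k)) x) / real (Suc m))"
proof (induction n rule: less_induct)
  case (less n)
  have *: ?case if "\<And>x. (Q n has_real_derivative d x) (at x)" "continuous_on UNIV d"
    "\<And>m x. n = Suc m \<Longrightarrow> x * d x = (\<Sum>k\<le>m. star (D k) (Q (m - k)) x + star (Q k) (D (m - k)) x) / real (Suc m)" for d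
  proof -
    have "deriv (Q n) = d" using that(1) by (intro ext DERIV_imp_deriv)
    then show ?thesis using that unfolding D_def by auto
  qed
  show ?case
  proof (cases n)
    case 0
    then show ?thesis using A_deriv A'_cont by (intro *[of A']) auto
  next
    case (Suc m)
    have IH: "(Q k has_real_derivative deriv (Q k) x) (at x)" "continuous_on UNIV (deriv (Q k))"
      if "k \<le> m" for k x using less[of k] that Suc by auto
    have "\<exists>d. (\<forall>x. (star (Q k) (Q (m - k)) has_real_derivative d x) (at x)) \<and> continuous_on UNIV d \<and>
       (\<forall>x. x * d x = star (D k) (Q (m - k)) x + star (Q k) (D (m - k)) x)" if km: "k \<le> m" for k
    proof -
      obtain d where "\<And>x. (star (Q k) (Q (m - k)) has_real_derivative d x) (at x)" "continuous_on UNIV d"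
        "\<And>x. x * d x = star (\<lambda>y. y * deriv (Q k) y) (Q (m - k)) x + star (Q k) (\<lambda>y. y * deriv (Q (m - k)) y) x"
        using DERIV_star[OF IH(1)[OF km] IH(2)[OF km] IH(1)[OF diff_le_self] IH(2)[OF diff_le_self]] by blast
      then show ?thesis unfolding D_def by blast
    qed
    then obtain d where d: "\<And>k x. k \<le> m \<Longrightarrow> (star (Q k) (Q (m - k)) has_real_derivative d k x) (at x)"
      "\<And>k. k \<le> m \<Longrightarrow> continuous_on UNIV (d k)"
      "\<And>k x. k \<le> m \<Longrightarrow> x * d k x = star (D k) (Q (m - k)) x + star (Q k) (D (m - k)) x"
      by (metis (no_types, lifting))
    show ?thesis
    proof (rule *)
      fix x
      have "((\<lambda>x. \<Sum>k\<le>m. star (Q k) (Q (m - k)) x) has_real_derivative (\<Sum>k\<le>m. d k x)) (at x)"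
        by (rule DERIV_sum) (use d(1) in auto)
      then have "((\<lambda>x. (\<Sum>k\<le>m. star (Q k) (Q (m - k)) x) / real (Suc m))
          has_real_derivative (\<Sum>k\<le>m. d k x) / real (Suc m)) (at x)"
        by (rule DERIV_cdivide)
      then show "(Q n has_real_derivative (\<Sum>k\<le>m. d k x) / real (Suc m)) (at x)"
        unfolding Suc wild.simps .
      show "continuous_on UNIV (\<lambda>x. (\<Sum>k\<le>m. d k x) / real (Suc m))"
        using d(2) by (auto intro!: continuous_intros simp del: of_nat_Suc)
      fix m' assume "n = Suc m'"
      then have "m' = m" using Suc by simp
      then show "x * ((\<Sum>k\<le>m. d k x) / real (Suc m)) =
         (\<Sum>k\<le>m'. star (D k) (Q (m' - k)) x + star (Q k) (D (m' - k)) x) / real (Suc m')"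
        using d(3) by (simp add: sum_distrib_left del: of_nat_Suc)
    qed
  qed
qed

lemma Q_deriv: "(Q n has_real_derivative deriv (Q n) x) (at x)"
  and deriv_Q_cont: "continuous_on UNIV (deriv (Q n))"
  and D_Suc: "D (Suc m) x = (\<Sum>k\<le>m. star (D k) (Q (m - k)) x + star (Q k) (D (m - k)) x) / real (Suc m)"
  using Q_deriv_aux by blast+

lemma Q_cont [continuous_intros]: "continuous_on UNIV (Q n)"
  using Q_deriv by (meson DERIV_isCont continuous_at_imp_continuous_on)

lemma D_cont [continuous_intros]: "continuous_on UNIV (D n)"
  unfolding D_def by (intro continuous_intros deriv_Q_cont)

lemma G_cont [continuous_intros]: "continuous_on UNIV G"
  unfolding G_def by (intro continuous_intros)

lemma U_cont [continuous_intros]: "continuous_on UNIV (U n)"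
  unfolding U_def by (intro continuous_intros)

lemma V_cont [continuous_intros]: "continuous_on UNIV (V n)"
  unfolding V_def by (intro continuous_intros)

text \<open>The derivation x d/dx applied to the fixed point identity
  \<open>star_gam\<close>.\<close>

lemma G_star: "G x = star G (gam \<sigma>) x + star (gam \<sigma>) G x"
proof -
  obtain d where d: "\<And>x. (star (gam \<sigma>) (gam \<sigma>) has_real_derivative d x) (at x)"
    "\<And>x. x * d x = star G (gam \<sigma>) x + star (gam \<sigma>) G x"
    unfolding G_def[abs_def]
    by (rule DERIV_star[of "gam \<sigma>" "\<lambda>x. - (\<sigma>\<^sup>2 * x) * gam \<sigma> x" "gam \<sigma>" "\<lambda>x. - (\<sigma>\<^sup>2 * x) * gam \<sigma> x"])
      (rule gam_deriv | intro continuous_intros | blast)+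
  have "star (gam \<sigma>) (gam \<sigma>) = gam \<sigma>" by (rule ext) (rule star_gam)
  then have "d x = - (\<sigma>\<^sup>2 * x) * gam \<sigma> x"
    using d(1)[of x] gam_deriv[of \<sigma> x] DERIV_unique by metis
  then show ?thesis using d(2)[of x] by (simp add: G_def)
qed

lemma Q_wgt: "\<bar>Q n x\<bar> \<le> wgt c q x"
proof (induction n arbitrary: x rule: less_induct)
  case (less n)
  show ?case
  proof (cases n)
    case 0
    then show ?thesis using A_wgt by simp
  next
    case (Suc m)
    have "\<bar>star (Q k) (Q (m - k)) x\<bar> \<le> wgt c q x" if "k \<le> m" for k
      using star_wgt_bound_crude[of "Q k" "Q (m - k)" 1 0 c q 1 0 x] less[of k] less[of "m - k"] that Suc c q
      by (auto intro: Q_cont)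
    then have "\<bar>\<Sum>k\<le>m. star (Q k) (Q (m - k)) x\<bar> \<le> (\<Sum>k\<le>m. wgt c q x)"
      by (intro order_trans[OF sum_abs sum_mono]) auto
    then show ?thesis unfolding Suc by (simp add: abs_divide divide_le_eq mult.commute)
  qed
qed

lemma QG_wgt: "\<bar>Q n x + gam \<sigma> x\<bar> \<le> 2 * wgt c q x"
  using Q_wgt[of n x] gam_wgt[of x] abs_triangle_ineq[of "Q n x" "gam \<sigma> x"] by (simp add: gam_def)

text \<open>A difference of squares, factored as difference times sum. The cross terms
  \<open>star (Q k) (gam \<sigma>)\<close> and \<open>star (Q (n - k)) (gam \<sigma>)\<close> carry
  opposite signs and cancel once the sum over k is reversed. The deviation thus enters linearly, in
  the first slot, whose fourth power is the one that is averaged.\<close>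

lemma U_Suc: "U (Suc n) x = (\<Sum>k\<le>n. star (U k) (\<lambda>y. Q (n - k) y + gam \<sigma> y) x) / real (Suc n)"
proof -
  have "(\<Sum>k\<le>n. star (U k) (\<lambda>y. Q (n - k) y + gam \<sigma> y) x) =
     (\<Sum>k\<le>n. star (Q k) (Q (n - k)) x + (star (Q k) (gam \<sigma>) x - star (Q (n - k)) (gam \<sigma>) x) - gam \<sigma> x)"
  proof (rule sum.cong[OF refl])
    fix k
    have "star (U k) (\<lambda>y. Q (n - k) y + gam \<sigma> y) x =
        star (Q k) (Q (n - k)) x + star (Q k) (gam \<sigma>) x -
        (star (gam \<sigma>) (Q (n - k)) x + star (gam \<sigma>) (gam \<sigma>) x)"
      unfolding U_def[abs_def] by (simp add: star_diff_left star_add_right continuous_intros)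
    also have "star (gam \<sigma>) (Q (n - k)) x = star (Q (n - k)) (gam \<sigma>) x"
      by (rule star_commute; intro continuous_intros)
    finally show "star (U k) (\<lambda>y. Q (n - k) y + gam \<sigma> y) x =
      star (Q k) (Q (n - k)) x + (star (Q k) (gam \<sigma>) x - star (Q (n - k)) (gam \<sigma>) x) - gam \<sigma> x"
      by (simp add: star_gam)
  qed
  also have "\<dots> = (\<Sum>k\<le>n. star (Q k) (Q (n - k)) x) - real (Suc n) * gam \<sigma> x"
    by (simp add: sum.distrib sum_subtractf sum_atMost_rev[of "\<lambda>k. star (Q k) (gam \<sigma>) x"] del: of_nat_Suc)
  finally show ?thesis by (simp add: U_def diff_divide_distrib del: of_nat_Suc)
qed

text \<open>The image of \<open>U_Suc\<close> under x d/dx. Two families of cross terms cancel by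
  reversing the sum, one pairing \<open>D\<close> with the Gaussian and one pairing \<open>Q\<close>
  with \<open>G\<close>; \<open>G_star\<close> accounts for the purely Gaussian part.\<close>

lemma V_Suc: "V (Suc n) x = (\<Sum>k\<le>n. star (V k) (\<lambda>y. Q (n - k) y + gam \<sigma> y) x
    + star (U k) (\<lambda>y. D (n - k) y + G y) x) / real (Suc n)"
proof -
  have "(\<Sum>k\<le>n. star (V k) (\<lambda>y. Q (n - k) y + gam \<sigma> y) x + star (U k) (\<lambda>y. D (n - k) y + G y) x) =
     (\<Sum>k\<le>n. star (D k) (Q (n - k)) x + star (Q k) (D (n - k)) x
       + (star (D k) (gam \<sigma>) x - star (D (n - k)) (gam \<sigma>) x)
       + (star (Q k) G x - star (Q (n - k)) G x) - G x)"
  proof (rule sum.cong[OF refl])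
    fix k
    have c1: "star (gam \<sigma>) (D (n - k)) x = star (D (n - k)) (gam \<sigma>) x"
      and c2: "star G (Q (n - k)) x = star (Q (n - k)) G x"
      by (rule star_commute; intro continuous_intros)+
    have "star (V k) (\<lambda>y. Q (n - k) y + gam \<sigma> y) x + star (U k) (\<lambda>y. D (n - k) y + G y) x =
       (star (D k) (Q (n - k)) x + star (D k) (gam \<sigma>) x - (star G (Q (n - k)) x + star G (gam \<sigma>) x)) +
       (star (Q k) (D (n - k)) x + star (Q k) G x - (star (gam \<sigma>) (D (n - k)) x + star (gam \<sigma>) G x))"
      unfolding U_def[abs_def] V_def[abs_def]
      by (simp add: star_diff_left star_add_right continuous_intros)
    then show "star (V k) (\<lambda>y. Q (n - k) y + gam \<sigma> y) x + star (U k) (\<lambda>y. D (n - k) y + G y) x =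
       star (D k) (Q (n - k)) x + star (Q k) (D (n - k)) x
       + (star (D k) (gam \<sigma>) x - star (D (n - k)) (gam \<sigma>) x)
       + (star (Q k) G x - star (Q (n - k)) G x) - G x"
      using G_star[of x] by (simp add: c1 c2)
  qed
  also have "\<dots> = (\<Sum>k\<le>n. star (D k) (Q (n - k)) x + star (Q k) (D (n - k)) x) - real (Suc n) * G x"
    by (simp add: sum.distrib sum_subtractf sum_atMost_rev[of "\<lambda>k. star (Q k) G x"]
        sum_atMost_rev[of "\<lambda>k. star (D k) (gam \<sigma>) x"] del: of_nat_Suc)
  finally show ?thesis by (simp add: V_def D_Suc diff_divide_distrib del: of_nat_Suc)
qed

lemma U_bound: "\<bar>U n x\<bar> \<le> M * pc n * \<bar>x\<bar>^4 * wgt c q x"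
proof (induction n arbitrary: x rule: less_induct)
  case (less n)
  show ?case
  proof (cases n)
    case 0
    then show ?thesis using A_gam by (simp add: U_def pc_def)
  next
    case (Suc m)
    have "\<bar>star (U k) (\<lambda>y. Q (m - k) y + gam \<sigma> y) x\<bar> \<le> pc k * (3/4 * M * \<bar>x\<bar>^4 * wgt c q x)" if "k \<le> m" for k
    proof -
      have "\<bar>star (U k) (\<lambda>y. Q (m - k) y + gam \<sigma> y) x\<bar> \<le>
         2 * (M * pc k * ((3*pi/4) / (2*pi)) * \<bar>x\<bar>^4) * wgt c q x"
        by (rule star_wgt_bound) (use c q M_nonneg pc_pos[of k] less[of k] Suc that in
          \<open>auto intro!: continuous_intros QG_wgt integral_cos_pow\<close>)
      then show ?thesis by (simp add: mult_ac)
    qed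
    then have "\<bar>U n x\<bar> \<le> 4/3 * pc (Suc m) * (3/4 * M * \<bar>x\<bar>^4 * wgt c q x)"
      unfolding Suc U_Suc by (intro avg_pc_bound) auto
    then show ?thesis by (simp add: Suc mult_ac)
  qed
qed

lemma D_Suc': "D (Suc n) x = 2 * (\<Sum>k\<le>n. star (D k) (Q (n - k)) x) / real (Suc n)"
proof -
  have "(\<Sum>k\<le>n. star (Q k) (D (n - k)) x) = (\<Sum>k\<le>n. star (D (n - k)) (Q (n - (n - k))) x)"
    by (rule sum.cong[OF refl]) (auto intro!: star_commute continuous_intros)
  also have "\<dots> = (\<Sum>k\<le>n. star (D k) (Q (n - k)) x)"
    by (rule sum_atMost_rev)
  finally show ?thesis by (simp add: D_Suc sum.distrib del: of_nat_Suc)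
qed

text \<open>Twice the mean of cos^2 is 1: at second order the recursion is neutral, and the bound
  reproduces itself exactly without any decay in n.\<close>

lemma D_bound: "\<bar>D n x\<bar> \<le> M * \<bar>x\<bar>^2 * wgt c q x"
proof (induction n arbitrary: x rule: less_induct)
  case (less n)
  show ?case
  proof (cases n)
    case 0
    have "deriv A x = A' x" by (rule DERIV_imp_deriv[OF A_deriv])
    then show ?thesis using A'_wgt[of x] by (simp add: D_def 0)
  next
    case (Suc m)
    have "\<bar>star (D k) (Q (m - k)) x\<bar> \<le> 1/2 * M * \<bar>x\<bar>^2 * wgt c q x" if "k \<le> m" for k
    proof -
      have "\<bar>star (D k) (Q (m - k)) x\<bar> \<le> 1 * (M * (pi / (2*pi)) * \<bar>x\<bar>^2) * wgt c q x"
        by (rule star_wgt_bound) (use c q M_nonneg less[of k] Suc that Q_wgt in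
          \<open>auto intro!: continuous_intros has_integral_cos2\<close>)
      then show ?thesis by simp
    qed
    then have "\<bar>\<Sum>k\<le>m. star (D k) (Q (m - k)) x\<bar> \<le> (\<Sum>k\<le>m. 1/2 * M * \<bar>x\<bar>^2 * wgt c q x)"
      by (intro order_trans[OF sum_abs sum_mono]) auto
    then show ?thesis unfolding Suc D_Suc' by (simp add: abs_divide abs_mult divide_le_eq mult_ac)
  qed
qed

text \<open>\<open>D_bound\<close> permits growth |x|^(2 - 2q) at infinity. For finitely many early
  indices the linear bound inherited from the boundedness of \<open>A'\<close> is better there, and
  its constant may depend on n.\<close>

lemma D_linear: "\<exists>C\<ge>0. \<forall>x. \<bar>D n x\<bar> \<le> C * \<bar>x\<bar>"
proof (induction n rule: less_induct)
  case (less n)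
  show ?case
  proof (cases n)
    case 0
    have "deriv A x = A' x" for x by (rule DERIV_imp_deriv[OF A_deriv])
    then have "\<bar>D n x\<bar> \<le> M * \<bar>x\<bar>" for x
      using mult_left_mono[OF A'_bound[of x], of "\<bar>x\<bar>"] by (simp add: D_def 0 abs_mult mult.commute)
    then show ?thesis using M_nonneg by blast
  next
    case (Suc m)
    have "\<forall>k\<in>{..m}. \<exists>C. C \<ge> 0 \<and> (\<forall>x. \<bar>D k x\<bar> \<le> C * \<bar>x\<bar>)" using less Suc by auto
    from bchoice[OF this] obtain C where C: "\<And>k. k \<le> m \<Longrightarrow> C k \<ge> 0" "\<And>k x. k \<le> m \<Longrightarrow> \<bar>D k x\<bar> \<le> C k * \<bar>x\<bar>"
      by auto
    have Q1: "\<bar>Q n x\<bar> \<le> 1" for n x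
    proof -
      have "(1 + c * x\<^sup>2) powr (-q) \<le> (1 + c * x\<^sup>2) powr 0"
        using c q by (intro powr_mono) auto
      moreover have "1 + c * x\<^sup>2 > 0" using c by (intro add_pos_nonneg) auto
      ultimately show ?thesis using Q_wgt[of n x] by (simp add: wgt_def)
    qed
    have "\<bar>star (D k) (Q (m - k)) x\<bar> \<le> C k * \<bar>x\<bar>" if "k \<le> m" for k x
      \<comment> \<open>With \<open>c = 0\<close> and \<open>q = 0\<close> the weight is identically
        1.\<close>
      using star_wgt_bound_crude[of "D k" "Q (m - k)" "C k" 1 0 0 1 0 x] C[OF that] Q1
      by (auto intro: continuous_intros simp: wgt_def)
    then have "\<bar>\<Sum>k\<le>m. star (D k) (Q (m - k)) x\<bar> \<le> (\<Sum>k\<le>m. C k * \<bar>x\<bar>)" for x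
      by (intro order_trans[OF sum_abs sum_mono]) auto
    then have "\<bar>D n x\<bar> \<le> (2 * (\<Sum>k\<le>m. C k) / real (Suc m)) * \<bar>x\<bar>" for x
      unfolding Suc D_Suc'
      by (simp add: abs_divide abs_mult divide_le_eq mult_ac sum_distrib_left[symmetric] sum_distrib_right[symmetric])
    then show ?thesis using C(1) by (intro exI[of _ "2 * (\<Sum>k\<le>m. C k) / real (Suc m)"]) (auto intro!: sum_nonneg divide_nonneg_nonneg)
  qed
qed

lemma G_bound: "\<bar>G x\<bar> \<le> M * \<bar>x\<bar>^2 * wgt c q x"
proof -
  have "\<bar>G x\<bar> = \<sigma>\<^sup>2 * \<bar>x\<bar>^2 * gam \<sigma> x"
    by (simp add: G_def abs_mult gam_def power2_eq_square)
  also have "\<dots> \<le> M * \<bar>x\<bar>^2 * wgt c q x"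
    by (intro mult_mono \<sigma>_le gam_wgt) (auto simp: gam_def M_nonneg)
  finally show ?thesis .
qed

lemma DG_bound: "\<bar>D n x + G x\<bar> \<le> 2 * M * \<bar>x\<bar>^2 * wgt c q x"
  using D_bound[of n x] G_bound[of x] abs_triangle_ineq[of "D n x" "G x"] by simp

text \<open>The source \<open>star (U k) (D + G)\<close> has size \<open>x\<^sup>6\<close>; the extra sixth-order weight
  contracts with the factor \<open>5/8 < 3/4\<close> and therefore absorbs it without resonance.\<close>

lemma V_bound: "\<bar>V n x\<bar> \<le> pc n * ((M * \<bar>x\<bar>^4 + 16 * M\<^sup>2 * \<bar>x\<bar>^6) * wgt c q x)"
proof (induction n arbitrary: x rule: less_induct)
  case (less n)
  show ?case
  proof (cases n)
    case 0
    have "deriv A x = A' x" by (rule DERIV_imp_deriv[OF A_deriv])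
    then have "\<bar>V 0 x\<bar> \<le> M * \<bar>x\<bar>^4 * wgt c q x"
      using A'_gam[of x] by (simp add: V_def D_def G_def)
    also have "\<dots> \<le> (M * \<bar>x\<bar>^4 + 16 * M\<^sup>2 * \<bar>x\<bar>^6) * wgt c q x"
      by (intro mult_right_mono) (auto simp: wgt_nonneg)
    finally show ?thesis by (simp add: 0 pc_def)
  next
    case (Suc m)
    let ?w = "wgt c q x"
    \<comment> \<open>The 16 is the fixed point of the sixth-order recursion: 5/8 of 16 plus 2 from
      the source gives 12, and averaging multiplies by 4/3.\<close>
    have "\<bar>star (V k) (\<lambda>y. Q (m - k) y + gam \<sigma> y) x + star (U k) (\<lambda>y. D (m - k) y + G y) x\<bar>
       \<le> pc k * ((3/4 * M * \<bar>x\<bar>^4 + 12 * M\<^sup>2 * \<bar>x\<bar>^6) * ?w)" if "k \<le> m" for k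
    proof -
      have 1: "\<bar>star (V k) (\<lambda>y. Q (m - k) y + gam \<sigma> y) x\<bar> \<le>
         2 * ((pc k * M) * ((3*pi/4) / (2*pi)) * \<bar>x\<bar>^4 + (pc k * (16 * M\<^sup>2)) * ((5*pi/8) / (2*pi)) * \<bar>x\<bar>^6) * ?w"
      proof (rule star_wgt_bound2)
        fix y show "\<bar>V k y\<bar> \<le> (pc k * M * \<bar>y\<bar>^4 + pc k * (16 * M\<^sup>2) * \<bar>y\<bar>^6) * wgt c q y"
          using less[of k y] Suc that by (simp add: algebra_simps)
      qed (use c q M_nonneg pc_pos[of k] in \<open>auto intro!: continuous_intros QG_wgt integral_cos_pow\<close>)
      have 2: "\<bar>star (U k) (\<lambda>y. D (m - k) y + G y) x\<bar> \<le> (M * pc k) * (2 * M) * \<bar>x\<bar>^(4+2) * ?w"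
        by (rule star_wgt_bound_crude) (use c q M_nonneg pc_pos[of k] U_bound DG_bound in
          \<open>auto intro!: continuous_intros\<close>)
      show ?thesis
        using abs_triangle_ineq[of "star (V k) (\<lambda>y. Q (m - k) y + gam \<sigma> y) x" "star (U k) (\<lambda>y. D (m - k) y + G y) x"]
          1 2 by (simp add: algebra_simps power2_eq_square)
    qed
    then have "\<bar>V n x\<bar> \<le> 4/3 * pc (Suc m) * ((3/4 * M * \<bar>x\<bar>^4 + 12 * M\<^sup>2 * \<bar>x\<bar>^6) * ?w)"
      unfolding Suc V_Suc by (intro avg_pc_bound) auto
    then show ?thesis by (simp add: Suc algebra_simps)
  qed
qed

end

section \<open>Decay at infinity of the differences and of their derivatives\<close>

lemma one_plus_sq_pos: "0 < 1 + (x::real)\<^sup>2"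
  by (intro add_pos_nonneg) auto

lemma one_plus_sq_powr_add:
  "(1 + (x::real)\<^sup>2) powr a * (1 + x\<^sup>2) powr b = (1 + x\<^sup>2) powr (a + b)"
  by (simp add: powr_add)

text \<open>For |x| \<le> 1 the factor (1 + x^2)^(-k) is at least 2^(-k); for |x| \<ge> 1 one has 1
  + x^2 \<le> (2|x|)^2. These two comparisons produce the two parts of the constant.\<close>

lemma bnd_glue:
  assumes near: "\<And>x. \<bar>x\<bar> \<le> 1 \<Longrightarrow> \<bar>g x\<bar> \<le> C * \<bar>x\<bar> ^ m"
    and far: "\<And>x. \<bar>x\<bar> \<ge> 1 \<Longrightarrow> \<bar>g x\<bar> \<le> D * (1 + x\<^sup>2) powr (real m / 2 - k)"
    and k: "0 \<le> k" and C: "0 \<le> C" and D: "0 \<le> D"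
  shows "bnd m (2 powr k * C + 2 ^ m * D) k g"
  unfolding bnd_def
proof
  fix x :: real
  let ?P = "\<bar>x\<bar> ^ m * (1 + x\<^sup>2) powr - k"
  have P: "0 \<le> ?P" by simp
  show "\<bar>g x\<bar> \<le> (2 powr k * C + 2 ^ m * D) * \<bar>x\<bar> ^ m * (1 + x\<^sup>2) powr - k"
  proof (cases "\<bar>x\<bar> \<le> 1")
    case True
    then have "x\<^sup>2 \<le> 1" by (simp add: abs_square_le_1)
    then have "2 powr (-k) \<le> (1 + x\<^sup>2) powr (-k)"
      using k one_plus_sq_pos by (intro powr_mono2') auto
    then have "2 powr k * 2 powr (-k) \<le> 2 powr k * (1 + x\<^sup>2) powr (-k)"
      by (intro mult_left_mono) auto
    then have "1 \<le> 2 powr k * (1 + x\<^sup>2) powr (-k)"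
      by (simp add: powr_minus)
    from mult_left_mono[OF this, of "C * \<bar>x\<bar> ^ m"] C
    have "C * \<bar>x\<bar> ^ m \<le> 2 powr k * C * ?P" by (simp add: mult_ac)
    also have "\<dots> \<le> (2 powr k * C + 2 ^ m * D) * ?P"
      using D P by (intro mult_right_mono) auto
    finally show ?thesis using near[OF True] by (simp add: mult_ac)
  next
    case False
    then have x: "1 \<le> \<bar>x\<bar>" by simp
    have "1 + x\<^sup>2 \<le> (2 * \<bar>x\<bar>)\<^sup>2"
      using power_mono[OF x, of 2] by (simp add: power_mult_distrib)
    then have "(1 + x\<^sup>2) powr (real m / 2) \<le> ((2 * \<bar>x\<bar>)\<^sup>2) powr (real m / 2)"
      by (intro powr_mono2) auto
    also have "\<dots> = (2 * \<bar>x\<bar>) ^ m"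
    proof -
      have "(y\<^sup>2) powr (real m / 2) = y ^ m" if "y > 0" for y :: real
      proof -
        have "(y\<^sup>2) powr (real m / 2) = (y powr 2) powr (real m / 2)" using that by simp
        also have "\<dots> = y powr real m" unfolding powr_powr by simp
        finally show ?thesis using that by (simp add: powr_realpow)
      qed
      from this[of "2 * \<bar>x\<bar>"] show ?thesis using x by linarith
    qed
    finally have *: "(1 + x\<^sup>2) powr (real m / 2) \<le> 2 ^ m * \<bar>x\<bar> ^ m"
      by (simp add: power_mult_distrib)
    have "(1 + x\<^sup>2) powr (real m / 2 - k) = (1 + x\<^sup>2) powr (real m / 2) * (1 + x\<^sup>2) powr (-k)"
      by (simp add: one_plus_sq_powr_add)
    also have "\<dots> \<le> (2 ^ m * \<bar>x\<bar> ^ m) * (1 + x\<^sup>2) powr (-k)"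
      by (intro mult_right_mono *) auto
    finally have "D * (1 + x\<^sup>2) powr (real m / 2 - k) \<le> D * ((2 ^ m * \<bar>x\<bar> ^ m) * (1 + x\<^sup>2) powr (-k))"
      using D by (rule mult_left_mono)
    also have "\<dots> \<le> (2 powr k * C + 2 ^ m * D) * ?P"
      using C P by (simp add: algebra_simps)
    finally show ?thesis using far[OF x] by (simp add: mult_ac)
  qed
qed

lemma wgt_le:
  assumes "0 < c" "c \<le> 1" "0 \<le> q"
  shows "wgt c q x \<le> c powr (-q) * (1 + x\<^sup>2) powr (-q)"
proof -
  have "(1 + c * x\<^sup>2) powr (-q) \<le> (c * (1 + x\<^sup>2)) powr (-q)"
    using assms mult_pos_pos[OF assms(1) one_plus_sq_pos[of x]]
    by (intro powr_mono2') (auto simp: distrib_left)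
  then show ?thesis using assms by (simp add: wgt_def powr_mult)
qed

context kac_fourier
begin

definition W :: real where "W = c powr (-q)"

lemma W_pos: "0 < W" using c by (simp add: W_def)

lemma wgt_W: "wgt c q x \<le> W * (1 + x\<^sup>2) powr (-q)"
  unfolding W_def using c q by (intro wgt_le) auto

lemma wgt_le_1: "wgt c q x \<le> 1"
proof -
  have "(1 + c * x\<^sup>2) powr (-q) \<le> (1 + c * x\<^sup>2) powr 0"
    using c q by (intro powr_mono) auto
  moreover have "1 + c * x\<^sup>2 > 0" using c by (intro add_pos_nonneg) auto
  ultimately show ?thesis by (simp add: wgt_def)
qed

lemma QG_bnd: "bnd 0 (2 * W) q (\<lambda>x. Q n x + gam \<sigma> x)"
  unfolding bnd_def
proof
  fix x
  show "\<bar>Q n x + gam \<sigma> x\<bar> \<le> 2 * W * \<bar>x\<bar>^0 * (1 + x\<^sup>2) powr (-q)"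
    using QG_wgt[of n x] wgt_W[of x] by simp
qed

text \<open>Complements \<open>U_bound\<close>: the decay |x|^(-2q) at infinity is already there for
  every n, because \<open>Q n\<close> and the Gaussian are both below the weight, but the factor
  \<open>pc n\<close> is given up. This is affordable for finitely many indices.\<close>

lemma U_rough: "bnd 4 (2 powr (2 + q) * M + 2 ^ 4 * (2 * W)) (2 + q) (U n)"
proof (rule bnd_glue)
  fix x :: real
  have "M * pc n * \<bar>x\<bar>^4 * wgt c q x \<le> M * 1 * \<bar>x\<bar>^4 * 1"
    using M_nonneg pc_pos[of n] pc_le_1[of n] wgt_le_1[of x] wgt_nonneg[of c q x]
    by (intro mult_mono) auto
  then show "\<bar>U n x\<bar> \<le> M * \<bar>x\<bar>^4" using U_bound[of n x] by simp
  have "\<bar>U n x\<bar> \<le> \<bar>Q n x\<bar> + \<bar>gam \<sigma> x\<bar>" by (simp add: U_def abs_triangle_ineq4)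
  also have "\<dots> \<le> 2 * wgt c q x" using Q_wgt[of n x] gam_wgt[of x] by (simp add: gam_def)
  also have "\<dots> \<le> 2 * (W * (1 + x\<^sup>2) powr (-q))" using wgt_W[of x] by simp
  finally show "\<bar>U n x\<bar> \<le> 2 * W * (1 + x\<^sup>2) powr (real 4 / 2 - (2 + q))" by simp
qed (use q M_nonneg W_pos in auto)

text \<open>Bootstrapping the decay exponent: for \<open>n \<ge> 2 N\<close> at least one of the two indices \<open>k\<close>,
  \<open>n - k\<close> is at least \<open>N\<close>, so one factor already has the decay of the current level and the
  other contributes at least \<open>q\<close>.\<close>

definition level_U :: "real \<Rightarrow> bool" where
  "level_U e \<longleftrightarrow> (\<exists>C N. 0 \<le> C \<and> (\<forall>n\<ge>N. bnd 4 (C * pc n) (2 + e) (U n)))"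

lemma level_U_start: "level_U (- 2 + q)"
  unfolding level_U_def
proof (intro exI conjI allI impI)
  show "0 \<le> M * W" using M_nonneg W_pos by simp
  fix n :: nat
  show "bnd 4 (M * W * pc n) (2 + (- 2 + q)) (U n)"
    unfolding bnd_def
  proof
    fix x :: real
    have "\<bar>U n x\<bar> \<le> M * pc n * \<bar>x\<bar>^4 * wgt c q x" by (rule U_bound)
    also have "\<dots> \<le> M * pc n * \<bar>x\<bar>^4 * (W * (1 + x\<^sup>2) powr (-q))"
      using M_nonneg pc_pos[of n] by (intro mult_left_mono wgt_W) auto
    finally show "\<bar>U n x\<bar> \<le> M * W * pc n * \<bar>x\<bar>^4 * (1 + x\<^sup>2) powr (- (2 + (- 2 + q)))"
      by (simp add: mult_ac)
  qed
qed

lemma U_gam_bnd: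
  assumes "bnd 4 (C * pc n) (2 + e) (U n)" "0 \<le> C" "bnd 0 Cg e (gam \<sigma>)" "0 \<le> Cg"
  shows "bnd 0 (C + 2 * Cg) e (\<lambda>x. Q n x + gam \<sigma> x)"
proof -
  have "bnd 4 C (2 + e) (U n)"
    by (rule bnd_mono[OF assms(1)]) (use assms(2) pc_le_1[of n] pc_pos[of n] in \<open>auto intro: mult_left_le\<close>)
  then have "bnd 0 C e (U n)" by (rule bnd_4_0) (rule assms)
  from bnd_add[OF this bnd_add[OF assms(3,3)]]
  show ?thesis by (simp add: U_def add.commute)
qed

text \<open>A round gains \<open>q\<close>, the decay that \<open>Q + gam\<close> has from the
  start. The cap 3/8 keeps \<open>2 + e\<close> below the limit 5/2 for the next round.\<close>

lemma level_U_step: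
  assumes "level_U e" and e: "e \<le> 3/8"
  shows "level_U (min (e + q) (3/8))"
proof -
  define e' where "e' = min (e + q) (3/8)"
  obtain C N where C: "0 \<le> C" and UN: "\<And>n. n \<ge> N \<Longrightarrow> bnd 4 (C * pc n) (2 + e) (U n)"
    using assms unfolding level_U_def by blast
  obtain Cg where Cg: "0 \<le> Cg" "bnd 0 Cg e (gam \<sigma>)"
    by (rule gam_bnd[OF \<sigma>_nz])
  obtain K1 where K1: "0 \<le> K1" "\<And>C D g h. \<lbrakk>continuous_on UNIV g; continuous_on UNIV h; bnd 4 C (2 + e) g;
      bnd 0 D q h; 0 \<le> C; 0 \<le> D\<rbrakk> \<Longrightarrow> bnd 4 (K1 * C * D) (2 + e + q) (star g h)"
    by (rule star_smoothing[of "2 + e" q]) (use e q in auto)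
  obtain K2 where K2: "0 \<le> K2" "\<And>C D g h. \<lbrakk>continuous_on UNIV g; continuous_on UNIV h; bnd 4 C (2 + q) g;
      bnd 0 D (max q e) h; 0 \<le> C; 0 \<le> D\<rbrakk> \<Longrightarrow> bnd 4 (K2 * C * D) (2 + q + max q e) (star g h)"
    by (rule star_smoothing[of "2 + q" "max q e"]) (use e q in auto)
  define Cr where "Cr = 2 powr (2 + q) * M + 2 ^ 4 * (2 * W)"
  have Cr: "0 \<le> Cr" using M_nonneg W_pos by (simp add: Cr_def)
  define Ch where "Ch = max (2 * W) (C + 2 * Cg)"
  have Ch: "0 \<le> Ch" using W_pos by (simp add: Ch_def)
  have hi: "bnd 0 Ch (max q e) (\<lambda>x. Q n x + gam \<sigma> x)" if "n \<ge> N" for n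
  proof (cases "q \<le> e")
    case True
    then show ?thesis
      using bnd_mono[OF U_gam_bnd[OF UN[OF that] C Cg(2,1)], of Ch e] C Cg by (simp add: Ch_def max_def)
  next
    case False
    then show ?thesis
      using bnd_mono[OF QG_bnd[of n], of Ch q] W_pos by (simp add: Ch_def max_def)
  qed
  \<comment> \<open>Summands with k < N are estimated by \<open>U_rough\<close>, which has no factor
    \<open>pc k\<close>. Since \<open>pc\<close> is decreasing, \<open>pc k \<ge> pc N\<close>
    there, and division by \<open>pc N\<close> supplies the factor at the price of a
    constant.\<close>
  define E where "E = K1 * C * (2 * W) + K2 * Cr * Ch / pc N"
  have E: "0 \<le> E" unfolding E_def using K1 K2 C Cr Ch W_pos pc_pos[of N] by auto
  have E1: "K1 * C * (2 * W) \<le> E" and E2: "K2 * Cr * Ch / pc N \<le> E"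
    unfolding E_def using K1 K2 C Cr Ch W_pos pc_pos[of N] by auto
  have summand: "bnd 4 (E * pc k) (2 + e') (star (U k) (\<lambda>y. Q (n - k) y + gam \<sigma> y))"
    if n: "n \<ge> 2 * N" and k: "k \<le> n" for n k
  proof (cases "k \<ge> N")
    case True
    have "bnd 4 (K1 * (C * pc k) * (2 * W)) (2 + e + q) (star (U k) (\<lambda>y. Q (n - k) y + gam \<sigma> y))"
      by (rule K1) (use UN[OF True] QG_bnd C W_pos pc_pos[of k] in \<open>auto intro!: continuous_intros\<close>)
    then show ?thesis
    proof (rule bnd_mono)
      show "K1 * (C * pc k) * (2 * W) \<le> E * pc k"
        using mult_right_mono[OF E1, of "pc k"] pc_pos[of k] by (simp add: mult_ac)
    qed (use K1 C W_pos pc_pos[of k] in \<open>auto simp: e'_def\<close>)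
  next
    case False
    then have "n - k \<ge> N" using n by simp
    then have "bnd 4 (K2 * Cr * Ch) (2 + q + max q e) (star (U k) (\<lambda>y. Q (n - k) y + gam \<sigma> y))"
      by (intro K2 hi Cr Ch) (use U_rough[of k] in \<open>auto intro!: continuous_intros simp: Cr_def\<close>)
    then show ?thesis
    proof (rule bnd_mono)
      have "K2 * Cr * Ch = K2 * Cr * Ch / pc N * pc N" using pc_pos[of N] by simp
      also have "\<dots> \<le> E * pc k"
        using False pc_pos[of N] E by (intro mult_mono E2 pc_mono) auto
      finally show "K2 * Cr * Ch \<le> E * pc k" .
    qed (use K2 Cr Ch in \<open>auto simp: e'_def\<close>)
  qed
  have "bnd 4 (4/3 * E * pc n) (2 + e') (U n)" if "n \<ge> Suc (2 * N)" for n
  proof -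
    obtain m where m: "n = Suc m" using \<open>n \<ge> Suc (2 * N)\<close> by (cases n) auto
    have "U (Suc m) = (\<lambda>x. (\<Sum>k\<le>m. star (U k) (\<lambda>y. Q (m - k) y + gam \<sigma> y) x) / real (Suc m))"
      by (rule ext) (rule U_Suc)
    then show ?thesis
      unfolding m using bnd_avg_pc[OF summand, of m] that m by simp
  qed
  then show ?thesis
    unfolding level_U_def e'_def[symmetric] using E by (intro exI[of _ "4/3 * E"]) auto
qed

lemma level_U_final: "level_U (3/8)"
proof -
  have "level_U (min (- 2 + q + real j * q) (3/8))" for j
  proof (induction j)
    case 0
    then show ?case using level_U_start q by (simp add: min_def)
  next
    case (Suc j)
    then have "level_U (min (min (- 2 + q + real j * q) (3/8) + q) (3/8))"
      by (rule level_U_step) (rule min.cobounded2)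
    also have "min (min (- 2 + q + real j * q) (3/8) + q) (3/8) = min (- 2 + q + real (Suc j) * q) (3/8)"
      using q by (auto simp: min_def algebra_simps)
    finally show ?case .
  qed
  \<comment> \<open>From -2 + q to 3/8 the distance is less than 3, so any j with
    \<open>j * q \<ge> 3\<close> is enough; for the derivatives it is the distance from -3 + q to
    -1/8 that is less than 3.\<close>
  moreover obtain j :: nat where "real j * q \<ge> 3" using q reals_Archimedean3 by (metis less_eq_real_def)
  then have "min (- 2 + q + real j * q) (3/8) = 3/8" using q by auto
  ultimately show ?thesis by metis
qed

definition level_V :: "real \<Rightarrow> bool" where
  "level_V e \<longleftrightarrow> (\<exists>C N. 0 \<le> C \<and> (\<forall>n\<ge>N. bnd 4 (C * pc n) (2 + e) (V n)))"

text \<open>One unit lower than the start for \<open>U\<close>, because x^6 is x^4 times x^2 and x^2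
  costs one power of 1 + x^2.\<close>

lemma level_V_start: "level_V (- 3 + q)"
  unfolding level_V_def
proof (intro exI conjI allI impI)
  show "0 \<le> (M + 16 * M\<^sup>2) * W" using M_nonneg W_pos by simp
  fix n :: nat
  show "bnd 4 ((M + 16 * M\<^sup>2) * W * pc n) (2 + (- 3 + q)) (V n)"
    unfolding bnd_def
  proof
    fix x :: real
    have 1: "M * \<bar>x\<bar>^4 + 16 * M\<^sup>2 * \<bar>x\<bar>^6 \<le> (M + 16 * M\<^sup>2) * \<bar>x\<bar>^4 * (1 + x\<^sup>2)"
    proof -
      have "(M + 16 * M\<^sup>2) * \<bar>x\<bar>^4 * (1 + x\<^sup>2) = M * \<bar>x\<bar>^4 + 16 * M\<^sup>2 * (\<bar>x\<bar>^4 * \<bar>x\<bar>\<^sup>2) +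
          (16 * M\<^sup>2 * \<bar>x\<bar>^4 + M * (\<bar>x\<bar>^4 * x\<^sup>2))" by (simp add: algebra_simps)
      also have "\<bar>x\<bar>^4 * \<bar>x\<bar>\<^sup>2 = \<bar>x\<bar>^6" by (simp only: power_add[symmetric]) simp
      finally show ?thesis using M_nonneg by simp
    qed
    have "\<bar>V n x\<bar> \<le> pc n * ((M * \<bar>x\<bar>^4 + 16 * M\<^sup>2 * \<bar>x\<bar>^6) * wgt c q x)" by (rule V_bound)
    also have "\<dots> \<le> pc n * (((M + 16 * M\<^sup>2) * \<bar>x\<bar>^4 * (1 + x\<^sup>2)) * (W * (1 + x\<^sup>2) powr (-q)))"
      using M_nonneg pc_pos[of n] by (intro mult_left_mono mult_mono wgt_W 1) (auto simp: wgt_nonneg)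
    also have "\<dots> = (M + 16 * M\<^sup>2) * W * pc n * \<bar>x\<bar>^4 * ((1 + x\<^sup>2) powr 1 * (1 + x\<^sup>2) powr (-q))"
      using one_plus_sq_pos[of x] by simp
    finally show "\<bar>V n x\<bar> \<le> (M + 16 * M\<^sup>2) * W * pc n * \<bar>x\<bar>^4 * (1 + x\<^sup>2) powr (- (2 + (- 3 + q)))"
      unfolding one_plus_sq_powr_add by simp
  qed
qed

lemma abs_le_powr_half: "\<bar>x\<bar> \<le> (1 + (x::real)\<^sup>2) powr (1/2)"
proof -
  have "\<bar>x\<bar> = sqrt (x\<^sup>2)" by simp
  also have "\<dots> \<le> sqrt (1 + x\<^sup>2)" by (rule real_sqrt_le_mono) simp
  finally show ?thesis using one_plus_sq_pos[of x] by (simp add: powr_half_sqrt)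
qed

lemma G_linear: "\<exists>C\<ge>0. \<forall>x. \<bar>G x\<bar> \<le> C * \<bar>x\<bar>"
proof -
  obtain C where C: "0 \<le> C" "bnd 0 C (1/2) (gam \<sigma>)" by (rule gam_bnd[OF \<sigma>_nz])
  have "\<bar>G x\<bar> \<le> \<sigma>\<^sup>2 * C * \<bar>x\<bar>" for x
  proof -
    have "\<bar>x\<bar> * \<bar>gam \<sigma> x\<bar> \<le> (1 + x\<^sup>2) powr (1/2) * (C * (1 + x\<^sup>2) powr (-(1/2)))"
      using bndD[OF C(2), of x] by (intro mult_mono abs_le_powr_half) auto
    also have "\<dots> = C * ((1 + x\<^sup>2) powr (1/2) * (1 + x\<^sup>2) powr (-(1/2)))" by simp
    also have "\<dots> = C" unfolding one_plus_sq_powr_add using one_plus_sq_pos[of x] by simp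
    finally have "(\<sigma>\<^sup>2 * \<bar>x\<bar>) * (\<bar>x\<bar> * \<bar>gam \<sigma> x\<bar>) \<le> (\<sigma>\<^sup>2 * \<bar>x\<bar>) * C"
      by (intro mult_left_mono) auto
    then show ?thesis by (simp add: G_def abs_mult mult_ac)
  qed
  then show ?thesis using C by (intro exI[of _ "\<sigma>\<^sup>2 * C"]) auto
qed

text \<open>Provision for the finitely many early indices: linear growth of \<open>D\<close> and
  \<open>G\<close> is exponent -1/2 for their sum and 2 - 1/2 = 3/2 for the fourth-order bound on
  \<open>V\<close>. Constants may depend on N, and no factor \<open>pc k\<close> is kept.\<close>

lemma V_rough:
  obtains C where "0 \<le> C" "\<And>k. k < N \<Longrightarrow> bnd 4 C (3/2) (V k)"
    "\<And>k. k < N \<Longrightarrow> bnd 0 C (-(1/2)) (\<lambda>x. D k x + G x)"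
proof -
  obtain Cd where Cd: "\<And>k. 0 \<le> Cd k" "\<And>k x. \<bar>D k x\<bar> \<le> Cd k * \<bar>x\<bar>"
    using D_linear by metis
  obtain Cg where Cg: "0 \<le> Cg" "\<And>x. \<bar>G x\<bar> \<le> Cg * \<bar>x\<bar>"
    using G_linear by metis
  define L where "L = (\<Sum>k<N. Cd k) + Cg"
  have L: "0 \<le> L" unfolding L_def using Cd Cg by (intro add_nonneg_nonneg sum_nonneg) auto
  have DL: "\<bar>D k x\<bar> + \<bar>G x\<bar> \<le> L * (1 + x\<^sup>2) powr (1/2)" if "k < N" for k x
  proof -
    have "Cd k \<le> (\<Sum>k<N. Cd k)" using that Cd by (intro member_le_sum) auto
    then have "Cd k * \<bar>x\<bar> \<le> (\<Sum>k<N. Cd k) * \<bar>x\<bar>" by (rule mult_right_mono) simp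
    then have "\<bar>D k x\<bar> + \<bar>G x\<bar> \<le> L * \<bar>x\<bar>"
      using Cd(2)[of k x] Cg(2)[of x] by (simp add: L_def algebra_simps)
    also have "\<dots> \<le> L * (1 + x\<^sup>2) powr (1/2)" by (intro mult_left_mono abs_le_powr_half L)
    finally show ?thesis .
  qed
  define B where "B = M + 16 * M\<^sup>2"
  have B: "0 \<le> B" using M_nonneg by (simp add: B_def)
  have "bnd 4 (2 powr (3/2) * B + 2 ^ 4 * L) (3/2) (V k)" if "k < N" for k
  proof (rule bnd_glue)
    fix x :: real
    show "\<bar>V k x\<bar> \<le> B * \<bar>x\<bar>^4" if "\<bar>x\<bar> \<le> 1"
    proof -
      have "\<bar>x\<bar>^6 \<le> \<bar>x\<bar>^4" using that by (intro power_decreasing) auto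
      then have "M * \<bar>x\<bar>^4 + 16 * M\<^sup>2 * \<bar>x\<bar>^6 \<le> B * \<bar>x\<bar>^4"
        by (simp add: B_def distrib_right mult_left_mono)
      moreover have "pc k * ((M * \<bar>x\<bar>^4 + 16 * M\<^sup>2 * \<bar>x\<bar>^6) * wgt c q x) \<le> 1 * ((M * \<bar>x\<bar>^4 + 16 * M\<^sup>2 * \<bar>x\<bar>^6) * 1)"
        using M_nonneg pc_pos[of k] by (intro mult_mono pc_le_1 wgt_le_1) (auto simp: wgt_nonneg)
      ultimately show ?thesis using V_bound[of k x] by simp
    qed
    have "\<bar>V k x\<bar> \<le> \<bar>D k x\<bar> + \<bar>G x\<bar>" by (simp add: V_def abs_triangle_ineq4)
    then show "\<bar>V k x\<bar> \<le> L * (1 + x\<^sup>2) powr (real 4 / 2 - 3/2)"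
      using DL[OF \<open>k < N\<close>, of x] by simp
  qed (use B L in auto)
  moreover have "bnd 0 L (-(1/2)) (\<lambda>x. D k x + G x)" if "k < N" for k
    unfolding bnd_def using DL[OF that] abs_triangle_ineq by (auto intro: order_trans)
  ultimately show ?thesis
  proof (intro that[of "(2 powr (3/2) * B + 2 ^ 4 * L) + L"])
    fix k assume k: "k < N" and *: "\<And>k. k < N \<Longrightarrow> bnd 4 (2 powr (3/2) * B + 2 ^ 4 * L) (3/2) (V k)"
      "\<And>k. k < N \<Longrightarrow> bnd 0 L (-(1/2)) (\<lambda>x. D k x + G x)"
    show "bnd 4 (2 powr (3/2) * B + 2 ^ 4 * L + L) (3/2) (V k)"
      by (rule bnd_mono[OF *(1)[OF k]]) (use B L in auto)
    show "bnd 0 (2 powr (3/2) * B + 2 ^ 4 * L + L) (-(1/2)) (\<lambda>x. D k x + G x)"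
      by (rule bnd_mono[OF *(2)[OF k]]) (use B L in auto)
  qed (use B L in auto)
qed

text \<open>The cap -1/8 is what an early index permits: linear growth, exponent -1/2, of
  \<open>V\<close> or \<open>D + G\<close> is paired with a late \<open>Q + gam\<close> or
  \<open>U\<close> of exponent 3/8. All other pairings gain at least \<open>q\<close> over the
  current level. This is why the final level for \<open>U\<close> has to be available before the
  derivatives are treated.\<close>

lemma level_V_step:
  assumes "level_V e" and e: "e \<le> -(1/8)"
  shows "level_V (min (e + q) (-(1/8)))"
proof -
  define e' where "e' = min (e + q) (-(1/8))"
  have e': "e' \<le> e + q" unfolding e'_def by (rule min.cobounded1)
  have e'': "e' \<le> -(1/8)" unfolding e'_def by (rule min.cobounded2)
  obtain C0 N0 where C0: "0 \<le> C0" "\<And>n. n \<ge> N0 \<Longrightarrow> bnd 4 (C0 * pc n) (2 + 3/8) (U n)"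
    using level_U_final unfolding level_U_def by blast
  obtain C1 N1 where C1: "0 \<le> C1" "\<And>n. n \<ge> N1 \<Longrightarrow> bnd 4 (C1 * pc n) (2 + e) (V n)"
    using assms unfolding level_V_def by blast
  define N where "N = max N0 N1"
  obtain Cr where Cr: "0 \<le> Cr" "\<And>k. k < N \<Longrightarrow> bnd 4 Cr (3/2) (V k)"
    "\<And>k. k < N \<Longrightarrow> bnd 0 Cr (-(1/2)) (\<lambda>x. D k x + G x)"
    using V_rough[of N] by blast
  obtain Cg where Cg: "0 \<le> Cg" "bnd 0 Cg (3/8) (gam \<sigma>)" by (rule gam_bnd[OF \<sigma>_nz])
  obtain CG where CG: "0 \<le> CG" "bnd 0 CG e G"
    using gam_bnd[OF \<sigma>_nz] unfolding G_def[abs_def] by metis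
  define Cu where "Cu = 2 powr (2 + q) * M + 2 ^ 4 * (2 * W)"
  have Cu: "0 \<le> Cu" using M_nonneg W_pos by (simp add: Cu_def)
  define C where "C = C0 + C1 + Cr + Cu + 2 * W + (C0 + 2 * Cg) + (C1 + 2 * CG)"
  have C: "0 \<le> C" using C0 C1 Cr Cu W_pos Cg CG by (simp add: C_def)
  have pcC: "0 \<le> C * pc k" "C * pc k \<le> C" for k
    using C pc_pos[of k] pc_le_1[of k] by (auto intro: mult_left_le)
  have U1: "bnd 4 (C * pc k) (2 + 3/8) (U k)" if "k \<ge> N" for k
    using that C0 C1 Cr Cu W_pos Cg CG pc_pos[of k]
    by (intro bnd_mono[OF C0(2)]) (auto simp: N_def C_def intro!: mult_right_mono)
  have U2: "bnd 4 C (2 + q) (U k)" for k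
    using C0 C1 Cr Cu W_pos Cg CG
    by (intro bnd_mono[OF U_rough]) (auto simp: C_def Cu_def)
  have V1: "bnd 4 (C * pc k) (2 + e) (V k)" if "k \<ge> N" for k
    using that C0 C1 Cr Cu W_pos Cg CG pc_pos[of k]
    by (intro bnd_mono[OF C1(2)]) (auto simp: N_def C_def intro!: mult_right_mono)
  have V2: "bnd 4 C (3/2) (V k)" if "k < N" for k
    using C0 C1 Cr Cu W_pos Cg CG by (intro bnd_mono[OF Cr(2)[OF that]]) (auto simp: C_def)
  have Q1: "bnd 0 C q (\<lambda>x. Q k x + gam \<sigma> x)" for k
    using C0 C1 Cr Cu W_pos Cg CG by (intro bnd_mono[OF QG_bnd]) (auto simp: C_def)
  have Q2: "bnd 0 C (3/8) (\<lambda>x. Q k x + gam \<sigma> x)" if "k \<ge> N" for k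
    using C0 C1 Cr Cu W_pos Cg CG that
    by (intro bnd_mono[OF U_gam_bnd[OF C0(2) C0(1) Cg(2,1)]]) (auto simp: C_def N_def)
  have D1: "bnd 0 C e (\<lambda>x. D k x + G x)" if "k \<ge> N" for k
  proof -
    have "bnd 4 C1 (2 + e) (V k)"
      by (rule bnd_mono[OF C1(2)]) (use that C1(1) pc_le_1[of k] pc_pos[of k] in \<open>auto simp: N_def intro: mult_left_le\<close>)
    then have "bnd 0 C1 e (V k)" by (rule bnd_4_0) (rule C1)
    from bnd_add[OF this bnd_add[OF CG(2,2)]]
    have "bnd 0 (C1 + (CG + CG)) e (\<lambda>x. D k x + G x)" by (simp add: V_def add.commute)
    then show ?thesis
      by (rule bnd_mono) (use C0 C1 Cr Cu W_pos Cg CG in \<open>auto simp: C_def\<close>)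
  qed
  have D2: "bnd 0 C (-(1/2)) (\<lambda>x. D k x + G x)" if "k < N" for k
    using C0 C1 Cr Cu W_pos Cg CG by (intro bnd_mono[OF Cr(3)[OF that]]) (auto simp: C_def)
  \<comment> \<open>Five pairs of exponents occur below, so the smoothing constant is turned into a
    function of the pair, and \<open>KK\<close> dominates the five values.\<close>
  have "\<exists>K\<ge>0. \<forall>C D g h. continuous_on UNIV g \<longrightarrow> continuous_on UNIV h \<longrightarrow> bnd 4 C k g \<longrightarrow> bnd 0 D l h \<longrightarrow>
     0 \<le> C \<longrightarrow> 0 \<le> D \<longrightarrow> bnd 4 (K * C * D) (k + l) (star g h)" if "k < 5/2" "l < 1/2" for k l
    using star_smoothing[OF that] by metis
  then obtain K where K: "\<And>k l. k < 5/2 \<Longrightarrow> l < 1/2 \<Longrightarrow> 0 \<le> K k l"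
    "\<And>k l C D g h. \<lbrakk>k < 5/2; l < 1/2; continuous_on UNIV g; continuous_on UNIV h; bnd 4 C k g; bnd 0 D l h;
      0 \<le> C; 0 \<le> D\<rbrakk> \<Longrightarrow> bnd 4 (K k l * C * D) (k + l) (star g h)"
    by metis
  define KK where "KK = K (2 + e) q + K (3/2) (3/8) + K (2 + 3/8) e + K (2 + 3/8) (-(1/2)) + K (2 + q) e"
  have Kp: "0 \<le> K (2 + e) q" "0 \<le> K (3/2) (3/8)" "0 \<le> K (2 + 3/8) e" "0 \<le> K (2 + 3/8) (-(1/2))" "0 \<le> K (2 + q) e"
    using e q by (auto intro!: K(1))
  have KK: "0 \<le> KK" "K (2 + e) q \<le> KK" "K (3/2) (3/8) \<le> KK" "K (2 + 3/8) e \<le> KK"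
    "K (2 + 3/8) (-(1/2)) \<le> KK" "K (2 + q) e \<le> KK"
    using Kp by (auto simp: KK_def)
  define E where "E = KK * C * C / pc N"
  have E: "0 \<le> E" using KK C pc_pos[of N] by (simp add: E_def)
  have early: "KK * C * C \<le> E * pc k" if "k \<le> N" for k
  proof -
    have "KK * C * C = E * pc N" using pc_pos[of N] by (simp add: E_def)
    also have "\<dots> \<le> E * pc k" using E that by (intro mult_left_mono pc_mono) auto
    finally show ?thesis .
  qed
  have late: "KK * (C * pc k) * C \<le> E * pc k" for k
  proof -
    have "KK * C * C \<le> E"
      unfolding E_def using KK C pc_pos[of N] pc_le_1[of N] by (simp add: pos_le_divide_eq mult_left_le)
    from mult_right_mono[OF this, of "pc k"] show ?thesis using pc_pos[of k] by (simp add: mult_ac)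
  qed
  have fin: "bnd 4 (E * pc k) (2 + e') (star g h)"
    if "bnd 4 (K a b * C' * C) (a + b) (star g h)" "0 \<le> K a b" "K a b \<le> KK" "0 \<le> C'"
      "KK * C' * C \<le> E * pc k" "2 + e' \<le> a + b" for a b C' g h k
  proof (rule bnd_mono[OF that(1)])
    show "0 \<le> K a b * C' * C" using that C by auto
    have "K a b * C' * C \<le> KK * C' * C" using that C by (intro mult_right_mono) auto
    then show "K a b * C' * C \<le> E * pc k" using that(5) by simp
  qed (rule that)
  have T1: "bnd 4 (E * pc k) (2 + e') (star (V k) (\<lambda>y. Q (n - k) y + gam \<sigma> y))"
    if n: "n \<ge> 2 * N" and k: "k \<le> n" for n k
  proof (cases "k \<ge> N")
    case True
    show ?thesis
      by (rule fin[OF K(2)[OF _ _ _ _ V1[OF True] Q1]])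
        (use e e' e'' q Kp KK late pcC C in \<open>auto intro!: continuous_intros\<close>)
  next
    case False
    then have "n - k \<ge> N" using n by simp
    show ?thesis
      by (rule fin[OF K(2)[OF _ _ _ _ V2 Q2[OF \<open>n - k \<ge> N\<close>]]])
        (use e e' e'' q Kp KK early[of k] C False in \<open>auto intro!: continuous_intros\<close>)
  qed
  have T2: "bnd 4 (E * pc k) (2 + e') (star (U k) (\<lambda>y. D (n - k) y + G y))"
    if n: "n \<ge> 2 * N" and k: "k \<le> n" for n k
  proof (cases "k \<ge> N")
    case True
    show ?thesis
    proof (cases "n - k \<ge> N")
      case nk: True
      show ?thesis
        by (rule fin[OF K(2)[OF _ _ _ _ U1[OF True] D1[OF nk]]])
          (use e e' e'' q Kp KK late pcC C in \<open>auto intro!: continuous_intros\<close>)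
    next
      case False
      show ?thesis
        by (rule fin[OF K(2)[OF _ _ _ _ U1[OF True] D2]])
          (use e e' e'' q Kp KK late pcC C False in \<open>auto intro!: continuous_intros\<close>)
    qed
  next
    case False
    then have "n - k \<ge> N" using n by simp
    show ?thesis
      by (rule fin[OF K(2)[OF _ _ _ _ U2 D1[OF \<open>n - k \<ge> N\<close>]]])
        (use e e' e'' q Kp KK early[of k] C False in \<open>auto intro!: continuous_intros\<close>)
  qed
  have "bnd 4 (4/3 * (E + E) * pc n) (2 + e') (V n)" if "n \<ge> Suc (2 * N)" for n
  proof -
    obtain m where m: "n = Suc m" using \<open>n \<ge> Suc (2 * N)\<close> by (cases n) auto
    have "V (Suc m) = (\<lambda>x. (\<Sum>k\<le>m. star (V k) (\<lambda>y. Q (m - k) y + gam \<sigma> y) x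
        + star (U k) (\<lambda>y. D (m - k) y + G y) x) / real (Suc m))"
      by (rule ext) (rule V_Suc)
    moreover have "bnd 4 ((E + E) * pc k) (2 + e') (\<lambda>x. star (V k) (\<lambda>y. Q (m - k) y + gam \<sigma> y) x
        + star (U k) (\<lambda>y. D (m - k) y + G y) x)" if "k \<le> m" for k
      using bnd_add[OF T1 T2, of m k m k] that \<open>n \<ge> Suc (2 * N)\<close> m by (simp add: mult.assoc)
    ultimately show ?thesis
      unfolding m using bnd_avg_pc[of m 4 "E + E" "2 + e'"] by simp
  qed
  then show ?thesis
    unfolding level_V_def e'_def[symmetric] using E by (intro exI[of _ "4/3 * (E + E)"]) auto
qed

lemma level_V_final: "level_V (-(1/8))"
proof -
  have "level_V (min (- 3 + q + real j * q) (-(1/8)))" for j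
  proof (induction j)
    case 0
    then show ?case using level_V_start q by (simp add: min_def)
  next
    case (Suc j)
    then have "level_V (min (min (- 3 + q + real j * q) (-(1/8)) + q) (-(1/8)))"
      by (rule level_V_step) (rule min.cobounded2)
    also have "min (min (- 3 + q + real j * q) (-(1/8)) + q) (-(1/8)) = min (- 3 + q + real (Suc j) * q) (-(1/8))"
      using q by (auto simp: min_def algebra_simps)
    finally show ?case .
  qed
  moreover obtain j :: nat where "real j * q \<ge> 3" using q reals_Archimedean3 by (metis less_eq_real_def)
  then have "min (- 3 + q + real j * q) (-(1/8)) = -(1/8)" using q by auto
  ultimately show ?thesis by metis
qed

text \<open>The derivative of the difference is \<open>V n x / x\<close>. Division by x leaves
  |x|^3, at most (1 + x^2)^(3/2), and 3/2 - 15/8 = -3/8: the level -1/8 for \<open>V\<close> is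
  exactly the level 3/8 for the derivative.\<close>

theorem wild_decay:
  obtains C N where "0 \<le> C"
    "\<And>n x. n \<ge> N \<Longrightarrow> \<bar>Q n x - gam \<sigma> x\<bar> \<le> C * pc n * (1 + x\<^sup>2) powr (-(3/8))"
    "\<And>n x. n \<ge> N \<Longrightarrow> \<exists>d. ((\<lambda>x. Q n x - gam \<sigma> x) has_real_derivative d) (at x)
        \<and> \<bar>d\<bar> \<le> C * pc n * (1 + x\<^sup>2) powr (-(3/8))"
proof -
  obtain C0 N0 where C0: "0 \<le> C0" "\<And>n. n \<ge> N0 \<Longrightarrow> bnd 4 (C0 * pc n) (2 + 3/8) (U n)"
    using level_U_final unfolding level_U_def by blast
  obtain C1 N1 where C1: "0 \<le> C1" "\<And>n. n \<ge> N1 \<Longrightarrow> bnd 4 (C1 * pc n) (2 + -(1/8)) (V n)"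
    using level_V_final unfolding level_V_def by blast
  define C where "C = C0 + C1"
  have C: "0 \<le> C" using C0 C1 by (simp add: C_def)
  have U: "\<bar>Q n x - gam \<sigma> x\<bar> \<le> C * pc n * (1 + x\<^sup>2) powr (-(3/8))" if "n \<ge> max N0 N1" for n x
  proof -
    have "bnd 0 (C0 * pc n) (3/8) (U n)"
      using that C0 pc_pos[of n] by (intro bnd_4_0) auto
    then have "bnd 0 (C * pc n) (3/8) (U n)"
      by (rule bnd_mono) (use C0 C1 pc_pos[of n] in \<open>auto simp: C_def intro!: mult_right_mono\<close>)
    from bndD[OF this, of x] show ?thesis by (simp add: U_def)
  qed
  have V: "\<exists>d. ((\<lambda>x. Q n x - gam \<sigma> x) has_real_derivative d) (at x)
        \<and> \<bar>d\<bar> \<le> C * pc n * (1 + x\<^sup>2) powr (-(3/8))" if n: "n \<ge> max N0 N1" for n x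
  proof (intro exI conjI)
    define d where "d = (\<lambda>x. deriv (Q n) x - (- (\<sigma>\<^sup>2 * x) * gam \<sigma> x))"
    show "((\<lambda>x. Q n x - gam \<sigma> x) has_real_derivative d x) (at x)"
      unfolding d_def by (intro DERIV_diff Q_deriv gam_deriv)
    have cont: "continuous_on UNIV d" unfolding d_def by (intro continuous_intros deriv_Q_cont)
    have *: "\<bar>d y\<bar> \<le> C * pc n * (1 + y\<^sup>2) powr (-(3/8))" if "y \<noteq> 0" for y
    proof -
      have "\<bar>V n y\<bar> \<le> C1 * pc n * \<bar>y\<bar>^4 * (1 + y\<^sup>2) powr (-(2 + -(1/8)))"
        using bndD[OF C1(2), of n y] n by simp
      also have "V n y = y * d y" by (simp add: V_def D_def G_def d_def algebra_simps)
      also have "C1 * pc n * \<bar>y\<bar>^4 * (1 + y\<^sup>2) powr (-(2 + -(1/8)))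
          = \<bar>y\<bar> * (C1 * pc n * (\<bar>y\<bar>^3 * (1 + y\<^sup>2) powr (-(15/8))))"
        by (simp add: power_numeral_reduce mult_ac)
      finally have "\<bar>d y\<bar> \<le> C1 * pc n * (\<bar>y\<bar>^3 * (1 + y\<^sup>2) powr (-(15/8)))"
        using that by (simp add: abs_mult)
      also have "\<dots> \<le> C1 * pc n * (((1 + y\<^sup>2) powr (1/2))^3 * (1 + y\<^sup>2) powr (-(15/8)))"
        using C1 pc_pos[of n] by (intro mult_left_mono mult_right_mono power_mono abs_le_powr_half) auto
      also have "((1 + y\<^sup>2) powr (1/2))^3 = (1 + y\<^sup>2) powr (3/2)"
        using one_plus_sq_pos[of y] by (simp add: powr_realpow[symmetric] powr_powr)
      also have "C1 * pc n * ((1 + y\<^sup>2) powr (3/2) * (1 + y\<^sup>2) powr (-(15/8))) =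
          C1 * pc n * (1 + y\<^sup>2) powr (-(3/8))"
        unfolding one_plus_sq_powr_add by simp
      also have "\<dots> \<le> C * pc n * (1 + y\<^sup>2) powr (-(3/8))"
        using C0 C1 pc_pos[of n] by (intro mult_right_mono) (auto simp: C_def)
      finally show ?thesis .
    qed
    show "\<bar>d x\<bar> \<le> C * pc n * (1 + x\<^sup>2) powr (-(3/8))"
    proof (cases "x = 0")
      case True
      \<comment> \<open>At 0 the bound on \<open>V\<close> says nothing about the derivative, so the
        estimate is carried over from nonzero points by continuity.\<close>
      have "\<bar>d 0\<bar> \<le> C * pc n * (1 + 0\<^sup>2) powr (-(3/8))"
      proof (rule tendsto_le)
        have "isCont (\<lambda>y. \<bar>d y\<bar>) 0"
          using cont by (intro continuous_intros) (auto simp: continuous_on_eq_continuous_at)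
        then show "((\<lambda>y. \<bar>d y\<bar>) \<longlongrightarrow> \<bar>d 0\<bar>) (at 0)" by (simp add: isCont_def)
        have "isCont (\<lambda>y::real. C * pc n * (1 + y\<^sup>2) powr (-(3/8))) 0"
          by (intro continuous_intros) auto
        then show "((\<lambda>y. C * pc n * (1 + y\<^sup>2) powr (-(3/8))) \<longlongrightarrow> C * pc n * (1 + 0\<^sup>2) powr (-(3/8))) (at (0::real))"
          by (simp add: isCont_def)
        show "\<forall>\<^sub>F y in at 0. \<bar>d y\<bar> \<le> C * pc n * (1 + y\<^sup>2) powr (-(3/8))"
          using * by (auto simp: eventually_at intro!: exI[of _ 1])
      qed auto
      then show ?thesis using True by simp
    qed (rule *)
  qed
  show ?thesis by (rule that[OF C U V])
qed

end

section \<open>Cosine and sine transforms\<close>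

lemma integrable_bounded_mult:
  fixes f b :: "real \<Rightarrow> real"
  assumes "integrable lborel f" "b \<in> borel_measurable borel" "\<And>x. \<bar>b x\<bar> \<le> 1"
  shows "integrable lborel (\<lambda>x. b x * f x)"
proof (rule Bochner_Integration.integrable_bound[OF assms(1)])
  have [measurable]: "f \<in> borel_measurable borel" using assms(1) by auto
  show "(\<lambda>x. b x * f x) \<in> borel_measurable lborel" using assms(2) by simp
  show "AE x in lborel. norm (b x * f x) \<le> norm (f x)"
    using assms(3) by (auto simp: abs_mult mult_left_le_one_le)
qed

lemma integrable_prod_mult:
  fixes f g :: "real \<Rightarrow> real" and b :: "real \<times> real \<Rightarrow> real"
  assumes f: "integrable lborel f" and g: "integrable lborel g"
    and b: "b \<in> borel_measurable (borel \<Otimes>\<^sub>M borel)" "\<And>z. \<bar>b z\<bar> \<le> 1"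
  shows "integrable (lborel \<Otimes>\<^sub>M lborel) (\<lambda>(x, y). b (x, y) * (f x * g y))"
proof -
  have [measurable]: "f \<in> borel_measurable borel" "g \<in> borel_measurable borel" using f g by auto
  have fg: "integrable (lborel \<Otimes>\<^sub>M lborel) (\<lambda>z. f (fst z) * g (snd z))"
  proof (rule lborel_pair.Fubini_integrable)
    show "(\<lambda>z. f (fst z) * g (snd z)) \<in> borel_measurable (lborel \<Otimes>\<^sub>M lborel)" by measurable
    show "integrable lborel (\<lambda>x. LBINT y. norm (f (fst (x, y)) * g (snd (x, y))))"
      using f by (simp add: abs_mult)
    show "AE x in lborel. integrable lborel (\<lambda>y. f (fst (x, y)) * g (snd (x, y)))"
      using g by simp
  qed
  show ?thesis
  proof (rule Bochner_Integration.integrable_bound[OF fg])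
    show "(\<lambda>(x, y). b (x, y) * (f x * g y)) \<in> borel_measurable (lborel \<Otimes>\<^sub>M lborel)"
      using b(1) by measurable
    show "AE z in lborel \<Otimes>\<^sub>M lborel. norm (case z of (x, y) \<Rightarrow> b (x, y) * (f x * g y)) \<le> norm (f (fst z) * g (snd z))"
      using b(2) by (auto simp: abs_mult mult_left_le_one_le)
  qed
qed

text \<open>For an integrable real function this and \<open>sinT\<close> are the real and imaginary
  parts of \<open>fourier\<close>, which are also its even and odd parts. They are kept apart
  because the flow treats them differently.\<close>

definition cosT :: "(real \<Rightarrow> real) \<Rightarrow> real \<Rightarrow> real" where
  "cosT f x = (LBINT v. cos (x * v) * f v)"

definition sinT :: "(real \<Rightarrow> real) \<Rightarrow> real \<Rightarrow> real" where
  "sinT f x = (LBINT v. sin (x * v) * f v)"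

lemma integral_bounded_mult_le:
  fixes f b :: "real \<Rightarrow> real"
  assumes "integrable lborel f" "b \<in> borel_measurable borel" "\<And>x. \<bar>b x\<bar> \<le> 1"
  shows "\<bar>LBINT x. b x * f x\<bar> \<le> (LBINT x. \<bar>f x\<bar>)"
proof -
  have "\<bar>LBINT x. b x * f x\<bar> \<le> (LBINT x. \<bar>b x * f x\<bar>)" by (rule integral_abs_bound)
  also have "\<dots> \<le> (LBINT x. \<bar>f x\<bar>)"
    using integrable_bounded_mult[OF assms] assms(1,3)
    by (intro integral_mono integrable_abs) (auto simp: abs_mult mult_left_le_one_le)
  finally show ?thesis .
qed

lemma integrable_cosT:
  fixes f :: "real \<Rightarrow> real" and x :: real
  shows "integrable lborel f \<Longrightarrow> integrable lborel (\<lambda>v. cos (x * v) * f v)"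
  using integrable_bounded_mult[of f "\<lambda>v. cos (x * v)"] by simp

lemma integrable_sinT:
  fixes f :: "real \<Rightarrow> real" and x :: real
  shows "integrable lborel f \<Longrightarrow> integrable lborel (\<lambda>v. sin (x * v) * f v)"
  using integrable_bounded_mult[of f "\<lambda>v. sin (x * v)"] by simp

lemma sinT_minus: "sinT f (- x) = - sinT f x"
  by (simp add: sinT_def)

lemma continuous_cosT:
  assumes "integrable lborel f"
  shows "continuous_on UNIV (cosT f)"
  unfolding cosT_def continuous_on_eq_continuous_at[OF open_UNIV] 
proof
  fix x :: real
  have [measurable]: "f \<in> borel_measurable borel" using assms by auto
  show "isCont (\<lambda>x. LBINT v. cos (x * v) * f v) x"
    unfolding continuous_at_sequentially
  proof (intro allI impI)
    fix X assume X: "X \<longlonglongrightarrow> x"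
    have "(\<lambda>n. LBINT v. cos (X n * v) * f v) \<longlonglongrightarrow> (LBINT v. cos (x * v) * f v)"
    proof (rule integral_dominated_convergence[where w="\<lambda>v. \<bar>f v\<bar>"])
      show "AE v in lborel. (\<lambda>n. cos (X n * v) * f v) \<longlonglongrightarrow> cos (x * v) * f v"
        by (intro AE_I2 tendsto_intros X)
    qed (use assms in \<open>auto simp: abs_mult mult_left_le_one_le\<close>)
    then show "((\<lambda>x. LBINT v. cos (x * v) * f v) \<circ> X) \<longlonglongrightarrow> (LBINT v. cos (x * v) * f v)"
      by (simp add: o_def)
  qed
qed

lemma continuous_sinT:
  assumes "integrable lborel f"
  shows "continuous_on UNIV (sinT f)"
  unfolding sinT_def continuous_on_eq_continuous_at[OF open_UNIV] 
proof
  fix x :: real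
  have [measurable]: "f \<in> borel_measurable borel" using assms by auto
  show "isCont (\<lambda>x. LBINT v. sin (x * v) * f v) x"
    unfolding continuous_at_sequentially
  proof (intro allI impI)
    fix X assume X: "X \<longlonglongrightarrow> x"
    have "(\<lambda>n. LBINT v. sin (X n * v) * f v) \<longlonglongrightarrow> (LBINT v. sin (x * v) * f v)"
    proof (rule integral_dominated_convergence[where w="\<lambda>v. \<bar>f v\<bar>"])
      show "AE v in lborel. (\<lambda>n. sin (X n * v) * f v) \<longlonglongrightarrow> sin (x * v) * f v"
        by (intro AE_I2 tendsto_intros X)
    qed (use assms in \<open>auto simp: abs_mult mult_left_le_one_le\<close>)
    then show "((\<lambda>x. LBINT v. sin (x * v) * f v) \<circ> X) \<longlonglongrightarrow> (LBINT v. sin (x * v) * f v)"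
      by (simp add: o_def)
  qed
qed

lemma abs_cosT_le: "integrable lborel f \<Longrightarrow> \<bar>cosT f x\<bar> \<le> (LBINT v. \<bar>f v\<bar>)"
  unfolding cosT_def using integral_bounded_mult_le[of f "\<lambda>v. cos (x * v)"] by simp

lemma abs_sinT_le: "integrable lborel f \<Longrightarrow> \<bar>sinT f x\<bar> \<le> (LBINT v. \<bar>f v\<bar>)"
  unfolding sinT_def using integral_bounded_mult_le[of f "\<lambda>v. sin (x * v)"] by simp

section \<open>Transforms of normal densities\<close>

lemma std_normal_transforms:
  "cosT std_normal_density x = exp (- (x\<^sup>2 / 2))" "sinT std_normal_density x = 0"
proof -
  have int: "complex_integrable std_normal_distribution (\<lambda>v. iexp (x * v))"
    by (rule finite_measure.integrable_const_bound[where B=1])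
      (auto intro!: prob_space.finite_measure prob_space_normal_density)
  have char: "char std_normal_distribution x = complex_of_real (exp (- (x\<^sup>2) / 2))"
    by (simp add: char_std_normal_distribution)
  have "Re (char std_normal_distribution x) = (LINT v|std_normal_distribution. cos (x * v))"
    unfolding char_def by (subst integral_Re[OF int, symmetric]) (simp add: Re_exp)
  also have "\<dots> = cosT std_normal_density x"
    unfolding cosT_def by (subst integral_density) (auto simp: mult.commute)
  finally show "cosT std_normal_density x = exp (- (x\<^sup>2 / 2))" by (simp add: char del: of_real_exp)
  have "Im (char std_normal_distribution x) = (LINT v|std_normal_distribution. sin (x * v))"
    unfolding char_def by (subst integral_Im[OF int, symmetric]) (simp add: Im_exp)
  also have "\<dots> = sinT std_normal_density x"
    unfolding sinT_def by (subst integral_density) (auto simp: mult.commute)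
  finally show "sinT std_normal_density x = 0" by (simp add: char del: of_real_exp)
qed

lemma cosT_affine:
  assumes "s \<noteq> 0"
  shows "cosT (\<lambda>v. f (v / s)) x = \<bar>s\<bar> * cosT f (s * x)" "sinT (\<lambda>v. f (v / s)) x = \<bar>s\<bar> * sinT f (s * x)"
  unfolding cosT_def sinT_def
  using lborel_integral_real_affine[OF assms, of "\<lambda>v. cos (x * v) * f (v / s)" 0]
    lborel_integral_real_affine[OF assms, of "\<lambda>v. sin (x * v) * f (v / s)" 0] assms
  by (simp_all add: mult_ac)

lemma cosT_cmult: "cosT (\<lambda>v. c * f v) x = c * cosT f x" "sinT (\<lambda>v. c * f v) x = c * sinT f x"
  unfolding cosT_def sinT_def by (simp_all add: mult.left_commute[of _ c])

lemma normal_density_transforms: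
  assumes "0 < s"
  shows "cosT (normal_density 0 s) x = gam s x" "sinT (normal_density 0 s) x = 0"
proof -
  have *: "normal_density 0 s = (\<lambda>v. 1 / s * std_normal_density (v / s))"
    using assms by (auto simp: normal_density_def fun_eq_iff power_divide real_sqrt_mult mult.commute)
  show "cosT (normal_density 0 s) x = gam s x" "sinT (normal_density 0 s) x = 0"
    unfolding * cosT_cmult using cosT_affine[of s std_normal_density x] assms
    by (auto simp: std_normal_transforms gam_def power_mult_distrib)
qed

text \<open>The Gaussian is, up to a constant, its own transform: \<open>gam s\<close> is
  \<open>\<surd>(2\<pi>) / s\<close> times the normal density of standard deviation \<open>1 / s\<close>.\<close>

lemma gam_transforms:
  assumes s: "0 < s"
  shows "cosT (gam s) x = 2 * pi * normal_density 0 s x" "sinT (gam s) x = 0"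
proof -
  have *: "gam s = (\<lambda>v. sqrt (2*pi) / s * normal_density 0 (1 / s) v)"
    using s by (auto simp: gam_def normal_density_def fun_eq_iff power_divide real_sqrt_mult real_sqrt_divide field_simps)
  have "cosT (gam s) x = sqrt (2*pi) / s * gam (1 / s) x"
    unfolding * cosT_cmult using s by (subst normal_density_transforms) auto
  also have "\<dots> = 2 * pi * normal_density 0 s x"
  proof -
    have "2 * pi = sqrt (2*pi) * sqrt (2*pi)" by simp
    then show ?thesis
      using s by (simp add: gam_def normal_density_def power_divide real_sqrt_mult field_simps)
  qed
  finally show "cosT (gam s) x = 2 * pi * normal_density 0 s x" .
  show "sinT (gam s) x = 0"
    unfolding * cosT_cmult using s by (subst normal_density_transforms) auto
qed

lemma integrable_gam: "0 < s \<Longrightarrow> integrable lborel (gam s)"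
proof -
  assume s: "0 < s"
  have *: "gam s = (\<lambda>v. sqrt (2*pi) / s * normal_density 0 (1 / s) v)"
    using s by (auto simp: gam_def normal_density_def fun_eq_iff power_divide real_sqrt_mult real_sqrt_divide field_simps)
  show ?thesis unfolding * using s by (intro integrable_mult_right integrable_normal_density) auto
qed

lemma gam_measurable [measurable]: "gam s \<in> borel_measurable borel"
  by (intro borel_measurable_continuous_onI continuous_gam)

lemma integrable_mult_gam:
  assumes "\<And>v. \<bar>b v\<bar> \<le> B" "b \<in> borel_measurable borel" "0 < s"
  shows "integrable lborel (\<lambda>v. b v * gam s v)"
proof (rule Bochner_Integration.integrable_bound)
  show "integrable lborel (\<lambda>v. B * gam s v)" using integrable_gam[OF assms(3)] by simp
  show "AE v in lborel. norm (b v * gam s v) \<le> norm (B * gam s v)"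
    using assms(1) by (auto simp: abs_mult intro!: mult_right_mono order_trans[OF assms(1)])
qed (use assms in auto)

lemma
  assumes P: "integrable lborel P"
  shows cosT_measurable: "cosT P \<in> borel_measurable borel"
    and sinT_measurable: "sinT P \<in> borel_measurable borel"
  using P by (auto intro!: borel_measurable_continuous_onI continuous_cosT continuous_sinT)

lemma
  assumes P: "integrable lborel P" and s: "0 < s"
  shows integrable_cosT_gam: "integrable lborel (\<lambda>v. cosT P v * gam s v)"
    and integrable_sinT_gam: "integrable lborel (\<lambda>v. sinT P v * gam s v)"
  by (rule integrable_mult_gam[OF abs_cosT_le[OF P] cosT_measurable[OF P] s]
      integrable_mult_gam[OF abs_sinT_le[OF P] sinT_measurable[OF P] s])+

text \<open>Fourier inversion with a Gaussian damping factor: since cos (xv) cos (yv) + sin (xv) sin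
  (yv) = cos ((x - y) v), Fubini's theorem yields 2\<pi> times the convolution of \<open>P\<close>
  with a normal density. The damping makes every integral absolutely convergent.\<close>

lemma gaussian_kernel:
  assumes P: "integrable lborel P" and s: "0 < s"
  shows "cosT (\<lambda>v. cosT P v * gam s v) x + sinT (\<lambda>v. sinT P v * gam s v) x
    = (LBINT y. P y * (2 * pi * normal_density 0 s (x - y)))"
proof -
  have [measurable]: "P \<in> borel_measurable borel" using P by auto
  define cg where "cg = (\<lambda>v. cosT P v * gam s v)"
  define sg where "sg = (\<lambda>v. sinT P v * gam s v)"
  have cg: "integrable lborel cg" and sg: "integrable lborel sg"
    unfolding cg_def sg_def by (rule integrable_cosT_gam[OF P s] integrable_sinT_gam[OF P s])+
    have i1: "integrable (lborel \<Otimes>\<^sub>M lborel) (\<lambda>(y, v). cos ((x - y) * v) * (P y * gam s v))"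
      using integrable_prod_mult[OF P integrable_gam[OF s], of "\<lambda>(y, v). cos ((x - y) * v)"] by (auto simp: split_beta)
    have "cosT cg x + sinT sg x = (LBINT v. cos (x * v) * cg v + sin (x * v) * sg v)"
      unfolding cosT_def[of cg] sinT_def[of sg]
      by (rule Bochner_Integration.integral_add[symmetric]) (intro integrable_cosT integrable_sinT cg sg)+
    also have "\<dots> = (LBINT v. LBINT y. cos ((x - y) * v) * (P y * gam s v))"
    proof (rule Bochner_Integration.integral_cong[OF refl])
      fix v
      have "cos (x * v) * cg v + sin (x * v) * sg v =
        (LBINT y. (cos (v * y) * P y) * (cos (x * v) * gam s v)) + (LBINT y. (sin (v * y) * P y) * (sin (x * v) * gam s v))"
        by (simp add: cg_def sg_def cosT_def[of P] sinT_def[of P])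
      also have "\<dots> = (LBINT y. (cos (v * y) * P y) * (cos (x * v) * gam s v) + (sin (v * y) * P y) * (sin (x * v) * gam s v))"
        by (rule Bochner_Integration.integral_add[symmetric])
          (intro integrable_mult_left integrable_cosT integrable_sinT P)+
      also have "\<dots> = (LBINT y. cos ((x - y) * v) * (P y * gam s v))"
        by (intro Bochner_Integration.integral_cong refl) (simp add: left_diff_distrib cos_diff algebra_simps)
      finally show "cos (x * v) * cg v + sin (x * v) * sg v = (LBINT y. cos ((x - y) * v) * (P y * gam s v))" .
    qed
    also have "\<dots> = (LBINT y. LBINT v. cos ((x - y) * v) * (P y * gam s v))"
      by (rule lborel_pair.Fubini_integral[OF i1])
    also have "\<dots> = (LBINT y. P y * cosT (gam s) (x - y))"
      unfolding cosT_def by (simp add: mult.left_commute[of _ "P _"])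
    finally show ?thesis by (simp add: gam_transforms[OF s] cg_def sg_def)
qed

text \<open>Unfolding one transform of each square and inserting \<open>gaussian_kernel\<close>
  gives 2\<pi> times the double integral of \<open>P x * P y * N (x - y)\<close>. By
  \<open>P x * P y \<le> ((P x)\<^sup>2 + (P y)\<^sup>2) / 2\<close> and the unit mass of the kernel
  it is at most the integral of the square.\<close>

lemma bessel_gaussian:
  assumes P: "integrable lborel P" and P2: "integrable lborel (\<lambda>x. (P x)\<^sup>2)" and s: "0 < s"
  shows "(LBINT v. ((cosT P v)\<^sup>2 + (sinT P v)\<^sup>2) * gam s v) \<le> 2 * pi * (LBINT x. (P x)\<^sup>2)"
    and "integrable lborel (\<lambda>v. ((cosT P v)\<^sup>2 + (sinT P v)\<^sup>2) * gam s v)"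
proof -
  have [measurable]: "P \<in> borel_measurable borel" using P by auto
  have [measurable]: "cosT P \<in> borel_measurable borel" "sinT P \<in> borel_measurable borel"
    using P by (rule cosT_measurable sinT_measurable)+
  define N where "N = normal_density 0 s"
  have N: "integrable lborel (\<lambda>y. N (x - y))" "(LBINT y. N (x - y)) = 1" for x
    using integral_normal_density[OF s, of 0] integrable_normal_density[OF s, of 0]
      lborel_integrable_real_affine[of N "-1" x] lborel_integral_real_affine[of "-1" N x]
    by (auto simp: N_def)
  have Npos: "0 \<le> N y" for y by (simp add: N_def)
  have [measurable]: "N \<in> borel_measurable borel" by (simp add: N_def)
  define B where "B = (LBINT v. \<bar>P v\<bar>)"
  have bounded: "\<bar>cosT P v\<bar> \<le> B" "\<bar>sinT P v\<bar> \<le> B" for v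
    unfolding B_def by (rule abs_cosT_le[OF P] abs_sinT_le[OF P])+
  have sq: "\<bar>(cosT P v)\<^sup>2 + (sinT P v)\<^sup>2\<bar> \<le> B\<^sup>2 + B\<^sup>2" for v
    using bounded[of v] power_mono[of "\<bar>cosT P v\<bar>" B 2] power_mono[of "\<bar>sinT P v\<bar>" B 2] by simp
  show "integrable lborel (\<lambda>v. ((cosT P v)\<^sup>2 + (sinT P v)\<^sup>2) * gam s v)"
    by (rule integrable_mult_gam[OF sq _ s]) simp
  define cg where "cg = (\<lambda>v. cosT P v * gam s v)"
  define sg where "sg = (\<lambda>v. sinT P v * gam s v)"
  have cg: "integrable lborel cg" and sg: "integrable lborel sg"
    unfolding cg_def sg_def by (rule integrable_cosT_gam[OF P s] integrable_sinT_gam[OF P s])+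
  have kernel: "cosT cg x + sinT sg x = (LBINT y. P y * (2 * pi * N (x - y)))" for x
    unfolding cg_def sg_def N_def by (rule gaussian_kernel[OF P s])
  have "(LBINT v. ((cosT P v)\<^sup>2 + (sinT P v)\<^sup>2) * gam s v) =
     (LBINT v. LBINT x. cos (x * v) * (P x * cg v) + sin (x * v) * (P x * sg v))"
  proof (rule Bochner_Integration.integral_cong[OF refl])
    fix v
    have "((cosT P v)\<^sup>2 + (sinT P v)\<^sup>2) * gam s v = cosT P v * cg v + sinT P v * sg v"
      by (simp add: cg_def sg_def power2_eq_square algebra_simps)
    also have "\<dots> = (LBINT x. (cos (v * x) * P x) * cg v) + (LBINT x. (sin (v * x) * P x) * sg v)"
      by (simp add: cosT_def[of P] sinT_def[of P])
    also have "\<dots> = (LBINT x. (cos (v * x) * P x) * cg v + (sin (v * x) * P x) * sg v)"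
      by (rule Bochner_Integration.integral_add[symmetric])
        (intro integrable_mult_left integrable_cosT integrable_sinT P)+
    finally show "((cosT P v)\<^sup>2 + (sinT P v)\<^sup>2) * gam s v =
        (LBINT x. cos (x * v) * (P x * cg v) + sin (x * v) * (P x * sg v))"
      by (simp add: mult_ac)
  qed
  also have "\<dots> = (LBINT x. LBINT v. cos (x * v) * (P x * cg v) + sin (x * v) * (P x * sg v))"
  proof (rule lborel_pair.Fubini_integral)
    have "integrable (lborel \<Otimes>\<^sub>M lborel) (\<lambda>(x, v). cos (x * v) * (P x * cg v))"
      using integrable_prod_mult[OF P cg, of "\<lambda>(x, v). cos (x * v)"] by (auto simp: split_beta)
    moreover have "integrable (lborel \<Otimes>\<^sub>M lborel) (\<lambda>(x, v). sin (x * v) * (P x * sg v))"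
      using integrable_prod_mult[OF P sg, of "\<lambda>(x, v). sin (x * v)"] by (auto simp: split_beta)
    ultimately show "integrable (lborel \<Otimes>\<^sub>M lborel)
        (\<lambda>(x, v). cos (x * v) * (P x * cg v) + sin (x * v) * (P x * sg v))"
      unfolding split_beta by (rule Bochner_Integration.integrable_add)
  qed
  also have "\<dots> = (LBINT x. P x * (cosT cg x + sinT sg x))"
  proof (rule Bochner_Integration.integral_cong[OF refl])
    fix x
    have "P x * (cosT cg x + sinT sg x) = P x * (LBINT v. cos (x * v) * cg v + sin (x * v) * sg v)"
      unfolding cosT_def[of cg] sinT_def[of sg]
      by (subst Bochner_Integration.integral_add) (auto intro!: integrable_cosT integrable_sinT cg sg)
    also have "\<dots> = (LBINT v. P x * (cos (x * v) * cg v + sin (x * v) * sg v))" by simp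
    finally show "(LBINT v. cos (x * v) * (P x * cg v) + sin (x * v) * (P x * sg v)) = P x * (cosT cg x + sinT sg x)"
      by (simp add: algebra_simps)
  qed
  also have "\<dots> = (LBINT x. LBINT y. 2 * pi * (P x * P y * N (x - y)))"
    unfolding kernel by (simp add: mult_ac)
  also have "\<dots> \<le> 2 * pi * (LBINT x. (P x)\<^sup>2)"
  proof -
    define F where "F = (\<lambda>(x, y). (P x)\<^sup>2 * N (x - y))"
    define F' where "F' = (\<lambda>(x, y). (P y)\<^sup>2 * N (x - y))"
    have F: "integrable (lborel \<Otimes>\<^sub>M lborel) F"
      unfolding F_def by (rule lborel_pair.Fubini_integrable) (use P2 N Npos in \<open>auto simp: abs_mult\<close>)
    have N': "N (x - y) = N (y - x)" for x y by (simp add: N_def normal_density_def power2_commute)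
    have F': "integrable (lborel \<Otimes>\<^sub>M lborel) F'"
      using lborel_pair.integrable_product_swap[OF F] N' by (simp add: F_def F'_def split_beta)
    have le: "P x * P y * N (x - y) \<le> F (x, y) / 2 + F' (x, y) / 2" for x y
    proof -
      have "P x * P y \<le> (P x)\<^sup>2 / 2 + (P y)\<^sup>2 / 2"
        using sum_squares_ge_zero[of "P x - P y" 0] by (simp add: power2_eq_square algebra_simps)
      from mult_right_mono[OF this Npos[of "x - y"]] show ?thesis
        by (simp add: F_def F'_def distrib_right)
    qed
    \<comment> \<open>The same inequality with absolute values dominates the double integrand, which
      makes it integrable.\<close>
    have le': "\<bar>P x * P y * N (x - y)\<bar> \<le> F (x, y) / 2 + F' (x, y) / 2" for x y
    proof -
      have "\<bar>P x\<bar> * \<bar>P y\<bar> \<le> (P x)\<^sup>2 / 2 + (P y)\<^sup>2 / 2"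
        using sum_squares_ge_zero[of "\<bar>P x\<bar> - \<bar>P y\<bar>" 0] by (simp add: power2_eq_square algebra_simps)
      from mult_right_mono[OF this Npos[of "x - y"]] show ?thesis
        using Npos[of "x - y"] by (simp add: F_def F'_def distrib_right abs_mult)
    qed
    have S: "integrable (lborel \<Otimes>\<^sub>M lborel) (\<lambda>z. F z / 2 + F' z / 2)"
      using F F' by auto
    have PP: "integrable (lborel \<Otimes>\<^sub>M lborel) (\<lambda>(x, y). P x * P y * N (x - y))"
      by (rule Bochner_Integration.integrable_bound[OF S])
        (auto intro!: AE_I2 le'[THEN order_trans] simp del: abs_divide)
    have "(LBINT x. LBINT y. 2 * pi * (P x * P y * N (x - y))) = 2 * pi * (LBINT x. LBINT y. P x * P y * N (x - y))"
      by simp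
    also have "(LBINT x. LBINT y. P x * P y * N (x - y)) = (\<integral>z. (case z of (x, y) \<Rightarrow> P x * P y * N (x - y)) \<partial>(lborel \<Otimes>\<^sub>M lborel))"
      using lborel_pair.integral_fst[OF PP] by simp
    also have "\<dots> \<le> (\<integral>z. F z / 2 + F' z / 2 \<partial>(lborel \<Otimes>\<^sub>M lborel))"
      by (rule integral_mono[OF PP S]) (use le in auto)
    also have "\<dots> = integral\<^sup>L (lborel \<Otimes>\<^sub>M lborel) F / 2 + integral\<^sup>L (lborel \<Otimes>\<^sub>M lborel) F' / 2"
      using F F' by simp
    also have "integral\<^sup>L (lborel \<Otimes>\<^sub>M lborel) F = (LBINT x. LBINT y. F (x, y))"
      using lborel_pair.integral_fst[of "\<lambda>x y. F (x, y)"] F by simp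
    also have "\<dots> = (LBINT x. (P x)\<^sup>2)"
      by (simp add: F_def N)
    also have "integral\<^sup>L (lborel \<Otimes>\<^sub>M lborel) F' = (LBINT y. LBINT x. F' (x, y))"
      using lborel_pair.integral_snd[of "\<lambda>x y. F' (x, y)"] F' by simp
    also have "\<dots> = (LBINT x. (P x)\<^sup>2)"
      using N by (simp add: F'_def N'[of _ "_ :: real"])
    finally show ?thesis by simp
  qed
  finally show "(LBINT v. ((cosT P v)\<^sup>2 + (sinT P v)\<^sup>2) * gam s v) \<le> 2 * pi * (LBINT x. (P x)\<^sup>2)" .
qed

section \<open>Bounding the \<open>L\<^sup>1\<close> norm by the transform\<close>

lemma Liminf_le_bound:
  fixes f :: "nat \<Rightarrow> ennreal"
  assumes "\<And>n. f n \<le> C"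
  shows "liminf f \<le> C"
proof -
  have "liminf f \<le> limsup f" by (rule Liminf_le_Limsup) simp
  also have "\<dots> \<le> C" by (rule Limsup_bounded) (use assms in auto)
  finally show ?thesis .
qed

lemma nn_integral_le_of_tendsto:
  fixes f :: "nat \<Rightarrow> real \<Rightarrow> real"
  assumes "\<And>n. f n \<in> borel_measurable borel"
    and "\<And>x. (\<lambda>n. f n x) \<longlonglongrightarrow> g x"
    and "\<And>n. (\<integral>\<^sup>+x. ennreal (f n x) \<partial>lborel) \<le> C"
  shows "(\<integral>\<^sup>+x. ennreal (g x) \<partial>lborel) \<le> C"
proof -
  have "(\<integral>\<^sup>+x. ennreal (g x) \<partial>lborel) = (\<integral>\<^sup>+x. liminf (\<lambda>n. ennreal (f n x)) \<partial>lborel)"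
    by (intro nn_integral_cong lim_imp_Liminf[symmetric] tendsto_ennrealI assms(2)) simp
  also have "\<dots> \<le> liminf (\<lambda>n. \<integral>\<^sup>+x. ennreal (f n x) \<partial>lborel)"
    by (rule nn_integral_liminf) (use assms(1) in measurable)
  also have "\<dots> \<le> C" by (rule Liminf_le_bound) (rule assms(3))
  finally show ?thesis .
qed

lemma inverse_Suc_tendsto: "(\<lambda>n. 1 / real (Suc n)) \<longlonglongrightarrow> 0"
  using LIMSEQ_inverse_real_of_nat by (simp add: inverse_eq_divide)

text \<open>As the parameter s tends to 0 the damping \<open>gam s\<close> tends to 1 pointwise;
  Fatou's lemma suffices, as only an inequality is needed.\<close>

lemma bessel:
  assumes P: "integrable lborel P" and P2: "integrable lborel (\<lambda>x. (P x)\<^sup>2)"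
  shows "(\<integral>\<^sup>+v. ennreal ((cosT P v)\<^sup>2 + (sinT P v)\<^sup>2) \<partial>lborel) \<le> ennreal (2 * pi * (LBINT x. (P x)\<^sup>2))"
proof (rule nn_integral_le_of_tendsto)
  let ?s = "\<lambda>n. 1 / real (Suc n)"
  let ?f = "\<lambda>n v. ((cosT P v)\<^sup>2 + (sinT P v)\<^sup>2) * gam (?s n) v"
  note [measurable] = cosT_measurable[OF P] sinT_measurable[OF P]
  fix n show "?f n \<in> borel_measurable borel" by measurable
  have "(\<integral>\<^sup>+v. ennreal (?f n v) \<partial>lborel) = ennreal (LBINT v. ?f n v)"
    by (intro nn_integral_eq_integral bessel_gaussian(2)[OF P P2]) (auto simp: gam_def)
  also have "\<dots> \<le> ennreal (2 * pi * (LBINT x. (P x)\<^sup>2))"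
    by (intro ennreal_leI bessel_gaussian(1)[OF P P2]) simp
  finally show "(\<integral>\<^sup>+v. ennreal (?f n v) \<partial>lborel) \<le> ennreal (2 * pi * (LBINT x. (P x)\<^sup>2))" .
next
  let ?s = "\<lambda>n. 1 / real (Suc n)"
  fix v
  have "(\<lambda>n. ((cosT P v)\<^sup>2 + (sinT P v)\<^sup>2) * exp (- ((?s n)\<^sup>2 * v\<^sup>2 / 2))) \<longlonglongrightarrow>
      ((cosT P v)\<^sup>2 + (sinT P v)\<^sup>2) * exp (- (0\<^sup>2 * v\<^sup>2 / 2))"
    by (intro tendsto_intros inverse_Suc_tendsto) auto
  then show "(\<lambda>n. ((cosT P v)\<^sup>2 + (sinT P v)\<^sup>2) * gam (?s n) v) \<longlonglongrightarrow> (cosT P v)\<^sup>2 + (sinT P v)\<^sup>2"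
    by (simp add: gam_def)
qed

lemma integrable_shift:
  fixes P :: "real \<Rightarrow> real"
  shows "integrable lborel P \<Longrightarrow> integrable lborel (\<lambda>x. P (x + h))"
  using lborel_integrable_real_affine[of P 1 h] by (simp add: add.commute)

lemma shift_transforms:
  assumes P: "integrable lborel P"
  shows "cosT (\<lambda>x. P (x + h)) v = cos (h * v) * cosT P v + sin (h * v) * sinT P v"
    and "sinT (\<lambda>x. P (x + h)) v = cos (h * v) * sinT P v - sin (h * v) * cosT P v"
proof -
  have "cosT (\<lambda>x. P (x + h)) v = (LBINT x. cos (v * (x - h)) * P x)"
    unfolding cosT_def using lborel_integral_real_affine[of 1 "\<lambda>x. cos (v * (x - h)) * P x" h]
    by (simp add: add.commute)
  also have "\<dots> = (LBINT x. cos (h * v) * (cos (v * x) * P x) + sin (h * v) * (sin (v * x) * P x))"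
    by (intro Bochner_Integration.integral_cong refl) (simp add: right_diff_distrib cos_diff algebra_simps)
  also have "\<dots> = cos (h * v) * cosT P v + sin (h * v) * sinT P v"
    unfolding cosT_def sinT_def
    by (subst Bochner_Integration.integral_add) (simp_all add: integrable_cosT[OF P] integrable_sinT[OF P])
  finally show "cosT (\<lambda>x. P (x + h)) v = cos (h * v) * cosT P v + sin (h * v) * sinT P v" .
  have "sinT (\<lambda>x. P (x + h)) v = (LBINT x. sin (v * (x - h)) * P x)"
    unfolding sinT_def using lborel_integral_real_affine[of 1 "\<lambda>x. sin (v * (x - h)) * P x" h]
    by (simp add: add.commute)
  also have "\<dots> = (LBINT x. cos (h * v) * (sin (v * x) * P x) - sin (h * v) * (cos (v * x) * P x))"
    by (intro Bochner_Integration.integral_cong refl) (simp add: right_diff_distrib sin_diff algebra_simps)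
  also have "\<dots> = cos (h * v) * sinT P v - sin (h * v) * cosT P v"
    unfolding cosT_def sinT_def
    by (subst Bochner_Integration.integral_diff) (simp_all add: integrable_cosT[OF P] integrable_sinT[OF P])
  finally show "sinT (\<lambda>x. P (x + h)) v = cos (h * v) * sinT P v - sin (h * v) * cosT P v" .
qed

lemma transforms_diff:
  assumes "integrable lborel f" "integrable lborel g"
  shows "cosT (\<lambda>x. f x - g x) v = cosT f v - cosT g v" "sinT (\<lambda>x. f x - g x) v = sinT f v - sinT g v"
  unfolding cosT_def sinT_def right_diff_distrib
  by (rule Bochner_Integration.integral_diff; intro integrable_cosT integrable_sinT assms)+

text \<open>Bessel's inequality for the derivative of \<open>P\<close>, without assuming that it
  exists. The difference quotient with step h has a transform whose modulus is that of
  \<open>P\<close> times |2 sin (h v / 2) / h|; this factor tends to |v|, and Fatou's lemma gives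
  the weighted bound.\<close>

lemma bessel_weighted:
  assumes P: "integrable lborel P"
    and diff: "\<And>h. 0 < h \<Longrightarrow> h \<le> 1 \<Longrightarrow> integrable lborel (\<lambda>x. (P (x + h) - P x)\<^sup>2)"
    and D: "\<And>h. 0 < h \<Longrightarrow> h \<le> 1 \<Longrightarrow> (LBINT x. (P (x + h) - P x)\<^sup>2) \<le> D * h\<^sup>2"
  shows "(\<integral>\<^sup>+v. ennreal (v\<^sup>2 * ((cosT P v)\<^sup>2 + (sinT P v)\<^sup>2)) \<partial>lborel) \<le> ennreal (2 * pi * D)"
proof (rule nn_integral_le_of_tendsto)
  let ?h = "\<lambda>n. 1 / real (Suc n)"
  let ?f = "\<lambda>n v. (2 * sin (?h n * v / 2) / ?h n)\<^sup>2 * ((cosT P v)\<^sup>2 + (sinT P v)\<^sup>2)"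
  note [measurable] = cosT_measurable[OF P] sinT_measurable[OF P]
  fix n show "?f n \<in> borel_measurable borel" by measurable
  define h where "h = ?h n"
  have h: "0 < h" "h \<le> 1" by (auto simp: h_def)
  define R where "R = (\<lambda>x. P (x + h) - P x)"
  have Ri: "integrable lborel R" unfolding R_def by (intro Bochner_Integration.integrable_diff integrable_shift P)
  note [measurable] = cosT_measurable[OF Ri] sinT_measurable[OF Ri]
  have eq: "(cosT R v)\<^sup>2 + (sinT R v)\<^sup>2 = (2 * sin (h * v / 2))\<^sup>2 * ((cosT P v)\<^sup>2 + (sinT P v)\<^sup>2)" for v
  proof -
    let ?c = "cos (h * v)" and ?s = "sin (h * v)" and ?a = "cosT P v" and ?b = "sinT P v"
    have "(cosT R v)\<^sup>2 + (sinT R v)\<^sup>2 = (?c * ?a + ?s * ?b - ?a)\<^sup>2 + (?c * ?b - ?s * ?a - ?b)\<^sup>2"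
      unfolding R_def transforms_diff[OF integrable_shift[OF P] P] shift_transforms[OF P] ..
    also have "\<dots> = (?c\<^sup>2 + ?s\<^sup>2 + 1 - 2 * ?c) * (?a\<^sup>2 + ?b\<^sup>2)"
      by algebra
    also have "?c\<^sup>2 + ?s\<^sup>2 + 1 - 2 * ?c = (2 * sin (h * v / 2))\<^sup>2"
    proof -
      have "cos (h * v) = 1 - 2 * (sin (h * v / 2))\<^sup>2" using cos_double_sin[of "h * v / 2"] by simp
      then show ?thesis unfolding sin_cos_squared_add2 by (simp add: power_mult_distrib)
    qed
    finally show ?thesis .
  qed
  have "(\<integral>\<^sup>+v. ennreal (?f n v) \<partial>lborel) = (\<integral>\<^sup>+v. ennreal (1 / h\<^sup>2) * ennreal ((cosT R v)\<^sup>2 + (sinT R v)\<^sup>2) \<partial>lborel)"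
    unfolding eq using h unfolding h_def[symmetric]
    by (intro nn_integral_cong) (simp add: ennreal_mult[symmetric] power_divide)
  also have "\<dots> = ennreal (1 / h\<^sup>2) * (\<integral>\<^sup>+v. ennreal ((cosT R v)\<^sup>2 + (sinT R v)\<^sup>2) \<partial>lborel)"
    by (rule nn_integral_cmult) simp
  also have "\<dots> \<le> ennreal (1 / h\<^sup>2) * ennreal (2 * pi * (LBINT x. (R x)\<^sup>2))"
    using bessel[OF Ri] diff[OF h] by (intro mult_left_mono) (auto simp: R_def)
  also have "\<dots> \<le> ennreal (1 / h\<^sup>2) * ennreal (2 * pi * (D * h\<^sup>2))"
    using D[OF h] by (intro mult_left_mono ennreal_leI) (auto simp: R_def)
  also have "\<dots> = ennreal (2 * pi * D)"
    using h by (subst ennreal_mult'[symmetric]) (auto simp: mult.assoc)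
  finally show "(\<integral>\<^sup>+v. ennreal (?f n v) \<partial>lborel) \<le> ennreal (2 * pi * D)" .
next
  let ?h = "\<lambda>n. 1 / real (Suc n)"
  fix v
  have "((\<lambda>h. 2 * sin (h * v / 2)) has_real_derivative v) (at 0)"
    by (auto intro!: derivative_eq_intros)
  then have "((\<lambda>h. 2 * sin (h * v / 2) / h) \<longlongrightarrow> v) (at 0)"
    by (simp add: DERIV_def)
  moreover have "filterlim ?h (at 0) sequentially"
    unfolding filterlim_at using inverse_Suc_tendsto by auto
  ultimately have "(\<lambda>n. 2 * sin (?h n * v / 2) / ?h n) \<longlonglongrightarrow> v"
    by (rule filterlim_compose)
  then show "(\<lambda>n. (2 * sin (?h n * v / 2) / ?h n)\<^sup>2 * ((cosT P v)\<^sup>2 + (sinT P v)\<^sup>2)) \<longlonglongrightarrow>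
       v\<^sup>2 * ((cosT P v)\<^sup>2 + (sinT P v)\<^sup>2)"
    by (intro tendsto_intros)
qed

text \<open>The square of the decay rate (1 + x^2)^(-3/8); it is integrable because it behaves like
  |x|^(-3/2).\<close>

definition J :: "real \<Rightarrow> real" where "J x = (1 + x\<^sup>2) powr (-(3/4))"

lemma J_integrable: "integrable lborel J"
proof -
  have pos: "0 < 1 + (x::real)\<^sup>2" for x by (intro add_pos_nonneg) auto
  have meas: "J \<in> borel_measurable borel"
    unfolding J_def using pos
    by (intro borel_measurable_continuous_onI continuous_intros) (auto simp: less_imp_neq[symmetric])
  have tail: "integrable lborel (\<lambda>x. indicator {1..} x * x powr (-(3/2)) :: real)"
  proof -
    have "(\<lambda>x::real. x powr (-(3/2))) absolutely_integrable_on {1..}"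
      using has_integral_powr_to_inf[of "-(3/2)" 1]
      by (intro nonnegative_absolutely_integrable_1) auto
    then have "integrable lebesgue (\<lambda>x. indicator {1..} x *\<^sub>R x powr (-(3/2)) :: real)"
      by (simp add: set_integrable_def)
    then show ?thesis
      by (subst (asm) integrable_completion) auto
  qed
  define T where "T = (\<lambda>x::real. indicator {1..} x * x powr (-(3/2)))"
  have T: "integrable lborel (\<lambda>x. T x)" "integrable lborel (\<lambda>x. T (- x))"
    using tail lborel_integrable_real_affine[of T "-1" 0] by (auto simp: T_def)
  have I: "integrable lborel (indicator {-1..1} :: real \<Rightarrow> real)"
    by (intro integrable_real_indicator) auto
  show ?thesis
  proof (rule Bochner_Integration.integrable_bound)
    show "integrable lborel (\<lambda>x. indicator {-1..1} x + T x + T (- x))"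
      using T I by (intro Bochner_Integration.integrable_add) auto
    show "J \<in> borel_measurable lborel" using meas by simp
    have Tn: "0 \<le> T x" for x by (simp add: T_def)
    have key: "J x \<le> y powr (-(3/2))" if "y = \<bar>x\<bar>" "y \<ge> 1" for x y
    proof -
      have "J x \<le> (y\<^sup>2) powr (-(3/4))"
        unfolding J_def using that by (intro powr_mono2') auto
      also have "y\<^sup>2 = y powr 2" using that by simp
      finally show ?thesis by (simp add: powr_powr)
    qed
    show "AE x in lborel. norm (J x) \<le> norm (indicator {-1..1} x + T x + T (- x))"
    proof (rule AE_I2)
      fix x :: real
      have J1: "J x \<le> 1"
      proof -
        have "(1 + x\<^sup>2) powr (-(3/4)) \<le> (1 + x\<^sup>2) powr 0" by (intro powr_mono) auto
        then show ?thesis using pos[of x] by (simp add: J_def)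
      qed
      consider "\<bar>x\<bar> \<le> 1" | "x \<ge> 1" | "- x \<ge> 1" by linarith
      then have "J x \<le> indicator {-1..1} x + T x + T (- x)"
      proof cases
        case 1
        then have "indicator {-1..1} x = (1::real)" by (auto simp: indicator_def)
        then show ?thesis using J1 Tn[of x] Tn[of "-x"] by simp
      next
        case 2
        then have "T x = x powr (-(3/2))" by (simp add: T_def)
        then show ?thesis using key[of x x] 2 Tn[of "-x"] by (auto simp: add_increasing add_increasing2)
      next
        case 3
        then have "T (- x) = (- x) powr (-(3/2))" by (simp add: T_def)
        then show ?thesis using key[of "-x" x] 3 Tn[of x] by (auto simp: add_increasing add_increasing2)
      qed
      then show "norm (J x) \<le> norm (indicator {-1..1} x + T x + T (- x))"
        by (simp add: J_def)
    qed
  qed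
qed

lemma J_pos: "0 < J x"
  using add_pos_nonneg[of 1 "x\<^sup>2"] by (simp add: J_def)

lemma J_half_sq: "((1 + x\<^sup>2) powr (-(3/8)))\<^sup>2 = J x"
  by (simp add: J_def power2_eq_square powr_add[symmetric])

text \<open>Cauchy-Schwarz against 1 / (1 + v^2), in the additive form a \<le> M / (2 w) + w a^2 /
  (2 M) with w = 1 + v^2. The parameter M is later the size of the transformed function, which makes
  the whole bound linear in that size. Since 1 / (1 + v^2) \<le> \<open>J v\<close>, a single
  constant integral occurs.\<close>

lemma transform_L1_bound:
  assumes P: "integrable lborel P" and P2: "integrable lborel (\<lambda>x. (P x)\<^sup>2)"
    and S: "(LBINT x. (P x)\<^sup>2) \<le> S"
    and diff: "\<And>h. 0 < h \<Longrightarrow> h \<le> 1 \<Longrightarrow> integrable lborel (\<lambda>x. (P (x + h) - P x)\<^sup>2)"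
    and D: "\<And>h. 0 < h \<Longrightarrow> h \<le> 1 \<Longrightarrow> (LBINT x. (P (x + h) - P x)\<^sup>2) \<le> D * h\<^sup>2"
    and M: "0 < M" and D0: "0 \<le> D"
  shows "(LBINT v. \<bar>cosT P v\<bar>) \<le> (M * (LBINT x. J x) + 2 * pi * (S + D) / M) / 2"
    and "integrable lborel (cosT P)"
proof -
  note [measurable] = cosT_measurable[OF P] sinT_measurable[OF P]
  let ?I = "LBINT x. J x"
  have S0: "0 \<le> S" using S by (rule order_trans[rotated]) simp
  have I0: "0 \<le> ?I" using J_pos by (intro integral_nonneg_AE) (auto intro: less_imp_le)
  have Jm[measurable]: "J \<in> borel_measurable borel" using J_integrable by auto
  have amgm: "\<bar>cosT P v\<bar> \<le> M / 2 * J v + 1 / (2 * M) * ((cosT P v)\<^sup>2 + (sinT P v)\<^sup>2)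
       + 1 / (2 * M) * (v\<^sup>2 * ((cosT P v)\<^sup>2 + (sinT P v)\<^sup>2))" for v
  proof -
    let ?a = "\<bar>cosT P v\<bar>" and ?w = "1 + v\<^sup>2"
    have w: "0 < ?w" by (intro add_pos_nonneg) auto
    have "0 \<le> (M / ?w - ?a)\<^sup>2 * (?w / (2 * M))" using w M by auto
    also have "\<dots> = M / 2 * (1 / ?w) - ?a + 1 / (2 * M) * (?w * ?a\<^sup>2)"
    proof -
      have "(M / w - a)\<^sup>2 * (w / (2 * M)) = M / 2 * (1 / w) - a + 1 / (2 * M) * (w * a\<^sup>2)"
        if "0 < w" for w a :: real
        using that M by (simp add: power2_eq_square field_simps)
      from this[OF w] show ?thesis .
    qed
    finally have "?a \<le> M / 2 * (1 / ?w) + 1 / (2 * M) * (?w * ?a\<^sup>2)" by simp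
    also have "\<dots> \<le> M / 2 * J v + 1 / (2 * M) * (?w * ((cosT P v)\<^sup>2 + (sinT P v)\<^sup>2))"
    proof (intro add_mono mult_left_mono)
      have "?w powr (-1) \<le> ?w powr (-(3/4))" by (intro powr_mono) auto
      then show "1 / ?w \<le> J v" using w by (simp add: J_def powr_neg_one)
    qed (use w M in auto)
    also have "1 / (2 * M) * (?w * ((cosT P v)\<^sup>2 + (sinT P v)\<^sup>2)) =
       1 / (2 * M) * ((cosT P v)\<^sup>2 + (sinT P v)\<^sup>2) + 1 / (2 * M) * (v\<^sup>2 * ((cosT P v)\<^sup>2 + (sinT P v)\<^sup>2))"
      by (simp only: distrib_right distrib_left mult_1_left)
    finally show ?thesis by (simp only: add.assoc)
  qed
  have e: "ennreal (p * x + u * y + u * z) = ennreal p * ennreal x + ennreal u * ennreal y + ennreal u * ennreal z"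
    if "0 \<le> p" "0 \<le> x" "0 \<le> u" "0 \<le> y" "0 \<le> z" for p x u y z :: real
    using that by (simp add: ennreal_mult)
  have "(\<integral>\<^sup>+v. ennreal \<bar>cosT P v\<bar> \<partial>lborel) \<le>
     (\<integral>\<^sup>+v. ennreal (M / 2) * ennreal (J v) + ennreal (1 / (2 * M)) * ennreal ((cosT P v)\<^sup>2 + (sinT P v)\<^sup>2)
       + ennreal (1 / (2 * M)) * ennreal (v\<^sup>2 * ((cosT P v)\<^sup>2 + (sinT P v)\<^sup>2)) \<partial>lborel)"
  proof (rule nn_integral_mono)
    fix v
    have "ennreal \<bar>cosT P v\<bar> \<le> ennreal (M / 2 * J v + 1 / (2 * M) * ((cosT P v)\<^sup>2 + (sinT P v)\<^sup>2)
       + 1 / (2 * M) * (v\<^sup>2 * ((cosT P v)\<^sup>2 + (sinT P v)\<^sup>2)))"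
      by (rule ennreal_leI[OF amgm])
    also have "\<dots> = ennreal (M / 2) * ennreal (J v) + ennreal (1 / (2 * M)) * ennreal ((cosT P v)\<^sup>2 + (sinT P v)\<^sup>2)
       + ennreal (1 / (2 * M)) * ennreal (v\<^sup>2 * ((cosT P v)\<^sup>2 + (sinT P v)\<^sup>2))"
      by (rule e) (use M J_pos[of v] in auto)
    finally show "ennreal \<bar>cosT P v\<bar> \<le> ennreal (M / 2) * ennreal (J v) + ennreal (1 / (2 * M)) * ennreal ((cosT P v)\<^sup>2 + (sinT P v)\<^sup>2)
       + ennreal (1 / (2 * M)) * ennreal (v\<^sup>2 * ((cosT P v)\<^sup>2 + (sinT P v)\<^sup>2))" .
  qed
  also have "\<dots> = ennreal (M / 2) * (\<integral>\<^sup>+v. ennreal (J v) \<partial>lborel)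
     + ennreal (1 / (2 * M)) * (\<integral>\<^sup>+v. ennreal ((cosT P v)\<^sup>2 + (sinT P v)\<^sup>2) \<partial>lborel)
     + ennreal (1 / (2 * M)) * (\<integral>\<^sup>+v. ennreal (v\<^sup>2 * ((cosT P v)\<^sup>2 + (sinT P v)\<^sup>2)) \<partial>lborel)"
    by (simp add: nn_integral_add nn_integral_cmult)
  also have "\<dots> \<le> ennreal (M / 2) * ennreal ?I + ennreal (1 / (2 * M)) * ennreal (2 * pi * S)
     + ennreal (1 / (2 * M)) * ennreal (2 * pi * D)"
  proof (intro add_mono mult_left_mono)
    show "(\<integral>\<^sup>+v. ennreal (J v) \<partial>lborel) \<le> ennreal ?I"
      using J_pos by (subst nn_integral_eq_integral[OF J_integrable]) (auto intro: less_imp_le)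
    show "(\<integral>\<^sup>+v. ennreal ((cosT P v)\<^sup>2 + (sinT P v)\<^sup>2) \<partial>lborel) \<le> ennreal (2 * pi * S)"
      by (rule order_trans[OF bessel[OF P P2]]) (use S in \<open>auto intro!: ennreal_leI\<close>)
    show "(\<integral>\<^sup>+v. ennreal (v\<^sup>2 * ((cosT P v)\<^sup>2 + (sinT P v)\<^sup>2)) \<partial>lborel) \<le> ennreal (2 * pi * D)"
      by (rule bessel_weighted[OF P diff D])
  qed auto
  also have "\<dots> = ennreal ((M * ?I + 2 * pi * (S + D) / M) / 2)"
  proof -
    have "ennreal (M / 2) * ennreal ?I + ennreal (1 / (2 * M)) * ennreal (2 * pi * S)
      + ennreal (1 / (2 * M)) * ennreal (2 * pi * D) =
      ennreal (M / 2 * ?I + 1 / (2 * M) * (2 * pi * S) + 1 / (2 * M) * (2 * pi * D))"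
      by (rule e[symmetric]) (use M I0 S0 D0 in auto)
    also have "M / 2 * ?I + 1 / (2 * M) * (2 * pi * S) + 1 / (2 * M) * (2 * pi * D) = (M * ?I + 2 * pi * (S + D) / M) / 2"
      using M by (simp add: field_simps)
    finally show ?thesis .
  qed
  finally have le: "(\<integral>\<^sup>+v. ennreal \<bar>cosT P v\<bar> \<partial>lborel) \<le> ennreal ((M * ?I + 2 * pi * (S + D) / M) / 2)" .
  then show int: "integrable lborel (cosT P)"
    by (intro integrableI_bounded) (auto simp: top.not_eq_extremum intro: le_less_trans)
  have "(\<integral>\<^sup>+v. ennreal \<bar>cosT P v\<bar> \<partial>lborel) = ennreal (LBINT v. \<bar>cosT P v\<bar>)"
    using int by (intro nn_integral_eq_integral) auto
  from le[unfolded this] show "(LBINT v. \<bar>cosT P v\<bar>) \<le> (M * ?I + 2 * pi * (S + D) / M) / 2"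
    using M I0 S0 D0 by (subst (asm) ennreal_le_iff) auto
qed

text \<open>|y| exp (- y^2 / 2) \<le> 1 at y = s z, and the remaining factor s of the derivative is
  at most 1. Uniformity in s is the point: damping must not spoil the Lipschitz bound of the
  transform.\<close>

lemma gam_lipschitz:
  assumes "0 < s" "s \<le> 1" "0 \<le> h"
  shows "\<bar>gam s (x + h) - gam s x\<bar> \<le> h"
proof -
  have "norm (gam s (x + h) - gam s x) \<le> 1 * norm ((x + h) - x)"
  proof (rule field_differentiable_bound[of UNIV])
    fix z show "(gam s has_field_derivative (- (s\<^sup>2 * z) * gam s z)) (at z within UNIV)"
      using gam_deriv[of s z] by simp
    have "\<bar>s * z\<bar> \<le> 1 + (s * z)\<^sup>2 / 2"
      using sum_squares_ge_zero[of "\<bar>s * z\<bar> - 1" 0] by (simp add: power2_eq_square algebra_simps)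
    also have "\<dots> \<le> exp ((s * z)\<^sup>2 / 2)" by (rule exp_ge_add_one_self)
    finally have "\<bar>s * z\<bar> * gam s z \<le> exp ((s * z)\<^sup>2 / 2) * gam s z"
      by (rule mult_right_mono) (simp add: gam_def)
    also have "\<dots> = 1" by (simp add: gam_def exp_add[symmetric] power_mult_distrib)
    finally have "s * (\<bar>s * z\<bar> * gam s z) \<le> 1 * 1"
      using assms by (intro mult_mono) (auto simp: gam_def)
    then show "norm (- (s\<^sup>2 * z) * gam s z) \<le> 1"
      using assms by (simp add: abs_mult gam_def power2_eq_square mult_ac)
  qed auto
  then show ?thesis using assms by simp
qed

text \<open>When the sine transform of r vanishes, \<open>cosT P\<close> is 2\<pi> times r smoothed
  by a normal density, so this controls the smoothed function uniformly in s. Increments of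
  \<open>P\<close> are bounded by 2 M h, one half from \<open>cosT r\<close> and one from the
  damping. Hence the squares contribute M^2 and 4 M^2, and 2\<pi> times 5 gives the 10\<pi>.\<close>

lemma mollified_L1_bound:
  assumes r: "integrable lborel r" and M: "0 < M"
    and R: "\<And>x. \<bar>cosT r x\<bar> \<le> M * (1 + x\<^sup>2) powr (-(3/8))"
    and L: "\<And>x h. 0 < h \<Longrightarrow> h \<le> 1 \<Longrightarrow> \<bar>cosT r (x + h) - cosT r x\<bar> \<le> M * h * (1 + x\<^sup>2) powr (-(3/8))"
    and s: "0 < s" "s \<le> 1"
  defines "P \<equiv> \<lambda>v. cosT r v * gam s v"
  shows "(LBINT v. \<bar>cosT P v\<bar>) \<le> M * (LBINT x. J x) * (1 + 10 * pi) / 2" and "integrable lborel (cosT P)"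
proof -
  let ?I = "LBINT x. J x"
  have Pi: "integrable lborel P" unfolding P_def by (rule integrable_cosT_gam[OF r s(1)])
  have [measurable]: "P \<in> borel_measurable borel" using Pi by auto
  have g1: "0 \<le> gam s x" "gam s x \<le> 1" for x by (auto simp: gam_def)
  have sq: "(p::real)\<^sup>2 \<le> c\<^sup>2 * J x" if "\<bar>p\<bar> \<le> c * (1 + x\<^sup>2) powr (-(3/8))" for p c x
    using power_mono[OF that, of 2] by (simp add: power_mult_distrib J_half_sq)
  have Pb: "(P x)\<^sup>2 \<le> M\<^sup>2 * J x" for x
  proof (rule sq)
    have "\<bar>P x\<bar> \<le> \<bar>cosT r x\<bar>" using g1[of x] by (simp add: P_def abs_mult mult_left_le)
    also have "\<dots> \<le> M * (1 + x\<^sup>2) powr (-(3/8))" by (rule R)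
    finally show "\<bar>P x\<bar> \<le> M * (1 + x\<^sup>2) powr (-(3/8))" .
  qed
  have Db: "(P (x + h) - P x)\<^sup>2 \<le> (2 * M * h)\<^sup>2 * J x" if h: "0 < h" "h \<le> 1" for x h
  proof (rule sq)
    have "P (x + h) - P x = (cosT r (x + h) - cosT r x) * gam s (x + h) + cosT r x * (gam s (x + h) - gam s x)"
      by (simp add: P_def algebra_simps)
    then have "\<bar>P (x + h) - P x\<bar> \<le> \<bar>cosT r (x + h) - cosT r x\<bar> * gam s (x + h) + \<bar>cosT r x\<bar> * \<bar>gam s (x + h) - gam s x\<bar>"
      using abs_triangle_ineq[of "(cosT r (x + h) - cosT r x) * gam s (x + h)" "cosT r x * (gam s (x + h) - gam s x)"] g1
      by (simp add: abs_mult)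
    also have "\<dots> \<le> (M * h * (1 + x\<^sup>2) powr (-(3/8))) * 1 + (M * (1 + x\<^sup>2) powr (-(3/8))) * h"
      using h s M g1 by (intro add_mono mult_mono L R gam_lipschitz) auto
    finally show "\<bar>P (x + h) - P x\<bar> \<le> 2 * M * h * (1 + x\<^sup>2) powr (-(3/8))" by (simp add: mult_ac)
  qed
  have bnd: "integrable lborel (\<lambda>x. (f x)\<^sup>2)" "(LBINT x. (f x)\<^sup>2) \<le> c * ?I"
    if "f \<in> borel_measurable borel" "\<And>x. (f x)\<^sup>2 \<le> c * J x" for f c
  proof -
    show "integrable lborel (\<lambda>x. (f x)\<^sup>2)"
      by (rule Bochner_Integration.integrable_bound[of _ "\<lambda>x. c * J x"])
        (use J_integrable that in \<open>auto intro: order_trans[OF _ abs_ge_self]\<close>)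
    then have "(LBINT x. (f x)\<^sup>2) \<le> (LBINT x. c * J x)"
      using J_integrable that by (intro integral_mono) auto
    then show "(LBINT x. (f x)\<^sup>2) \<le> c * ?I" by simp
  qed
  have I0: "0 \<le> ?I" using J_pos by (intro integral_nonneg_AE) (auto intro: less_imp_le)
  have D': "(LBINT x. (P (x + h) - P x)\<^sup>2) \<le> (4 * M\<^sup>2 * ?I) * h\<^sup>2" if "0 < h" "h \<le> 1" for h
    using bnd(2)[OF _ Db[OF that]] by (simp add: power_mult_distrib mult_ac)
  have D0: "0 \<le> 4 * M\<^sup>2 * ?I" using I0 by simp
  note * = transform_L1_bound[OF Pi bnd[OF _ Pb] bnd(1)[OF _ Db] D' M D0]
  show "integrable lborel (cosT P)" by (rule *(2)) auto
  have "(LBINT v. \<bar>cosT P v\<bar>) \<le> (M * ?I + 2 * pi * (M\<^sup>2 * ?I + 4 * M\<^sup>2 * ?I) / M) / 2"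
    by (rule *(1)) auto
  also have "\<dots> = M * ?I * (1 + 10 * pi) / 2"
    using M by (simp add: power2_eq_square field_simps)
  finally show "(LBINT v. \<bar>cosT P v\<bar>) \<le> M * ?I * (1 + 10 * pi) / 2" .
qed

lemma integrable_conv_normal:
  assumes r: "integrable lborel r" and s: "0 < s"
  shows "integrable (lborel \<Otimes>\<^sub>M lborel) (\<lambda>(y, v). r y * normal_density 0 s (v - y))"
proof (rule lborel_pair.Fubini_integrable)
  have [measurable]: "r \<in> borel_measurable borel" using r by auto
  have N: "integrable lborel (\<lambda>v. normal_density 0 s (v - y))" "(LBINT v. normal_density 0 s (v - y)) = 1" for y
    using integral_normal_density[OF s, of 0] integrable_normal_density[OF s, of 0]
      lborel_integrable_real_affine[of "normal_density 0 s" 1 "-y"]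
      lborel_integral_real_affine[of 1 "normal_density 0 s" "-y"]
    by auto
  show "(\<lambda>(y, v). r y * normal_density 0 s (v - y)) \<in> borel_measurable (lborel \<Otimes>\<^sub>M lborel)"
    by measurable
  show "integrable lborel (\<lambda>y. LBINT v. norm (case (y, v) of (y, v) \<Rightarrow> r y * normal_density 0 s (v - y)))"
    using r N by (simp add: abs_mult)
  show "AE y in lborel. integrable lborel (\<lambda>v. case (y, v) of (y, v) \<Rightarrow> r y * normal_density 0 s (v - y))"
    using N by simp
qed

text \<open>Duality: the test function is smoothed rather than r. By the symmetry of the normal
  density the smoothing moves over to r, where \<open>K\<close> applies, and it disappears in the
  limit by dominated convergence.\<close>

lemma test_function_bound:
  assumes r: "integrable lborel r" and S: "\<And>x. sinT r x = 0"
    and K: "\<And>s. 0 < s \<Longrightarrow> s \<le> 1 \<Longrightarrow> (LBINT v. \<bar>cosT (\<lambda>v. cosT r v * gam s v) v\<bar>) \<le> K"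
    and Ki: "\<And>s. 0 < s \<Longrightarrow> s \<le> 1 \<Longrightarrow> integrable lborel (cosT (\<lambda>v. cosT r v * gam s v))"
    and g: "continuous_on UNIV g" and g1: "\<And>x. \<bar>g x\<bar> \<le> 1"
  shows "(LBINT y. r y * g y) \<le> K / (2 * pi)"
proof -
  have [measurable]: "r \<in> borel_measurable borel" using r by auto
  have [measurable]: "g \<in> borel_measurable borel" using g by (rule borel_measurable_continuous_onI)
  let ?s = "\<lambda>n. 1 / real (Suc n)"
  \<comment> \<open>The average of g at distance of order 1/(n + 1) around y, written against a
    fixed density so that dominated convergence applies in z as well.\<close>
  define G where "G = (\<lambda>n y. LBINT z. std_normal_density z * g (y + ?s n * z))"
  have Gi: "integrable lborel (\<lambda>z. std_normal_density z * g (y + s * z))" for y s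
    using integrable_bounded_mult[of std_normal_density "\<lambda>z. g (y + s * z)"] g1
      integrable_normal_density[of 1 0] by (simp add: mult.commute)
  have bound: "(LBINT y. r y * G n y) \<le> K / (2 * pi)" for n
  proof -
    define s where "s = ?s n"
    have s: "0 < s" "s \<le> 1" by (auto simp: s_def)
    define k where "k = cosT (\<lambda>v. cosT r v * gam s v)"
    have k: "k v = (LBINT y. r y * (2 * pi * normal_density 0 s (v - y)))" for v
    proof -
      have "sinT (\<lambda>v. 0) v = 0" by (simp add: sinT_def)
      then show ?thesis using gaussian_kernel[OF r s(1), of v] by (simp add: k_def S)
    qed
    have G: "G n y = (LBINT v. normal_density 0 s (v - y) * g v)" for y
    proof -
      have "(LBINT v. normal_density 0 s (v - y) * g v) = s * (LBINT z. normal_density 0 s (s * z) * g (y + s * z))"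
        using lborel_integral_real_affine[of s "\<lambda>v. normal_density 0 s (v - y) * g v" y] s by simp
      also have "\<dots> = (LBINT z. s * normal_density 0 s (s * z) * g (y + s * z))" by (simp add: mult.assoc)
      also have "\<dots> = G n y"
        unfolding G_def s_def[symmetric] using s
        by (intro Bochner_Integration.integral_cong refl)
          (simp add: normal_density_def real_sqrt_mult power_mult_distrib)
      finally show ?thesis ..
    qed
    have fub: "integrable (lborel \<Otimes>\<^sub>M lborel) (\<lambda>(y, v). g v * (r y * normal_density 0 s (v - y)))"
    proof (rule Bochner_Integration.integrable_bound[OF integrable_conv_normal[OF r s(1)]])
      show "AE z in lborel \<Otimes>\<^sub>M lborel. norm (case z of (y, v) \<Rightarrow> g v * (r y * normal_density 0 s (v - y)))
         \<le> norm (case z of (y, v) \<Rightarrow> r y * normal_density 0 s (v - y))"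
        using g1 by (auto simp: abs_mult mult_left_le_one_le)
    qed measurable
    have "(LBINT y. r y * G n y) = (LBINT y. LBINT v. g v * (r y * normal_density 0 s (v - y)))"
    proof (rule Bochner_Integration.integral_cong[OF refl])
      fix y
      have "r y * G n y = (LBINT v. r y * (normal_density 0 s (v - y) * g v))" by (simp add: G)
      then show "r y * G n y = (LBINT v. g v * (r y * normal_density 0 s (v - y)))" by (simp only: mult_ac)
    qed
    also have "\<dots> = (LBINT v. LBINT y. g v * (r y * normal_density 0 s (v - y)))"
      using lborel_pair.Fubini_integral[OF fub] by simp
    also have "\<dots> = (LBINT v. g v * (k v / (2 * pi)))"
    proof (rule Bochner_Integration.integral_cong[OF refl])
      fix v
      have "k v = (LBINT y. (2 * pi) * (r y * normal_density 0 s (v - y)))"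
        unfolding k by (simp only: mult_ac)
      then have "k v / (2 * pi) = (LBINT y. r y * normal_density 0 s (v - y))" by simp
      then show "(LBINT y. g v * (r y * normal_density 0 s (v - y))) = g v * (k v / (2 * pi))" by simp
    qed
    also have "\<dots> = (LBINT v. g v * k v) / (2 * pi)" by simp
    also have "(LBINT v. g v * k v) \<le> (LBINT v. \<bar>k v\<bar>)"
      using integral_bounded_mult_le[OF Ki[OF s], of g] g1 by (simp add: k_def)
    also have "\<dots> \<le> K" unfolding k_def by (rule K[OF s])
    finally show ?thesis by (simp add: divide_right_mono)
  qed
  have G1: "\<bar>G n y\<bar> \<le> 1" for n y
  proof -
    have "\<bar>G n y\<bar> \<le> (LBINT z. \<bar>std_normal_density z\<bar>)"
      using integral_bounded_mult_le[of std_normal_density "\<lambda>z. g (y + ?s n * z)"] g1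
        integrable_normal_density[of 1 0] unfolding G_def by (simp add: mult.commute)
    then show ?thesis using integral_normal_density[of 1 0] by simp
  qed
  have Gm[measurable]: "G n \<in> borel_measurable borel" for n
    unfolding G_def by measurable
  have "(\<lambda>n. LBINT y. r y * G n y) \<longlonglongrightarrow> (LBINT y. r y * g y)"
  proof (rule integral_dominated_convergence[where w="\<lambda>y. \<bar>r y\<bar>"])
    show "AE y in lborel. (\<lambda>n. r y * G n y) \<longlonglongrightarrow> r y * g y"
    proof (intro AE_I2 tendsto_mult_left)
      fix y
      have "(\<lambda>n. G n y) \<longlonglongrightarrow> (LBINT z. std_normal_density z * g y)"
        unfolding G_def
      proof (rule integral_dominated_convergence[where w=std_normal_density])
        show "AE z in lborel. (\<lambda>n. std_normal_density z * g (y + ?s n * z)) \<longlonglongrightarrow> std_normal_density z * g y"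
        proof (intro AE_I2 tendsto_mult_left)
          fix z
          have "(\<lambda>n. y + ?s n * z) \<longlonglongrightarrow> y + 0 * z" by (intro tendsto_intros inverse_Suc_tendsto)
          then show "(\<lambda>n. g (y + ?s n * z)) \<longlonglongrightarrow> g y"
            using g by (intro isCont_tendsto_compose[of y g]) (auto simp: continuous_on_eq_continuous_at)
        qed
        show "integrable lborel std_normal_density" by (rule integrable_normal_density) simp
      qed (use g1 in \<open>auto simp: abs_mult mult_left_le\<close>)
      then show "(\<lambda>n. G n y) \<longlonglongrightarrow> g y" using integral_normal_density[of 1 0] by simp
    qed
  qed (use r G1 in \<open>auto simp: abs_mult mult_left_le\<close>)
  then show ?thesis by (rule LIMSEQ_le_const2) (use bound in auto)
qed

text \<open>The best test function would be the sign of r; being measurable, it is an almost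
  everywhere limit of continuous functions, to which \<open>test_function_bound\<close> applies.
  Dividing the bound of the smoothed function by 2\<pi> gives the 4\<pi> in the constant.\<close>

theorem L1_bound_of_transform:
  assumes r: "integrable lborel r" and S: "\<And>x. sinT r x = 0" and M: "0 < M"
    and R: "\<And>x. \<bar>cosT r x\<bar> \<le> M * (1 + x\<^sup>2) powr (-(3/8))"
    and L: "\<And>x h. 0 < h \<Longrightarrow> h \<le> 1 \<Longrightarrow> \<bar>cosT r (x + h) - cosT r x\<bar> \<le> M * h * (1 + x\<^sup>2) powr (-(3/8))"
  shows "(LBINT v. \<bar>r v\<bar>) \<le> M * ((LBINT x. J x) * (1 + 10 * pi) / (4 * pi))"
proof -
  have [measurable]: "r \<in> borel_measurable borel" using r by auto
  have "(\<lambda>x. sgn (r x)) \<in> borel_measurable lebesgue"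
    by (intro measurable_completion) simp
  then have "(\<lambda>x. sgn (r x)) measurable_on UNIV"
    by (rule lebesgue_measurable_imp_measurable_on_real) simp
  then obtain N g where N: "negligible N" and g: "\<And>n. continuous_on UNIV (g n)"
    and lim: "\<And>x. x \<notin> N \<Longrightarrow> (\<lambda>n. g n x) \<longlonglongrightarrow> sgn (r x)"
    unfolding measurable_on_def by auto
  \<comment> \<open>Truncation to [-1, 1] leaves the limit unchanged, since the sign already lies
    there, and makes the approximants admissible test functions.\<close>
  define g' where "g' = (\<lambda>n x. max (-1) (min 1 (g n x)))"
  have g': "continuous_on UNIV (g' n)" for n unfolding g'_def by (intro continuous_intros g)
  have g'1: "\<bar>g' n x\<bar> \<le> 1" for n x by (auto simp: g'_def)
  have [measurable]: "g' n \<in> borel_measurable borel" for n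
    using g' by (rule borel_measurable_continuous_onI)
  have "AE x in lebesgue. x \<notin> N"
    using N by (simp add: negligible_iff_null_sets AE_not_in)
  moreover have "(\<lambda>n. r x * g' n x) \<longlonglongrightarrow> \<bar>r x\<bar>" if "x \<notin> N" for x
  proof -
    have "(\<lambda>n. g' n x) \<longlonglongrightarrow> max (-1) (min 1 (sgn (r x)))"
      unfolding g'_def by (intro tendsto_intros lim that)
    also have "max (-1) (min 1 (sgn (r x))) = sgn (r x)" by (auto simp: sgn_if)
    finally have "(\<lambda>n. r x * g' n x) \<longlonglongrightarrow> r x * sgn (r x)" by (rule tendsto_mult_left)
    then show ?thesis by (simp only: abs_sgn)
  qed
  ultimately have "AE x in lebesgue. (\<lambda>n. r x * g' n x) \<longlonglongrightarrow> \<bar>r x\<bar>" by auto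
  then have AE: "AE x in lborel. (\<lambda>n. r x * g' n x) \<longlonglongrightarrow> \<bar>r x\<bar>"
    by (simp add: AE_completion_iff)
  have "(\<lambda>n. LBINT x. r x * g' n x) \<longlonglongrightarrow> (LBINT x. \<bar>r x\<bar>)"
    by (rule integral_dominated_convergence[where w="\<lambda>x. \<bar>r x\<bar>"])
      (use r g'1 AE in \<open>auto simp: abs_mult mult_left_le\<close>)
  moreover have "\<exists>N. \<forall>n\<ge>N. (LBINT x. r x * g' n x) \<le> (M * (LBINT x. J x) * (1 + 10 * pi) / 2) / (2 * pi)"
    by (intro exI allI impI, rule test_function_bound[OF r S _ _ g' g'1]) (rule mollified_L1_bound[OF r M R L]; assumption)+
  ultimately have "(LBINT v. \<bar>r v\<bar>) \<le> (M * (LBINT x. J x) * (1 + 10 * pi) / 2) / (2 * pi)"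
    by (rule LIMSEQ_le_const2)
  then show ?thesis by simp
qed

section \<open>The gain term\<close>

text \<open>The rotation splits into two affine substitutions on the line: for fixed v, w is
  replaced by the first new coordinate; after exchanging the integrals, v is replaced by the second
  one. The Jacobians 1/|s| and |s| cancel. Angles with vanishing sine form a null set.\<close>

lemma nn_integral_rotation:
  fixes F :: "real \<times> real \<Rightarrow> ennreal"
  assumes [measurable]: "F \<in> borel_measurable (borel \<Otimes>\<^sub>M borel)"
    and s: "s \<noteq> 0" and cs: "c\<^sup>2 + s\<^sup>2 = 1"
  shows "(\<integral>\<^sup>+v. \<integral>\<^sup>+w. F (v * c - w * s, v * s + w * c) \<partial>lborel \<partial>lborel) = (\<integral>\<^sup>+x. \<integral>\<^sup>+y. F (x, y) \<partial>lborel \<partial>lborel)"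
proof -
  have inner: "(\<integral>\<^sup>+w. F (v * c - w * s, v * s + w * c) \<partial>lborel) =
     (\<integral>\<^sup>+x. ennreal (1 / \<bar>s\<bar>) * F (x, (v - c * x) / s) \<partial>lborel)" for v
  proof -
    have "(\<integral>\<^sup>+w. F (v * c - w * s, v * s + w * c) \<partial>lborel) =
      ennreal \<bar>- (1 / s)\<bar> * (\<integral>\<^sup>+x. F (v * c - (v * c / s + - (1 / s) * x) * s, v * s + (v * c / s + - (1 / s) * x) * c) \<partial>lborel)"
      by (rule nn_integral_real_affine) (use s in auto)
    also have "\<dots> = ennreal (1 / \<bar>s\<bar>) * (\<integral>\<^sup>+x. F (x, (v - c * x) / s) \<partial>lborel)"
    proof -
      have "v * c - (v * c / s + - (1 / s) * x) * s = x" for x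
        using s by (simp add: field_simps)
      moreover have "v * s + (v * c / s + - (1 / s) * x) * c = (v - c * x) / s" for x
      proof -
        have "v * s + (v * c / s + - (1 / s) * x) * c = (v * (c\<^sup>2 + s\<^sup>2) - c * x) / s"
          using s by (simp add: field_simps power2_eq_square)
        then show ?thesis using cs by simp
      qed
      ultimately show ?thesis by simp
    qed
    finally show ?thesis by (simp add: nn_integral_cmult)
  qed
  have "(\<integral>\<^sup>+v. \<integral>\<^sup>+w. F (v * c - w * s, v * s + w * c) \<partial>lborel \<partial>lborel) =
    (\<integral>\<^sup>+x. \<integral>\<^sup>+v. ennreal (1 / \<bar>s\<bar>) * F (x, (v - c * x) / s) \<partial>lborel \<partial>lborel)"
    unfolding inner by (rule lborel_pair.Fubini') measurable
  also have "\<dots> = (\<integral>\<^sup>+x. \<integral>\<^sup>+y. F (x, y) \<partial>lborel \<partial>lborel)"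
  proof (rule nn_integral_cong)
    fix x :: real
    have "(\<integral>\<^sup>+v. ennreal (1 / \<bar>s\<bar>) * F (x, (v - c * x) / s) \<partial>lborel) =
      ennreal \<bar>s\<bar> * (\<integral>\<^sup>+y. ennreal (1 / \<bar>s\<bar>) * F (x, (c * x + s * y - c * x) / s) \<partial>lborel)"
      by (rule nn_integral_real_affine) (use s in auto)
    also have "\<dots> = ennreal \<bar>s\<bar> * (ennreal (1 / \<bar>s\<bar>) * (\<integral>\<^sup>+y. F (x, y) \<partial>lborel))"
      using s by (simp add: nn_integral_cmult)
    also have "\<dots> = (\<integral>\<^sup>+y. F (x, y) \<partial>lborel)"
      using s by (simp add: mult.assoc[symmetric] ennreal_mult[symmetric])
    finally show "(\<integral>\<^sup>+v. ennreal (1 / \<bar>s\<bar>) * F (x, (v - c * x) / s) \<partial>lborel) = (\<integral>\<^sup>+y. F (x, y) \<partial>lborel)" .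
  qed
  finally show ?thesis .
qed

lemma distr_rotation:
  fixes c s :: real
  assumes s: "s \<noteq> 0" and cs: "c\<^sup>2 + s\<^sup>2 = 1"
  shows "distr (lborel \<Otimes>\<^sub>M lborel) (lborel \<Otimes>\<^sub>M lborel) (\<lambda>(v, w). (v * c - w * s, v * s + w * c)) = lborel \<Otimes>\<^sub>M lborel"
    (is "distr ?L ?L ?r = _")
proof (rule measure_eqI)
  fix A assume "A \<in> sets (distr ?L ?L ?r)"
  then have A[measurable]: "A \<in> sets ?L" by simp
  have Ab: "A \<in> sets (borel \<Otimes>\<^sub>M borel)" using A by (simp cong: sets_pair_measure_cong)
  have r: "?r \<in> measurable ?L ?L" by measurable
  have "emeasure (distr ?L ?L ?r) A = (\<integral>\<^sup>+z. indicator A z \<partial>distr ?L ?L ?r)"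
    by (subst nn_integral_indicator) (use A in auto)
  also have "\<dots> = (\<integral>\<^sup>+z. indicator A (?r z) \<partial>?L)" by (rule nn_integral_distr[OF r]) simp
  also have "\<dots> = (\<integral>\<^sup>+v. \<integral>\<^sup>+w. indicator A (?r (v, w)) \<partial>lborel \<partial>lborel)"
    by (rule lborel.nn_integral_fst[symmetric]) (use r in measurable)
  also have "\<dots> = (\<integral>\<^sup>+x. \<integral>\<^sup>+y. indicator A (x, y) \<partial>lborel \<partial>lborel)"
    using nn_integral_rotation[of "indicator A" s c] s cs Ab by simp
  also have "\<dots> = (\<integral>\<^sup>+z. indicator A z \<partial>?L)"
    by (rule lborel.nn_integral_fst) simp
  also have "\<dots> = emeasure ?L A" by (rule nn_integral_indicator) (rule A)
  finally show "emeasure (distr ?L ?L ?r) A = emeasure ?L A" .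
qed simp

lemma integral_rotation:
  fixes F :: "real \<times> real \<Rightarrow> real"
  assumes F: "integrable (lborel \<Otimes>\<^sub>M lborel) F" and s: "s \<noteq> 0" and cs: "c\<^sup>2 + s\<^sup>2 = 1"
  shows "integrable (lborel \<Otimes>\<^sub>M lborel) (\<lambda>(v, w). F (v * c - w * s, v * s + w * c))"
    and "(LBINT v. LBINT w. F (v * c - w * s, v * s + w * c)) = (LBINT x. LBINT y. F (x, y))"
proof -
  let ?L = "lborel \<Otimes>\<^sub>M lborel :: (real \<times> real) measure"
  let ?r = "\<lambda>(v, w). (v * c - w * s, v * s + w * c)"
  have r: "?r \<in> measurable ?L ?L" by measurable
  have "integrable (distr ?L ?L ?r) F" using F by (simp only: distr_rotation[OF s cs])
  then have i: "integrable ?L (\<lambda>z. F (?r z))" by (rule integrable_distr[OF r])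
  then show i': "integrable ?L (\<lambda>(v, w). F (v * c - w * s, v * s + w * c))"
    by (simp add: case_prod_beta')
  have "integral\<^sup>L ?L F = integral\<^sup>L (distr ?L ?L ?r) F" by (simp only: distr_rotation[OF s cs])
  also have "\<dots> = (\<integral>z. F (?r z) \<partial>?L)"
    by (rule integral_distr[OF r]) (use F in auto)
  also have "\<dots> = (LBINT v. LBINT w. F (v * c - w * s, v * s + w * c))"
    using lborel_pair.integral_fst[OF i'] by (simp add: case_prod_beta')
  finally show "(LBINT v. LBINT w. F (v * c - w * s, v * s + w * c)) = (LBINT x. LBINT y. F (x, y))"
    using lborel_pair.integral_fst[of "\<lambda>x y. F (x, y)"] F by simp
qed

text \<open>Bilinear rather than quadratic, because Wild's recursion combines two different
  densities. The circle average is normalised, so a pair of probability densities yields a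
  probability density.\<close>

definition gain :: "(real \<Rightarrow> real) \<Rightarrow> (real \<Rightarrow> real) \<Rightarrow> real \<Rightarrow> real" where
  "gain f g v = (LBINT \<theta>. indicator {0..2*pi} \<theta> *
     (LBINT w. f (v * cos \<theta> - w * sin \<theta>) * g (v * sin \<theta> + w * cos \<theta>))) / (2 * pi)"

lemma AE_sin_nonzero: "AE \<theta> in lborel. sin (\<theta>::real) \<noteq> 0"
proof -
  have "{\<theta>::real. sin \<theta> = 0} \<subseteq> range (\<lambda>i::int. of_int i * pi)"
    by (auto simp: sin_zero_iff_int2)
  then have "countable {\<theta>::real. sin \<theta> = 0}"
    by (rule countable_subset) auto
  then have "{\<theta>::real. sin \<theta> = 0} \<in> null_sets lborel"
    by (rule countable_imp_null_set_lborel)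
  then show ?thesis by (rule AE_I') auto
qed

lemma integrable_pair_mult:
  fixes f g :: "real \<Rightarrow> real"
  assumes f: "integrable lborel f" and g: "integrable lborel g"
  shows "integrable (lborel \<Otimes>\<^sub>M lborel) (\<lambda>(x, y). f x * g y)"
  using integrable_prod_mult[OF f g, of "\<lambda>_. 1"] by simp

text \<open>With the angle as outermost variable, rotation invariance makes the inner double
  integral equal to the product of the two L1 norms for almost every angle. This absolute
  integrability licenses every later exchange of integrals.\<close>

lemma collision_integrable:
  fixes f g \<psi> :: "real \<Rightarrow> real"
  assumes f: "integrable lborel f" and g: "integrable lborel g"
    and \<psi>[measurable]: "\<psi> \<in> borel_measurable borel" and \<psi>1: "\<And>v. \<bar>\<psi> v\<bar> \<le> 1"
  shows "integrable ((lborel \<Otimes>\<^sub>M lborel) \<Otimes>\<^sub>M lborel)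
    (\<lambda>(p, w). \<psi> (fst p) * indicator {0..2*pi} (snd p) *
      (f (fst p * cos (snd p) - w * sin (snd p)) * g (fst p * sin (snd p) + w * cos (snd p))))"
    (is "integrable ?M (\<lambda>(p, w). ?H p w)")
proof (rule integrableI_bounded)
  have [measurable]: "f \<in> borel_measurable borel" "g \<in> borel_measurable borel" using f g by auto
  show m: "(\<lambda>(p, w). ?H p w) \<in> borel_measurable ?M" by measurable
  let ?fg = "\<lambda>(x, y). \<bar>f x * g y\<bar>"
  have fin: "(\<integral>\<^sup>+x. \<integral>\<^sup>+y. ennreal \<bar>f x * g y\<bar> \<partial>lborel \<partial>lborel) < \<infinity>"
  proof -
    have "(\<integral>\<^sup>+z. ennreal (norm (case z of (x, y) \<Rightarrow> f x * g y)) \<partial>(lborel \<Otimes>\<^sub>M lborel)) < \<infinity>"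
      using integrable_pair_mult[OF f g] by (simp add: integrable_iff_bounded)
    also have "(\<integral>\<^sup>+z. ennreal (norm (case z of (x, y) \<Rightarrow> f x * g y)) \<partial>(lborel \<Otimes>\<^sub>M lborel)) =
       (\<integral>\<^sup>+x. \<integral>\<^sup>+y. ennreal (norm (f x * g y)) \<partial>lborel \<partial>lborel)"
      by (subst lborel.nn_integral_fst[symmetric]) auto
    finally show ?thesis by simp
  qed
  have "(\<integral>\<^sup>+z. ennreal (norm (case z of (p, w) \<Rightarrow> ?H p w)) \<partial>?M) \<le>
     (\<integral>\<^sup>+z. (case z of ((v, \<theta>), w) \<Rightarrow> indicator {0..2*pi} \<theta> * ennreal \<bar>f (v * cos \<theta> - w * sin \<theta>) * g (v * sin \<theta> + w * cos \<theta>)\<bar>) \<partial>?M)"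
  proof (rule nn_integral_mono)
    fix z :: "(real \<times> real) \<times> real"
    obtain v \<theta> w where z: "z = ((v, \<theta>), w)" by (metis prod.collapse)
    let ?k = "f (v * cos \<theta> - w * sin \<theta>) * g (v * sin \<theta> + w * cos \<theta>)"
    have "ennreal \<bar>\<psi> v * ?k\<bar> \<le> ennreal \<bar>?k\<bar>"
      using \<psi>1[of v] by (intro ennreal_leI) (simp add: abs_mult mult_left_le_one_le)
    then show "ennreal (norm (case z of (p, w) \<Rightarrow> ?H p w)) \<le> (case z of ((v, \<theta>), w) \<Rightarrow>
       indicator {0..2*pi} \<theta> * ennreal \<bar>f (v * cos \<theta> - w * sin \<theta>) * g (v * sin \<theta> + w * cos \<theta>)\<bar>)"
      unfolding z by (simp split: split_indicator)
  qed
  also have "\<dots> = (\<integral>\<^sup>+p. \<integral>\<^sup>+w. (case p of (v, \<theta>) \<Rightarrow> indicator {0..2*pi} \<theta> * ennreal \<bar>f (v * cos \<theta> - w * sin \<theta>) * g (v * sin \<theta> + w * cos \<theta>)\<bar>)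
      \<partial>lborel \<partial>(lborel \<Otimes>\<^sub>M lborel))"
    by (subst lborel.nn_integral_fst[symmetric]) (auto simp: split_beta)
  also have "\<dots> = (\<integral>\<^sup>+v. \<integral>\<^sup>+\<theta>. \<integral>\<^sup>+w. indicator {0..2*pi} \<theta> * ennreal \<bar>f (v * cos \<theta> - w * sin \<theta>) * g (v * sin \<theta> + w * cos \<theta>)\<bar>
      \<partial>lborel \<partial>lborel \<partial>lborel)"
    by (subst lborel.nn_integral_fst[symmetric]) (auto simp: split_beta)
  also have "\<dots> = (\<integral>\<^sup>+\<theta>. \<integral>\<^sup>+v. \<integral>\<^sup>+w. indicator {0..2*pi} \<theta> * ennreal \<bar>f (v * cos \<theta> - w * sin \<theta>) * g (v * sin \<theta> + w * cos \<theta>)\<bar>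
      \<partial>lborel \<partial>lborel \<partial>lborel)"
    by (rule lborel_pair.Fubini') measurable
  also have "\<dots> = (\<integral>\<^sup>+\<theta>. indicator {0..2*pi} \<theta> * (\<integral>\<^sup>+v. \<integral>\<^sup>+w. ennreal \<bar>f (v * cos \<theta> - w * sin \<theta>) * g (v * sin \<theta> + w * cos \<theta>)\<bar>
      \<partial>lborel \<partial>lborel) \<partial>lborel)"
    by (simp add: nn_integral_cmult)
  also have "\<dots> = (\<integral>\<^sup>+\<theta>. indicator {0..2*pi} \<theta> * (\<integral>\<^sup>+x. \<integral>\<^sup>+y. ennreal \<bar>f x * g y\<bar> \<partial>lborel \<partial>lborel) \<partial>lborel)"
  proof (rule nn_integral_cong_AE, use AE_sin_nonzero in eventually_elim)
    case (elim \<theta>)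
    have "(\<integral>\<^sup>+v. \<integral>\<^sup>+w. ennreal \<bar>f (v * cos \<theta> - w * sin \<theta>) * g (v * sin \<theta> + w * cos \<theta>)\<bar> \<partial>lborel \<partial>lborel) =
       (\<integral>\<^sup>+x. \<integral>\<^sup>+y. ennreal \<bar>f x * g y\<bar> \<partial>lborel \<partial>lborel)"
      using nn_integral_rotation[of "\<lambda>(x, y). ennreal \<bar>f x * g y\<bar>" "sin \<theta>" "cos \<theta>"] elim by simp
    then show ?case by simp
  qed
  also have "\<dots> = ennreal (2 * pi) * (\<integral>\<^sup>+x. \<integral>\<^sup>+y. ennreal \<bar>f x * g y\<bar> \<partial>lborel \<partial>lborel)"
    by (subst nn_integral_multc) auto
  also have "\<dots> < \<infinity>"
    using fin by (simp add: ennreal_mult_less_top)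
  finally show "(\<integral>\<^sup>+z. ennreal (norm (case z of (p, w) \<Rightarrow> ?H p w)) \<partial>?M) < \<infinity>" .
qed

text \<open>In rotated coordinates x, y the old velocity is
  \<open>x * cos \<theta> + y * sin \<theta>\<close>, so the rotation moves from the densities to
  the test function. Trigonometric test functions then give the transforms of the gain term.\<close>

lemma gain_weak:
  fixes f g \<psi> :: "real \<Rightarrow> real"
  assumes f: "integrable lborel f" and g: "integrable lborel g"
    and \<psi>[measurable]: "\<psi> \<in> borel_measurable borel" and \<psi>1: "\<And>v. \<bar>\<psi> v\<bar> \<le> 1"
  shows "integrable lborel (\<lambda>v. \<psi> v * gain f g v)"
    and "(LBINT v. \<psi> v * gain f g v) = (LBINT \<theta>. indicator {0..2*pi} \<theta> *
       (LBINT x. LBINT y. \<psi> (x * cos \<theta> + y * sin \<theta>) * (f x * g y))) / (2 * pi)"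
proof -
  have [measurable]: "f \<in> borel_measurable borel" "g \<in> borel_measurable borel" using f g by auto
  interpret P: pair_sigma_finite "lborel \<Otimes>\<^sub>M lborel :: (real \<times> real) measure" "lborel :: real measure"
    unfolding lborel_prod ..
  let ?K = "\<lambda>v \<theta> w. f (v * cos \<theta> - w * sin \<theta>) * g (v * sin \<theta> + w * cos \<theta>)"
  let ?F = "\<lambda>(v, \<theta>). \<psi> v * (indicator {0..2*pi} \<theta> * (LBINT w. ?K v \<theta> w))"
  have F: "integrable (lborel \<Otimes>\<^sub>M lborel) ?F"
    using P.integrable_fst[OF collision_integrable[OF f g \<psi> \<psi>1]]
    by (simp add: case_prod_beta' mult.assoc)
  have eq: "\<psi> v * gain f g v = (LBINT \<theta>. ?F (v, \<theta>)) / (2 * pi)" for v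
    by (simp add: gain_def)
  show "integrable lborel (\<lambda>v. \<psi> v * gain f g v)"
    unfolding eq using lborel_pair.integrable_fst[OF F] by simp
  have "(LBINT v. LBINT \<theta>. ?F (v, \<theta>)) = (LBINT \<theta>. LBINT v. ?F (v, \<theta>))"
    using lborel_pair.Fubini_integral[of "\<lambda>v \<theta>. ?F (v, \<theta>)"] F by simp
  also have "\<dots> = (LBINT \<theta>. indicator {0..2*pi} \<theta> *
       (LBINT x. LBINT y. \<psi> (x * cos \<theta> + y * sin \<theta>) * (f x * g y)))"
  proof (rule integral_cong_AE)
    show "AE \<theta> in lborel. (LBINT v. ?F (v, \<theta>)) = indicator {0..2*pi} \<theta> *
       (LBINT x. LBINT y. \<psi> (x * cos \<theta> + y * sin \<theta>) * (f x * g y))"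
      using AE_sin_nonzero
    proof eventually_elim
      case (elim \<theta>)
      define G where "G = (\<lambda>(x, y). \<psi> (x * cos \<theta> + y * sin \<theta>) * (f x * g y))"
      have G: "integrable (lborel \<Otimes>\<^sub>M lborel) G"
        using integrable_prod_mult[OF f g, of "\<lambda>(x, y). \<psi> (x * cos \<theta> + y * sin \<theta>)"] \<psi>1
        by (simp add: G_def split_beta)
      have "G (v * cos \<theta> - w * sin \<theta>, v * sin \<theta> + w * cos \<theta>) = \<psi> v * ?K v \<theta> w" for v w
      proof -
        have "(v * cos \<theta> - w * sin \<theta>) * cos \<theta> + (v * sin \<theta> + w * cos \<theta>) * sin \<theta> = v * ((cos \<theta>)\<^sup>2 + (sin \<theta>)\<^sup>2)"
          unfolding power2_eq_square by (simp only: algebra_simps)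
        also have "\<dots> = v" by simp
        finally show ?thesis by (simp add: G_def)
      qed
      then have "(LBINT v. \<psi> v * (LBINT w. ?K v \<theta> w)) = (LBINT x. LBINT y. G (x, y))"
        using integral_rotation(2)[OF G elim, of "cos \<theta>"] by simp
      then show ?case
        by (simp add: G_def mult.left_commute[of "\<psi> _" "indicator _ _"])
    qed
  qed (use lborel_pair.integrable_snd[of "\<lambda>v \<theta>. ?F (v, \<theta>)"] F in auto)
  finally show "(LBINT v. \<psi> v * gain f g v) = (LBINT \<theta>. indicator {0..2*pi} \<theta> *
       (LBINT x. LBINT y. \<psi> (x * cos \<theta> + y * sin \<theta>) * (f x * g y))) / (2 * pi)"
    unfolding eq by simp
qed

lemma star_lebesgue:
  assumes "continuous_on UNIV g" "continuous_on UNIV h"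
  shows "star g h x = (LBINT \<theta>. indicator {0..2*pi} \<theta> * (g (x * cos \<theta>) * h (x * sin \<theta>))) / (2 * pi)"
    and "integrable lborel (\<lambda>\<theta>. indicator {0..2*pi} \<theta> * (g (x * cos \<theta>) * h (x * sin \<theta>)))"
proof -
  have i: "set_integrable lborel {0..2*pi} (\<lambda>\<theta>. g (x * cos \<theta>) * h (x * sin \<theta>))"
    by (rule borel_integrable_atLeastAtMost') (rule continuous_star_integrand[OF assms])
  then show "integrable lborel (\<lambda>\<theta>. indicator {0..2*pi} \<theta> * (g (x * cos \<theta>) * h (x * sin \<theta>)))"
    by (simp add: set_integrable_def)
  show "star g h x = (LBINT \<theta>. indicator {0..2*pi} \<theta> * (g (x * cos \<theta>) * h (x * sin \<theta>))) / (2 * pi)"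
    using set_borel_integral_eq_integral(2)[OF i] by (simp add: star_def set_lebesgue_integral_def)
qed

lemma gain_transforms:
  assumes f: "integrable lborel f" and g: "integrable lborel g"
  shows "cosT (gain f g) x = star (cosT f) (cosT g) x - star (sinT f) (sinT g) x" (is ?C)
    and "sinT (gain f g) x = star (sinT f) (cosT g) x + star (cosT f) (sinT g) x" (is ?S)
proof -
  note cont = continuous_cosT[OF f] continuous_cosT[OF g] continuous_sinT[OF f] continuous_sinT[OF g]
  have ci: "(LBINT a. LBINT b. cos (x * (a * c + b * s)) * (f a * g b)) =
      cosT f (x * c) * cosT g (x * s) - sinT f (x * c) * sinT g (x * s)" for c s
  proof -
    have "(LBINT b. cos (x * (a * c + b * s)) * (f a * g b)) =
       (cos ((x * c) * a) * f a) * cosT g (x * s) - (sin ((x * c) * a) * f a) * sinT g (x * s)" for a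
    proof -
      have "(LBINT b. cos (x * (a * c + b * s)) * (f a * g b)) =
         (LBINT b. (cos ((x * c) * a) * f a) * (cos ((x * s) * b) * g b) - (sin ((x * c) * a) * f a) * (sin ((x * s) * b) * g b))"
        by (intro Bochner_Integration.integral_cong refl) (simp add: distrib_left cos_add algebra_simps)
      also have "\<dots> = (cos ((x * c) * a) * f a) * cosT g (x * s) - (sin ((x * c) * a) * f a) * sinT g (x * s)"
        unfolding cosT_def sinT_def
        by (subst Bochner_Integration.integral_diff) (simp_all add: integrable_cosT[OF g] integrable_sinT[OF g])
      finally show ?thesis .
    qed
    then show ?thesis
      unfolding cosT_def[of f] sinT_def[of f]
      by (simp add: integrable_cosT[OF f] integrable_sinT[OF f] integrable_mult_left)
  qed
  have si: "(LBINT a. LBINT b. sin (x * (a * c + b * s)) * (f a * g b)) =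
      sinT f (x * c) * cosT g (x * s) + cosT f (x * c) * sinT g (x * s)" for c s
  proof -
    have "(LBINT b. sin (x * (a * c + b * s)) * (f a * g b)) =
       (sin ((x * c) * a) * f a) * cosT g (x * s) + (cos ((x * c) * a) * f a) * sinT g (x * s)" for a
    proof -
      have "(LBINT b. sin (x * (a * c + b * s)) * (f a * g b)) =
         (LBINT b. (sin ((x * c) * a) * f a) * (cos ((x * s) * b) * g b) + (cos ((x * c) * a) * f a) * (sin ((x * s) * b) * g b))"
        by (intro Bochner_Integration.integral_cong refl) (simp add: distrib_left sin_add algebra_simps)
      also have "\<dots> = (sin ((x * c) * a) * f a) * cosT g (x * s) + (cos ((x * c) * a) * f a) * sinT g (x * s)"
        unfolding cosT_def sinT_def
        by (subst Bochner_Integration.integral_add) (simp_all add: integrable_cosT[OF g] integrable_sinT[OF g])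
      finally show ?thesis .
    qed
    then show ?thesis
      unfolding cosT_def[of f] sinT_def[of f]
      by (simp add: integrable_cosT[OF f] integrable_sinT[OF f] integrable_mult_left)
  qed
  have "cosT (gain f g) x = (LBINT \<theta>. indicator {0..2*pi} \<theta> *
      (LBINT a. LBINT b. cos (x * (a * cos \<theta> + b * sin \<theta>)) * (f a * g b))) / (2 * pi)"
    unfolding cosT_def by (rule gain_weak(2)[OF f g]) auto
  also have "\<dots> = (LBINT \<theta>. indicator {0..2*pi} \<theta> * (cosT f (x * cos \<theta>) * cosT g (x * sin \<theta>))
      - indicator {0..2*pi} \<theta> * (sinT f (x * cos \<theta>) * sinT g (x * sin \<theta>))) / (2 * pi)"
    unfolding ci by (simp only: right_diff_distrib)
  also have "\<dots> = star (cosT f) (cosT g) x - star (sinT f) (sinT g) x"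
    unfolding star_lebesgue(1)[OF cont(1,2)] star_lebesgue(1)[OF cont(3,4)]
    by (subst Bochner_Integration.integral_diff)
      (rule star_lebesgue(2)[OF cont(1,2)] star_lebesgue(2)[OF cont(3,4)] diff_divide_distrib)+
  finally show ?C .
  have "sinT (gain f g) x = (LBINT \<theta>. indicator {0..2*pi} \<theta> *
      (LBINT a. LBINT b. sin (x * (a * cos \<theta> + b * sin \<theta>)) * (f a * g b))) / (2 * pi)"
    unfolding sinT_def by (rule gain_weak(2)[OF f g]) auto
  also have "\<dots> = (LBINT \<theta>. indicator {0..2*pi} \<theta> * (sinT f (x * cos \<theta>) * cosT g (x * sin \<theta>))
      + indicator {0..2*pi} \<theta> * (cosT f (x * cos \<theta>) * sinT g (x * sin \<theta>))) / (2 * pi)"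
    unfolding si by (simp only: distrib_left)
  also have "\<dots> = star (sinT f) (cosT g) x + star (cosT f) (sinT g) x"
    unfolding star_lebesgue(1)[OF cont(3,2)] star_lebesgue(1)[OF cont(1,4)]
    by (subst Bochner_Integration.integral_add)
      (rule star_lebesgue(2)[OF cont(3,2)] star_lebesgue(2)[OF cont(1,4)] add_divide_distrib)+
  finally show ?S .
qed

text \<open>Sine transforms are odd, and the average over the circle annihilates any
  \<open>star\<close> product with an odd factor. So the gain term is blind to odd parts, and
  collisions only damp them.\<close>

lemma gain_transforms_even:
  assumes f: "integrable lborel f" and g: "integrable lborel g"
  shows "cosT (gain f g) x = star (cosT f) (cosT g) x" "sinT (gain f g) x = 0"
proof -
  note cont = continuous_cosT[OF f] continuous_cosT[OF g] continuous_sinT[OF f] continuous_sinT[OF g]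
  have "star (sinT f) (sinT g) x = 0" "star (cosT f) (sinT g) x = 0"
    by (rule star_odd_right; use cont sinT_minus in auto)+
  moreover have "star (sinT f) (cosT g) x = star (cosT g) (sinT f) x"
    by (rule star_commute) (use cont in auto)
  moreover have "star (cosT g) (sinT f) x = 0"
    by (rule star_odd_right; use cont sinT_minus in auto)
  ultimately show "cosT (gain f g) x = star (cosT f) (cosT g) x" "sinT (gain f g) x = 0"
    by (simp_all add: gain_transforms[OF f g])
qed

lemma prob_densityD:
  assumes "prob_density g"
  shows "0 \<le> g x" "integrable lborel g" "(LBINT x. g x) = 1"
  using assms by (auto simp: prob_density_def has_bochner_integral_iff)

lemma prob_densityI:
  assumes "\<And>x. 0 \<le> g x" "integrable lborel g" "(LBINT x. g x) = 1"
  shows "prob_density g"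
  using assms by (auto simp: prob_density_def has_bochner_integral_iff)

lemma prob_density_gain:
  assumes f: "prob_density f" and g: "prob_density g"
  shows "prob_density (gain f g)"
proof (rule prob_densityI)
  note F = prob_densityD[OF f] and G = prob_densityD[OF g]
  show "0 \<le> gain f g x" for x
    unfolding gain_def using F(1) G(1) by (intro divide_nonneg_pos integral_nonneg mult_nonneg_nonneg) auto
  show "integrable lborel (gain f g)"
    using gain_weak(1)[OF F(2) G(2), of "\<lambda>_. 1"] by simp
  have "(LBINT v. gain f g v) = (LBINT \<theta>. indicator {0..2*pi} \<theta> * (LBINT x. LBINT y. f x * g y)) / (2 * pi)"
    using gain_weak(2)[OF F(2) G(2), of "\<lambda>_. 1"] by simp
  also have "\<dots> = 1" using F G by simp
  finally show "(LBINT v. gain f g v) = 1" .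
qed

text \<open>The loss term is \<open>g v\<close>, because g has mass 1 and the circle average is
  normalised. Convergence of the collision integral, together with integrability of the loss, makes
  the gain integral converge separately and allows the splitting.\<close>

lemma kac_collision_eq_gain:
  assumes g: "prob_density g"
    and i: "set_integrable (lborel \<Otimes>\<^sub>M lborel) ({0..2*pi} \<times> UNIV) (\<lambda>(\<theta>, w). kac_integrand g v \<theta> w)"
  shows "kac_collision g v = gain g g v - g v"
proof -
  note G = prob_densityD[OF g]
  let ?I = "indicator {0..2*pi} :: real \<Rightarrow> real"
  let ?K = "\<lambda>\<theta> w. g (v * cos \<theta> - w * sin \<theta>) * g (v * sin \<theta> + w * cos \<theta>)"
  have I: "integrable lborel ?I" by (intro integrable_real_indicator) auto
  have i1: "integrable (lborel \<Otimes>\<^sub>M lborel) (\<lambda>(\<theta>, w). ?I \<theta> * kac_integrand g v \<theta> w)"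
    using i by (simp add: set_integrable_def case_prod_beta' indicator_times)
  have i2: "integrable (lborel \<Otimes>\<^sub>M lborel) (\<lambda>(\<theta>, w). ?I \<theta> * g w)"
    by (rule integrable_pair_mult[OF I G(2)])
  have i3: "integrable (lborel \<Otimes>\<^sub>M lborel) (\<lambda>(\<theta>, w). ?I \<theta> * ?K \<theta> w)"
  proof -
    have "integrable (lborel \<Otimes>\<^sub>M lborel) (\<lambda>z. (case z of (\<theta>, w) \<Rightarrow> ?I \<theta> * kac_integrand g v \<theta> w)
       + g v * (case z of (\<theta>, w) \<Rightarrow> ?I \<theta> * g w))"
      by (intro Bochner_Integration.integrable_add integrable_mult_right i1 i2)
    then show ?thesis by (simp add: case_prod_beta' kac_integrand_def algebra_simps)
  qed
  have i4: "integrable lborel (\<lambda>\<theta>. ?I \<theta> * (LBINT w. ?K \<theta> w))"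
    using lborel_pair.integrable_fst[OF i3] by simp
  have i5: "integrable lborel (\<lambda>\<theta>. ?I \<theta> * (LBINT w. kac_integrand g v \<theta> w))"
    using lborel_pair.integrable_fst[OF i1] by simp
  have "kac_collision g v = (LBINT \<theta>. ?I \<theta> * (LBINT w. kac_integrand g v \<theta> w)) / (2 * pi)"
    by (simp add: kac_collision_def set_lebesgue_integral_def)
  also have "(LBINT \<theta>. ?I \<theta> * (LBINT w. kac_integrand g v \<theta> w)) =
      (LBINT \<theta>. ?I \<theta> * (LBINT w. ?K \<theta> w) - ?I \<theta> * g v)"
  proof (rule integral_cong_AE)
    have "AE \<theta> in lborel. integrable lborel (\<lambda>w. ?I \<theta> * ?K \<theta> w)"
      using lborel_pair.AE_integrable_fst[OF i3] by simp
    then show "AE \<theta> in lborel. ?I \<theta> * (LBINT w. kac_integrand g v \<theta> w) = ?I \<theta> * (LBINT w. ?K \<theta> w) - ?I \<theta> * g v"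
    proof eventually_elim
      case (elim \<theta>)
      show ?case
      proof (cases "\<theta> \<in> {0..2*pi}")
        case True
        then have "integrable lborel (\<lambda>w. ?K \<theta> w)" using elim by simp
        then have "(LBINT w. kac_integrand g v \<theta> w) = (LBINT w. ?K \<theta> w) - g v"
          unfolding kac_integrand_def using G by (subst Bochner_Integration.integral_diff) auto
        then show ?thesis using True by simp
      qed simp
    qed
    show "(\<lambda>\<theta>. ?I \<theta> * (LBINT w. kac_integrand g v \<theta> w)) \<in> borel_measurable lborel" using i5 by auto
    show "(\<lambda>\<theta>. ?I \<theta> * (LBINT w. ?K \<theta> w) - ?I \<theta> * g v) \<in> borel_measurable lborel" using i4 by auto
  qed
  also have "\<dots> = (LBINT \<theta>. ?I \<theta> * (LBINT w. ?K \<theta> w)) - 2 * pi * g v"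
    using i4 I by (subst Bochner_Integration.integral_diff) auto
  finally show ?thesis by (simp add: gain_def diff_divide_distrib)
qed

section \<open>Solutions of Kac's equation\<close>

lemma weak_limit_of_L1:
  fixes F :: "nat \<Rightarrow> real \<Rightarrow> real"
  assumes Fi: "\<And>n. integrable lborel (F n)" and fi: "integrable lborel f"
    and lim: "(\<lambda>n. \<integral>\<^sup>+ x. norm (F n x - f x) \<partial>lborel) \<longlonglongrightarrow> 0"
    and \<psi>: "\<psi> \<in> borel_measurable borel" "\<And>x. \<bar>\<psi> x\<bar> \<le> 1"
  shows "(\<lambda>n. LBINT x. \<psi> x * F n x) \<longlonglongrightarrow> (LBINT x. \<psi> x * f x)"
proof -
  have i: "integrable lborel (\<lambda>x. F n x - f x)" for n using Fi fi by auto
  have "(\<lambda>n. ennreal (LBINT x. \<bar>F n x - f x\<bar>)) \<longlonglongrightarrow> 0"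
    using lim i by (simp add: nn_integral_eq_integral)
  then have L1: "(\<lambda>n. LBINT x. \<bar>F n x - f x\<bar>) \<longlonglongrightarrow> 0"
    by (subst (asm) ennreal_tendsto_0_iff) auto
  have "(\<lambda>n. (LBINT x. \<psi> x * F n x) - (LBINT x. \<psi> x * f x)) \<longlonglongrightarrow> 0"
  proof (rule Lim_null_comparison[OF always_eventually L1], rule allI)
    fix n
    have "(LBINT x. \<psi> x * F n x) - (LBINT x. \<psi> x * f x) = (LBINT x. \<psi> x * (F n x - f x))"
      unfolding right_diff_distrib
      by (rule Bochner_Integration.integral_diff[symmetric]; rule integrable_bounded_mult[OF _ \<psi>]; rule Fi fi)
    then show "norm ((LBINT x. \<psi> x * F n x) - (LBINT x. \<psi> x * f x)) \<le> (LBINT x. \<bar>F n x - f x\<bar>)"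
      using integral_bounded_mult_le[OF i \<psi>, of n] by simp
  qed
  then show ?thesis by (simp add: LIM_zero_iff)
qed

text \<open>Since \<open>e\<^sup>t f(v, t)\<close> is nondecreasing in \<open>t\<close> with total mass \<open>e\<^sup>t\<close>, the difference quotients are
  nonnegative with converging masses, so Scheffe's lemma turns the pointwise equation into an
  equation in \<open>L\<^sup>1\<close>, without any joint measurability in \<open>(v, t)\<close>.\<close>

locale kac_flow =
  fixes f0 :: "real \<Rightarrow> real" and f :: "real \<Rightarrow> real \<Rightarrow> real"
  assumes f0: "prob_density f0" and sol: "kac_solution f0 f"
begin

definition ft :: "real \<Rightarrow> real \<Rightarrow> real" where "ft t = (\<lambda>v. f v t)"

lemma ft: "0 \<le> t \<Longrightarrow> prob_density (ft t)"
  using sol by (simp add: kac_solution_def ft_def)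

text \<open>The integrating factor \<open>exp s\<close> absorbs the loss term and leaves a
  nonnegative derivative.\<close>

lemma AE_deriv: "AE v in lborel. \<forall>t>0. ((\<lambda>s. exp s * f v s) has_real_derivative exp t * gain (ft t) (ft t) v) (at t)"
proof -
  have "AE v in lborel. \<forall>t>0.
        set_integrable (lborel \<Otimes>\<^sub>M lborel) ({0..2*pi} \<times> UNIV)
          (\<lambda>(\<theta>, w). kac_integrand (ft t) v \<theta> w) \<and>
        ((\<lambda>s. f v s) has_real_derivative kac_collision (ft t) v) (at t)"
    using sol by (simp add: kac_solution_def ft_def)
  then show ?thesis
  proof eventually_elim
    case (elim v)
    show ?case
    proof (intro allI impI)
      fix t :: real assume t: "0 < t"
      have "kac_collision (ft t) v = gain (ft t) (ft t) v - f v t"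
        using kac_collision_eq_gain[OF ft, of t v] elim t by (simp add: ft_def)
      then have "((\<lambda>s. f v s) has_real_derivative gain (ft t) (ft t) v - f v t) (at t)"
        using elim t by auto
      then show "((\<lambda>s. exp s * f v s) has_real_derivative exp t * gain (ft t) (ft t) v) (at t)"
        by (auto intro!: derivative_eq_intros simp: algebra_simps)
    qed
  qed
qed

lemma AE_mono: "AE v in lborel. \<forall>s>0. \<forall>t\<ge>s. exp s * f v s \<le> exp t * f v t"
  using AE_deriv
proof eventually_elim
  case (elim v)
  show ?case
  proof (intro allI impI)
    fix s t :: real assume s: "0 < s" "s \<le> t"
    show "exp s * f v s \<le> exp t * f v t"
    proof (rule DERIV_nonneg_imp_nondecreasing[OF s(2)])
      fix x assume "s \<le> x" "x \<le> t"
      then show "\<exists>y. ((\<lambda>s. exp s * f v s) has_real_derivative y) (at x) \<and> 0 \<le> y"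
        using elim s prob_densityD(1)[OF prob_density_gain[OF ft ft], of x x v]
        by (intro exI[of _ "exp x * gain (ft x) (ft x) v"]) auto
    qed
  qed
qed

lemma weak_deriv_seq:
  assumes t: "0 < t" and \<psi>: "\<psi> \<in> borel_measurable borel" "\<And>x. \<bar>\<psi> x\<bar> \<le> 1"
    and h: "\<And>n. h n \<noteq> 0" "\<And>n. 0 < t + h n" "h \<longlonglongrightarrow> 0"
  shows "(\<lambda>n. (exp (t + h n) * (LBINT v. \<psi> v * ft (t + h n) v) - exp t * (LBINT v. \<psi> v * ft t v)) / h n)
    \<longlonglongrightarrow> exp t * (LBINT v. \<psi> v * gain (ft t) (ft t) v)"
proof -
  define F where "F = (\<lambda>n v. (exp (t + h n) * ft (t + h n) v - exp t * ft t v) / h n)"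
  define g where "g = (\<lambda>v. exp t * gain (ft t) (ft t) v)"
  have P: "prob_density (ft t)" "prob_density (ft (t + h n))" for n
    using t h(2)[of n] by (auto intro!: ft)
  have Pg: "prob_density (gain (ft t) (ft t))" by (rule prob_density_gain[OF P(1) P(1)])
  have Fi: "integrable lborel (F n)" for n
    unfolding F_def using prob_densityD(2)[OF P(1)] prob_densityD(2)[OF P(2)[of n]] by auto
  have gi: "integrable lborel g" unfolding g_def using prob_densityD(2)[OF Pg] by simp
  have Fint: "(LBINT v. F n v) = (exp (t + h n) - exp t) / h n" for n
    unfolding F_def using prob_densityD(2,3)[OF P(1)] prob_densityD(2,3)[OF P(2)[of n]] by simp
  have gint: "(LBINT v. g v) = exp t" unfolding g_def using prob_densityD(3)[OF Pg] by simp
  have g0: "0 \<le> g v" for v unfolding g_def using prob_densityD(1)[OF Pg] by simp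
  have F0: "AE v in lborel. 0 \<le> F n v" for n
    using AE_mono
  proof eventually_elim
    case (elim v)
    show ?case
    proof (cases "h n > 0")
      case True
      then show ?thesis using elim t by (auto simp: F_def ft_def)
    next
      \<comment> \<open>For negative steps numerator and denominator change sign together, so the
        quotient is again nonnegative.\<close>
      case False
      then have "h n < 0" using h(1)[of n] by simp
      then have "exp (t + h n) * f v (t + h n) \<le> exp t * f v t"
        using elim h(2)[of n] by auto
      then show ?thesis using \<open>h n < 0\<close> by (auto simp: F_def ft_def divide_nonpos_neg)
    qed
  qed
  have hz: "filterlim h (at 0) sequentially"
    unfolding filterlim_at using h by auto
  have Flim: "AE v in lborel. (\<lambda>n. F n v) \<longlonglongrightarrow> g v"
    using AE_deriv
  proof eventually_elim
    case (elim v)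
    then have "((\<lambda>s. exp s * f v s) has_real_derivative g v) (at t)" using t by (simp add: g_def)
    then have "((\<lambda>h. (exp (t + h) * f v (t + h) - exp t * f v t) / h) \<longlongrightarrow> g v) (at 0)"
      by (simp add: DERIV_def)
    from filterlim_compose[OF this hz] show ?case by (simp add: F_def ft_def)
  qed
  have nF: "(\<integral>\<^sup>+v. norm (F n v) \<partial>lborel) = ennreal ((exp (t + h n) - exp t) / h n)" for n
  proof -
    have "(\<integral>\<^sup>+v. norm (F n v) \<partial>lborel) = (\<integral>\<^sup>+v. ennreal (F n v) \<partial>lborel)"
      by (rule nn_integral_cong_AE) (use F0[of n] in \<open>eventually_elim, simp\<close>)
    also have "\<dots> = ennreal (LBINT v. F n v)"
      by (rule nn_integral_eq_integral[OF Fi F0])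
    finally show ?thesis by (simp add: Fint)
  qed
  have ng: "(\<integral>\<^sup>+v. norm (g v) \<partial>lborel) = ennreal (exp t)"
    using nn_integral_eq_integral[OF gi] g0 gint by simp
  \<comment> \<open>All the \<open>ft s\<close> have mass 1, so the masses of the difference
    quotients are those of the exponential, and they converge to the mass of the limit.\<close>
  have "(exp has_real_derivative exp t) (at t)" by (rule DERIV_exp)
  then have "((\<lambda>h. (exp (t + h) - exp t) / h) \<longlongrightarrow> exp t) (at 0)" by (simp add: DERIV_def)
  from filterlim_compose[OF this hz] have "(\<lambda>n. (exp (t + h n) - exp t) / h n) \<longlonglongrightarrow> exp t" by simp
  then have "(\<lambda>n. \<integral>\<^sup>+v. norm (F n v) \<partial>lborel) \<longlonglongrightarrow> (\<integral>\<^sup>+v. norm (g v) \<partial>lborel)"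
    unfolding nF ng by (rule tendsto_ennrealI)
  then have "limsup (\<lambda>n. \<integral>\<^sup>+v. norm (F n v) \<partial>lborel) \<le> (\<integral>\<^sup>+v. norm (g v) \<partial>lborel)"
    by (simp add: lim_imp_Limsup)
  then have "(\<lambda>n. \<integral>\<^sup>+v. norm (F n v - g v) \<partial>lborel) \<longlonglongrightarrow> 0"
    by (rule Scheffe_lemma1[OF Fi gi Flim])
  then have *: "(\<lambda>n. LBINT v. \<psi> v * F n v) \<longlonglongrightarrow> (LBINT v. \<psi> v * g v)"
    by (rule weak_limit_of_L1[OF Fi gi _ \<psi>])
  have "(LBINT v. \<psi> v * F n v) = (exp (t + h n) * (LBINT v. \<psi> v * ft (t + h n) v) - exp t * (LBINT v. \<psi> v * ft t v)) / h n" for n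
  proof -
    have i1: "integrable lborel (\<lambda>v. \<psi> v * ft t v)"
      by (rule integrable_bounded_mult[OF prob_densityD(2)[OF P(1)] \<psi>])
    have i2: "integrable lborel (\<lambda>v. \<psi> v * ft (t + h n) v)"
      by (rule integrable_bounded_mult[OF prob_densityD(2)[OF P(2)] \<psi>])
    have "(LBINT v. \<psi> v * F n v) = (LBINT v. (exp (t + h n) * (\<psi> v * ft (t + h n) v) - exp t * (\<psi> v * ft t v)) / h n)"
      by (intro Bochner_Integration.integral_cong refl) (simp add: F_def algebra_simps)
    also have "\<dots> = (exp (t + h n) * (LBINT v. \<psi> v * ft (t + h n) v) - exp t * (LBINT v. \<psi> v * ft t v)) / h n"
      using i1 i2 by simp
    finally show ?thesis .
  qed
  with * show ?thesis by (simp add: g_def mult.left_commute[of _ "exp t"])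
qed

lemma weak_deriv:
  assumes t: "0 < t" and \<psi>: "\<psi> \<in> borel_measurable borel" "\<And>x. \<bar>\<psi> x\<bar> \<le> 1"
  shows "((\<lambda>s. exp s * (LBINT v. \<psi> v * ft s v)) has_real_derivative
    exp t * (LBINT v. \<psi> v * gain (ft t) (ft t) v)) (at t)"
  unfolding DERIV_def tendsto_at_iff_sequentially
proof (intro allI impI)
  fix X :: "nat \<Rightarrow> real" assume X: "\<forall>i. X i \<in> UNIV - {0}" and lim: "X \<longlonglongrightarrow> 0"
  from lim t have "eventually (\<lambda>n. - t < X n) sequentially"
    by (intro order_tendstoD) auto
  then obtain N where N: "\<And>n. n \<ge> N \<Longrightarrow> - t < X n" by (auto simp: eventually_sequentially)
  \<comment> \<open>The index is shifted because the solution is only available at positive times,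
    and the first few steps may lead below 0.\<close>
  have "(\<lambda>n. (exp (t + X (n + N)) * (LBINT v. \<psi> v * ft (t + X (n + N)) v) - exp t * (LBINT v. \<psi> v * ft t v)) / X (n + N))
    \<longlonglongrightarrow> exp t * (LBINT v. \<psi> v * gain (ft t) (ft t) v)"
  proof (rule weak_deriv_seq[OF t \<psi>, where h="\<lambda>n. X (n + N)"])
    show "0 < t + X (n + N)" for n using N[of "n + N"] by simp
    show "(\<lambda>n. X (n + N)) \<longlonglongrightarrow> 0" using lim by (rule LIMSEQ_ignore_initial_segment)
  qed (use X in auto)
  then show "((\<lambda>h. (exp (t + h) * (LBINT v. \<psi> v * ft (t + h) v) - exp t * (LBINT v. \<psi> v * ft t v)) / h) \<circ> X)
    \<longlonglongrightarrow> exp t * (LBINT v. \<psi> v * gain (ft t) (ft t) v)"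
    unfolding o_def by (rule LIMSEQ_offset)
qed

text \<open>All densities have mass 1, so Scheffe's lemma upgrades the pointwise limit at time 0 to
  convergence in L1.\<close>

lemma weak_cont_0:
  assumes \<psi>: "\<psi> \<in> borel_measurable borel" "\<And>x. \<bar>\<psi> x\<bar> \<le> 1"
  shows "((\<lambda>s. LBINT v. \<psi> v * ft s v) \<longlongrightarrow> (LBINT v. \<psi> v * f0 v)) (at_right 0)"
  unfolding tendsto_at_iff_sequentially
proof (intro allI impI)
  fix X :: "nat \<Rightarrow> real" assume X: "\<forall>i. X i \<in> {0<..} - {0}" and lim: "X \<longlonglongrightarrow> 0"
  have Xp: "0 < X n" for n using X by auto
  have P: "prob_density (ft (X n))" for n using Xp[of n] by (intro ft) auto
  note F = prob_densityD[OF P] and G = prob_densityD[OF f0]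
  have Xr: "filterlim X (at_right 0) sequentially"
    unfolding filterlim_at
  proof
    show "\<forall>\<^sub>F n in sequentially. X n \<in> {0<..} \<and> X n \<noteq> 0"
      by (rule always_eventually) (metis Xp greaterThan_iff less_irrefl)
  qed (rule lim)
  have "(\<lambda>n. \<integral>\<^sup>+v. norm (ft (X n) v - f0 v) \<partial>lborel) \<longlonglongrightarrow> 0"
  proof (rule Scheffe_lemma2)
    have "AE v in lborel. ((\<lambda>t. f v t) \<longlongrightarrow> f0 v) (at_right 0)"
      using sol unfolding kac_solution_def by auto
    then show "AE v in lborel. (\<lambda>n. ft (X n) v) \<longlonglongrightarrow> f0 v"
      by eventually_elim (use filterlim_compose[OF _ Xr] in \<open>auto simp: ft_def\<close>)
    fix n
    have "(\<integral>\<^sup>+v. norm (ft (X n) v) \<partial>lborel) = ennreal 1" "(\<integral>\<^sup>+v. norm (f0 v) \<partial>lborel) = ennreal 1"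
      using nn_integral_eq_integral[OF F(2)[of n]] nn_integral_eq_integral[OF G(2)] F(1,3)[of n] G(1,3) by auto
    then show "(\<integral>\<^sup>+v. norm (ft (X n) v) \<partial>lborel) \<le> (\<integral>\<^sup>+v. norm (f0 v) \<partial>lborel)" by simp
  qed (use F(2) G(2) in auto)
  from weak_limit_of_L1[OF F(2) G(2) this \<psi>]
  show "((\<lambda>s. LBINT v. \<psi> v * ft s v) \<circ> X) \<longlonglongrightarrow> (LBINT v. \<psi> v * f0 v)" by (simp add: o_def)
qed

end

section \<open>Wild's series for the cosine transform of a solution\<close>

lemma star_bound_const:
  assumes "continuous_on UNIV g" "continuous_on UNIV h"
    and "\<And>y. \<bar>g y\<bar> \<le> a" "\<And>y. \<bar>h y\<bar> \<le> b"
  shows "\<bar>star g h x\<bar> \<le> a * b"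
proof -
  have ab: "0 \<le> a" "0 \<le> b" using assms(3,4)[of 0] by linarith+
  have "\<bar>star g h x\<bar> \<le> integral {0..2*pi} (\<lambda>\<theta>. a * b) / (2*pi)"
    by (rule star_bound[OF assms(1,2) integrable_const_ivl])
      (use assms(3,4) ab in \<open>auto simp: abs_mult intro!: mult_mono\<close>)
  then show ?thesis by simp
qed

lemma wild_le_1:
  assumes "continuous_on UNIV A" "\<And>x. \<bar>A x\<bar> \<le> 1"
  shows "\<bar>wild A n x\<bar> \<le> 1"
proof (induction n arbitrary: x rule: less_induct)
  case (less n)
  show ?case
  proof (cases n)
    case 0
    then show ?thesis using assms by simp
  next
    case (Suc m)
    have "\<bar>star (wild A k) (wild A (m - k)) x\<bar> \<le> 1" if "k \<le> m" for k
      using star_bound_const[of "wild A k" "wild A (m - k)" 1 1 x] less[of k] less[of "m - k"] that Suc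
        continuous_wild[OF assms(1)] by auto
    then have "\<bar>\<Sum>k\<le>m. star (wild A k) (wild A (m - k)) x\<bar> \<le> (\<Sum>k\<le>m. 1)"
      by (intro order_trans[OF sum_abs sum_mono]) auto
    then show ?thesis unfolding Suc by (simp add: abs_divide divide_le_eq)
  qed
qed

text \<open>Both b - y and b + y are nondecreasing on the positive half-line. Initial values enter
  only as right limits, because the equation is available for positive times only.\<close>

lemma deriv_comparison:
  fixes y b :: "real \<Rightarrow> real"
  assumes y: "\<And>t. 0 < t \<Longrightarrow> (y has_real_derivative d t) (at t)" and y0: "(y \<longlongrightarrow> y0) (at_right 0)"
    and b: "\<And>t. 0 < t \<Longrightarrow> (b has_real_derivative b' t) (at t)" and b0: "(b \<longlongrightarrow> b0) (at_right 0)"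
    and le: "\<And>t. 0 < t \<Longrightarrow> \<bar>d t\<bar> \<le> b' t" and t: "0 < t"
  shows "\<bar>y t - y0\<bar> \<le> b t - b0"
proof -
  have key: "z0 \<le> z t" if z: "\<And>t. 0 < t \<Longrightarrow> (z has_real_derivative z' t) (at t)"
    and z': "\<And>t. 0 < t \<Longrightarrow> 0 \<le> z' t" and z0: "(z \<longlongrightarrow> z0) (at_right 0)" for z z' :: "real \<Rightarrow> real" and z0
  proof (rule tendsto_upperbound[OF z0])
    have "z s \<le> z t" if "0 < s" "s \<le> t" for s
      using that z z' by (intro DERIV_nonneg_imp_nondecreasing[OF that(2)]) (meson less_le_trans)
    then show "eventually (\<lambda>s. z s \<le> z t) (at_right 0)"
      using t by (auto simp: eventually_at_right intro!: exI[of _ t])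
  qed auto
  have "b0 - y0 \<le> b t - y t"
    by (rule key[where z="\<lambda>t. b t - y t" and z'="\<lambda>t. b' t - d t"])
      (use le in \<open>auto intro!: DERIV_diff y b tendsto_diff y0 b0 simp: abs_le_iff\<close>)
  moreover have "b0 + y0 \<le> b t + y t"
    by (rule key[where z="\<lambda>t. b t + y t" and z'="\<lambda>t. b' t + d t"])
      (use le in \<open>auto intro!: DERIV_add y b tendsto_add y0 b0 simp: abs_le_iff\<close>, use le in \<open>fastforce simp: abs_le_iff\<close>)
  ultimately show ?thesis by linarith
qed

context kac_flow
begin

abbreviation A :: "real \<Rightarrow> real" where "A \<equiv> cosT f0"

lemma ft_int: "0 \<le> t \<Longrightarrow> integrable lborel (ft t)"
  using ft prob_densityD by blast

lemma f0_int: "integrable lborel f0"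
  using f0 prob_densityD by blast

lemma C_le_1: "0 \<le> t \<Longrightarrow> \<bar>cosT (ft t) x\<bar> \<le> 1"
  using abs_cosT_le[OF ft_int, of t x] prob_densityD[OF ft, of t] by simp

lemma A_le_1: "\<bar>A x\<bar> \<le> 1"
  using abs_cosT_le[OF f0_int, of x] prob_densityD[OF f0] by simp

lemma C_deriv:
  assumes "0 < t"
  shows "((\<lambda>s. exp s * cosT (ft s) x) has_real_derivative exp t * star (cosT (ft t)) (cosT (ft t)) x) (at t)"
  using weak_deriv[OF assms, of "\<lambda>v. cos (x * v)"] gain_transforms_even(1)[OF ft_int ft_int, of t t x] assms
  by (simp add: cosT_def)

lemma C_0: "((\<lambda>s. cosT (ft s) x) \<longlongrightarrow> A x) (at_right 0)"
  using weak_cont_0[of "\<lambda>v. cos (x * v)"] by (simp add: cosT_def)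

text \<open>The gain term has no sine transform, so the product of \<open>exp t\<close> and the sine
  transform is constant; the comparison function is 0.\<close>

lemma sinT_flow:
  assumes "0 < t"
  shows "sinT (ft t) x = exp (- t) * sinT f0 x"
proof -
  have "\<bar>exp t * sinT (ft t) x - exp 0 * sinT f0 x\<bar> \<le> 0 - 0"
  proof (rule deriv_comparison[where y="\<lambda>t. exp t * sinT (ft t) x" and d="\<lambda>_. 0" and t=t
        and b="\<lambda>_. 0" and b'="\<lambda>_. 0"])
    fix s :: real assume s: "0 < s"
    show "((\<lambda>t. exp t * sinT (ft t) x) has_real_derivative 0) (at s)"
      using weak_deriv[OF s, of "\<lambda>v. sin (x * v)"] gain_transforms_even(2)[OF ft_int ft_int, of s s x] s
      by (simp add: sinT_def)
  next
    show "((\<lambda>t. exp t * sinT (ft t) x) \<longlongrightarrow> exp 0 * sinT f0 x) (at_right 0)"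
      using weak_cont_0[of "\<lambda>v. sin (x * v)"] unfolding sinT_def by (intro tendsto_intros) auto
  qed (use assms in auto)
  then show ?thesis by (simp add: exp_minus field_simps)
qed

text \<open>The partial sums of Wild's series are compared directly with an arbitrary solution, so
  its transform is identified without recourse to uniqueness. Strong induction is needed because the
  error after N terms involves the errors of all shorter partial sums.\<close>

lemma wild_expansion:
  "0 < t \<Longrightarrow> \<bar>cosT (ft t) x - (\<Sum>n<N. exp (- t) * (1 - exp (- t)) ^ n * wild A n x)\<bar> \<le> (1 - exp (- t)) ^ N"
proof (induction N arbitrary: t x rule: less_induct)
  case (less N)
  note IH = less.IH and t = less.prems
  show ?case
  proof (cases N)
    case 0
    then show ?thesis using C_le_1[of t x] t by simp
  next
    case (Suc L)
    define tau where "tau = (\<lambda>s::real. 1 - exp (- s))"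
    define q where "q = wild A"
    define w where "w = (\<lambda>s k. exp (- s) * tau s ^ k)"
    \<comment> \<open>The error of the partial sum times \<open>exp s\<close>: it starts at 0, and
      its derivative contains no loss term.\<close>
    define y where "y = (\<lambda>s. exp s * cosT (ft s) x - (\<Sum>n<Suc L. tau s ^ n * q n x))"
    define d where "d = (\<lambda>s. exp s * star (cosT (ft s)) (cosT (ft s)) x
        - (\<Sum>m<L. exp (- s) * (tau s ^ m * (\<Sum>k\<le>m. star (q k) (q (m - k)) x))))"
    have cA: "continuous_on UNIV A" by (rule continuous_cosT[OF f0_int])
    have cq: "continuous_on UNIV (q n)" for n unfolding q_def by (rule continuous_wild[OF cA])
    have q1: "\<bar>q n x\<bar> \<le> 1" for n x unfolding q_def by (rule wild_le_1[OF cA A_le_1])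
    have tau: "0 \<le> tau s" "tau s \<le> 1" if "0 < s" for s using that by (auto simp: tau_def)
    have dtau: "(tau has_real_derivative exp (- s)) (at s)" for s
      unfolding tau_def by (auto intro!: derivative_eq_intros)
    have IH': "\<bar>cosT (ft s) z - (\<Sum>n<m. w s n * q n z)\<bar> \<le> tau s ^ m" if "m \<le> L" "0 < s" for m s z
      using IH[of m s z] that Suc by (simp add: w_def tau_def q_def)
    \<comment> \<open>The comparison function is chosen such that its derivative,
      \<open>tau s ^ L * (exp s + real L)\<close>, is exactly what the induction hypotheses give for
      \<open>d\<close>: one term of size \<open>exp s * tau s ^ L\<close> and L terms of size
      \<open>tau s ^ L\<close>.\<close>
    have "\<bar>y t - 0\<bar> \<le> exp t * tau t ^ Suc L - 0"
    proof (rule deriv_comparison[where d=d and b="\<lambda>s. exp s * tau s ^ Suc L" and b'="\<lambda>s. tau s ^ L * (exp s + real L)"])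
      fix s :: real assume s: "0 < s"
      have "((\<lambda>s. \<Sum>n<Suc L. tau s ^ n * q n x) has_real_derivative
         (\<Sum>n<Suc L. real n * tau s ^ (n - 1) * exp (- s) * q n x)) (at s)"
        by (auto intro!: derivative_eq_intros dtau sum.cong simp: mult_ac simp del: sum.lessThan_Suc)
      also have "(\<Sum>n<Suc L. real n * tau s ^ (n - 1) * exp (- s) * q n x) =
         (\<Sum>m<L. exp (- s) * (tau s ^ m * (\<Sum>k\<le>m. star (q k) (q (m - k)) x)))"
        by (subst sum.lessThan_Suc_shift) (simp add: q_def mult.left_commute del: of_nat_Suc sum.lessThan_Suc)
      finally show "(y has_real_derivative d s) (at s)"
        unfolding y_def d_def by (rule DERIV_diff[OF C_deriv[OF s]])
      show "((\<lambda>s. exp s * tau s ^ Suc L) has_real_derivative tau s ^ L * (exp s + real L)) (at s)"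
      proof -
        have "((\<lambda>s. exp s * tau s ^ Suc L) has_real_derivative
            exp s * tau s ^ Suc L + ((1 + real L) * (exp (- s) * tau s ^ L)) * exp s) (at s)"
          by (rule DERIV_mult[OF DERIV_exp DERIV_power_Suc[OF dtau]])
        also have "exp s * tau s ^ Suc L + ((1 + real L) * (exp (- s) * tau s ^ L)) * exp s =
            tau s ^ L * (real (Suc L) * (exp s * exp (- s)) + exp s * tau s)"
          by (simp add: algebra_simps)
        also have "real (Suc L) * (exp s * exp (- s)) + exp s * tau s = exp s + real L"
          by (simp add: tau_def right_diff_distrib exp_add[symmetric])
        finally show ?thesis .
      qed
      show "\<bar>d s\<bar> \<le> tau s ^ L * (exp s + real L)"
      proof -
        let ?C = "cosT (ft s)"
        define P where "P = (\<lambda>m z. \<Sum>n<m. w s n * q n z)"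
        have cC: "continuous_on UNIV ?C" by (rule continuous_cosT[OF ft_int]) (use s in simp)
        have cP: "continuous_on UNIV (P m)" for m unfolding P_def by (intro continuous_intros cq)
        have w0: "0 \<le> w s k" for k using tau(1)[OF s] by (simp add: w_def)
        have sP: "star (P m) h x = (\<Sum>n<m. w s n * star (q n) h x)" if "continuous_on UNIV h" for m h
          unfolding P_def by (rule star_sum_left[OF cq that])
        have "(\<Sum>m<L. exp (- s) * (tau s ^ m * (\<Sum>k\<le>m. star (q k) (q (m - k)) x))) =
           exp s * (\<Sum>m<L. \<Sum>k\<le>m. w s k * w s (m - k) * star (q k) (q (m - k)) x)"
          unfolding sum_distrib_left
        proof (intro sum.cong refl)
          fix m k :: nat assume "k \<in> {..m}"
          then have "tau s ^ m = tau s ^ k * tau s ^ (m - k)" by (simp add: power_add[symmetric])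
          moreover have "exp s * (exp (- s) * exp (- s)) = exp (- s)" by (simp add: exp_add[symmetric])
          ultimately show "exp (- s) * (tau s ^ m * star (q k) (q (m - k)) x) =
             exp s * (w s k * w s (m - k) * star (q k) (q (m - k)) x)"
            by (simp add: w_def mult_ac)
        qed
        \<comment> \<open>A Cauchy product cut off to the triangle k + l < L: each index k meets the
          partial sum of length L - k.\<close>
        also have "(\<Sum>m<L. \<Sum>k\<le>m. w s k * w s (m - k) * star (q k) (q (m - k)) x) =
            (\<Sum>k<L. \<Sum>l<L-k. w s k * w s l * star (q k) (q l) x)"
        proof -
          have "(\<Sum>m<L. \<Sum>k\<le>m. w s k * w s (m - k) * star (q k) (q (m - k)) x) =
             (\<Sum>(k, l)\<in>{(k, l). k + l < L}. w s k * w s l * star (q k) (q l) x)"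
            by (rule sum.triangle_reindex[symmetric])
          also have "{(k, l). k + l < L} = (SIGMA k:{..<L}. {..<L-k})" by auto
          finally show ?thesis by (simp add: sum.Sigma)
        qed
        also have "\<dots> = (\<Sum>k<L. w s k * star (q k) (P (L - k)) x)"
        proof (intro sum.cong refl)
          fix k
          have "star (q k) (P (L - k)) x = star (P (L - k)) (q k) x"
            by (rule star_commute[OF cq cP])
          also have "\<dots> = (\<Sum>l<L-k. w s l * star (q l) (q k) x)" by (rule sP[OF cq])
          also have "\<dots> = (\<Sum>l<L-k. w s l * star (q k) (q l) x)"
            by (intro sum.cong refl arg_cong2[where f="(*)"] star_commute cq)
          finally show "(\<Sum>l<L-k. w s k * w s l * star (q k) (q l) x) = w s k * star (q k) (P (L - k)) x"
            by (simp add: sum_distrib_left mult.assoc)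
        qed
        finally have "d s = exp s * (star ?C ?C x - (\<Sum>k<L. w s k * star (q k) (P (L - k)) x))"
          by (simp add: d_def right_diff_distrib)
        \<comment> \<open>Since \<open>P L\<close> is the sum of the \<open>w s k * q k\<close>,
          adding and subtracting \<open>star (P L) ?C x\<close> leaves only errors of partial sums,
          of length L in one term and L - k in the others.\<close>
        also have "star ?C ?C x - (\<Sum>k<L. w s k * star (q k) (P (L - k)) x) =
            star (\<lambda>z. ?C z - P L z) ?C x + (\<Sum>k<L. w s k * star (q k) (\<lambda>z. ?C z - P (L - k) z) x)"
        proof -
          have "(\<Sum>k<L. w s k * star (q k) (\<lambda>z. ?C z - P (L - k) z) x) =
             (\<Sum>k<L. w s k * star (q k) ?C x) - (\<Sum>k<L. w s k * star (q k) (P (L - k)) x)"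
            by (simp add: star_diff_right[OF cq cC cP] right_diff_distrib sum_subtractf)
          then show ?thesis
            by (simp add: star_diff_left[OF cC cP cC] sP[OF cC])
        qed
        finally have d: "d s = exp s * (star (\<lambda>z. ?C z - P L z) ?C x + (\<Sum>k<L. w s k * star (q k) (\<lambda>z. ?C z - P (L - k) z) x))" .
        have IHP: "\<bar>?C z - P m z\<bar> \<le> tau s ^ m" if "m \<le> L" for m z
          unfolding P_def by (rule IH'[OF that s])
        have b1: "\<bar>star (\<lambda>z. ?C z - P L z) ?C x\<bar> \<le> tau s ^ L * 1"
          by (rule star_bound_const) (use IHP[of L] s C_le_1[of s] in \<open>auto intro!: continuous_intros cC cP\<close>)
        have b2: "\<bar>\<Sum>k<L. w s k * star (q k) (\<lambda>z. ?C z - P (L - k) z) x\<bar> \<le> (\<Sum>k<L. exp (- s) * tau s ^ L)"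
        proof (rule order_trans[OF sum_abs sum_mono])
          fix k assume k: "k \<in> {..<L}"
          have "\<bar>star (q k) (\<lambda>z. ?C z - P (L - k) z) x\<bar> \<le> 1 * tau s ^ (L - k)"
            by (rule star_bound_const) (use IHP[of "L - k"] q1 in \<open>auto intro!: continuous_intros cC cP cq\<close>)
          then have "w s k * \<bar>star (q k) (\<lambda>z. ?C z - P (L - k) z) x\<bar> \<le> w s k * tau s ^ (L - k)"
            using w0 by (intro mult_left_mono) auto
          also have "\<dots> = exp (- s) * tau s ^ L"
            using k by (simp add: w_def mult.assoc power_add[symmetric])
          finally show "\<bar>w s k * star (q k) (\<lambda>z. ?C z - P (L - k) z) x\<bar> \<le> exp (- s) * tau s ^ L"
            using w0[of k] by (simp add: abs_mult)
        qed
        have "\<bar>d s\<bar> \<le> exp s * (tau s ^ L * 1 + (\<Sum>k<L. exp (- s) * tau s ^ L))"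
          unfolding d abs_mult using b1 b2
          by (intro mult_mono order_trans[OF abs_triangle_ineq add_mono]) auto
        also have "\<dots> = tau s ^ L * (exp s + real L * (exp s * exp (- s)))"
          by (simp add: algebra_simps)
        finally show ?thesis by (simp add: exp_add[symmetric])
      qed
    next
      have "(y \<longlongrightarrow> exp 0 * A x - (\<Sum>n<Suc L. (1 - exp (- 0)) ^ n * q n x)) (at_right 0)"
        unfolding y_def tau_def by (intro tendsto_intros C_0)
      also have "exp 0 * A x - (\<Sum>n<Suc L. (1 - exp (- 0)) ^ n * q n x) = 0"
        by (subst sum.lessThan_Suc_shift) (simp add: q_def)
      finally show "(y \<longlongrightarrow> 0) (at_right 0)" .
      have "((\<lambda>s::real. exp s * tau s ^ Suc L) \<longlongrightarrow> exp 0 * (1 - exp (- 0)) ^ Suc L) (at_right 0)"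
        unfolding tau_def by (intro tendsto_intros)
      then show "((\<lambda>s. exp s * tau s ^ Suc L) \<longlongrightarrow> 0) (at_right 0)" by simp
    qed (rule t)
    then have "exp (- t) * \<bar>y t\<bar> \<le> exp (- t) * (exp t * tau t ^ Suc L)"
      by (intro mult_left_mono) auto
    also have "exp (- t) * (exp t * tau t ^ Suc L) = tau t ^ Suc L"
      by (simp add: mult.assoc[symmetric] exp_add[symmetric] del: power_Suc)
    also have "exp (- t) * \<bar>y t\<bar> = \<bar>exp (- t) * y t\<bar>" by (simp add: abs_mult)
    also have "exp (- t) * y t = cosT (ft t) x - (\<Sum>n<Suc L. exp (- t) * tau t ^ n * q n x)"
      by (simp add: y_def right_diff_distrib mult.assoc[symmetric] exp_add[symmetric] sum_distrib_left del: sum.lessThan_Suc)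
    finally show ?thesis by (simp only: Suc tau_def q_def)
  qed
qed

lemma wild_series:
  assumes t: "0 < t"
  shows "(\<lambda>n. exp (- t) * (1 - exp (- t)) ^ n * wild A n x) sums cosT (ft t) x"
  unfolding sums_def
proof (rule LIM_zero_cancel, rule Lim_null_comparison[OF always_eventually])
  show "\<forall>N. norm ((\<Sum>n<N. exp (- t) * (1 - exp (- t)) ^ n * wild A n x) - cosT (ft t) x) \<le> (1 - exp (- t)) ^ N"
    using wild_expansion[OF t, of x] by (simp add: abs_minus_commute)
  show "(\<lambda>N. (1 - exp (- t)) ^ N) \<longlonglongrightarrow> 0"
    using t by (intro LIMSEQ_power_zero) auto
qed

end

text \<open>Wild's recursion carried out on densities through \<open>gain\<close>. It is needed for
  the early terms of the series, which are controlled in L1 by their mass and not by decay of their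
  transform. From n = 1 on the densities have no odd part.\<close>

lemma wild_density:
  assumes f0: "prob_density f0"
  shows "\<exists>\<rho>. prob_density \<rho> \<and> (\<forall>x. cosT \<rho> x = wild (cosT f0) n x) \<and> (n \<noteq> 0 \<longrightarrow> (\<forall>x. sinT \<rho> x = 0))"
proof (induction n rule: less_induct)
  case (less n)
  show ?case
  proof (cases n)
    case 0
    then show ?thesis using f0 by (intro exI[of _ f0]) auto
  next
    case (Suc m)
    have "\<forall>k\<in>{..m}. \<exists>\<rho>. prob_density \<rho> \<and> (\<forall>x. cosT \<rho> x = wild (cosT f0) k x)"
      using less Suc by (meson atMost_iff le_imp_less_Suc)
    from bchoice[OF this] obtain \<rho> where \<rho>: "\<And>k. k \<le> m \<Longrightarrow> prob_density (\<rho> k)"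
      "\<And>k. k \<le> m \<Longrightarrow> cosT (\<rho> k) = wild (cosT f0) k" by (auto simp: fun_eq_iff)
    define g where "g = (\<lambda>k. gain (\<rho> k) (\<rho> (m - k)))"
    have g: "prob_density (g k)" if "k \<le> m" for k
      unfolding g_def using that by (intro prob_density_gain \<rho>) auto
    have gT: "cosT (g k) x = star (wild (cosT f0) k) (wild (cosT f0) (m - k)) x" "sinT (g k) x = 0" if "k \<le> m" for k x
      unfolding g_def using that gain_transforms_even[OF prob_densityD(2)[OF \<rho>(1)] prob_densityD(2)[OF \<rho>(1)], of k "m - k" x]
      by (simp_all add: \<rho>(2))
    define r where "r = (\<lambda>v. (\<Sum>k\<le>m. g k v) / real (Suc m))"
    have gi: "integrable lborel (g k)" if "k \<le> m" for k using g[OF that] by (rule prob_densityD)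
    have "prob_density r"
    proof (rule prob_densityI)
      show "0 \<le> r v" for v
        unfolding r_def using prob_densityD(1)[OF g] by (intro divide_nonneg_nonneg sum_nonneg) auto
      show "integrable lborel r" unfolding r_def
        by (intro integrable_divide_zero Bochner_Integration.integrable_sum) (use gi in auto)
      have "(LBINT v. r v) = (\<Sum>k\<le>m. LBINT v. g k v) / real (Suc m)"
        unfolding r_def using gi by (simp add: Bochner_Integration.integral_sum del: of_nat_Suc)
      also have "\<dots> = 1" using prob_densityD(3)[OF g] by simp
      finally show "(LBINT v. r v) = 1" .
    qed
    moreover have "cosT r x = wild (cosT f0) n x" for x
    proof -
      have "cosT r x = (LBINT v. (\<Sum>k\<le>m. cos (x * v) * g k v) / real (Suc m))"
        unfolding cosT_def r_def by (simp add: sum_distrib_left del: of_nat_Suc)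
      also have "\<dots> = (\<Sum>k\<le>m. cosT (g k) x) / real (Suc m)"
        unfolding cosT_def using integrable_cosT[OF gi] by (simp add: Bochner_Integration.integral_sum del: of_nat_Suc)
      finally show ?thesis using gT(1) by (simp add: Suc del: of_nat_Suc)
    qed
    moreover have "sinT r x = 0" for x
    proof -
      have "sinT r x = (LBINT v. (\<Sum>k\<le>m. sin (x * v) * g k v) / real (Suc m))"
        unfolding sinT_def r_def by (simp add: sum_distrib_left del: of_nat_Suc)
      also have "\<dots> = (\<Sum>k\<le>m. sinT (g k) x) / real (Suc m)"
        unfolding sinT_def using integrable_sinT[OF gi] by (simp add: Bochner_Integration.integral_sum del: of_nat_Suc)
      finally show ?thesis using gT(2) by simp
    qed
    ultimately show ?thesis by blast
  qed
qed

section \<open>The initial datum\<close>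

lemma cos_taylor: "\<bar>cos y - (1 - y\<^sup>2 / 2)\<bar> \<le> y ^ 4 / (24::real)"
proof -
  have "\<bar>Re (iexp y - (\<Sum>k\<le>3. (\<i> * y) ^ k / fact k))\<bar> \<le> \<bar>y\<bar> ^ Suc 3 / fact (Suc 3)"
    by (rule order_trans[OF abs_Re_le_cmod iexp_approx1])
  also have "Re (iexp y - (\<Sum>k\<le>3. (\<i> * y) ^ k / fact k)) = cos y - (1 - y\<^sup>2 / 2)"
    by (simp add: numeral_eq_Suc Re_exp power2_eq_square)
  finally show ?thesis by (simp add: fact_numeral power_even_abs)
qed

lemma sin_taylor: "\<bar>sin y - y\<bar> \<le> \<bar>y\<bar> ^ 3 / (6::real)"
proof -
  have "\<bar>Im (iexp y - (\<Sum>k\<le>2. (\<i> * y) ^ k / fact k))\<bar> \<le> \<bar>y\<bar> ^ Suc 2 / fact (Suc 2)"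
    by (rule order_trans[OF abs_Im_le_cmod iexp_approx1])
  also have "Im (iexp y - (\<Sum>k\<le>2. (\<i> * y) ^ k / fact k)) = sin y - y"
    by (simp add: numeral_eq_Suc Im_exp power2_eq_square)
  finally show ?thesis by (simp add: fact_numeral)
qed

text \<open>The upper bound follows from the lower Taylor bound for \<open>exp y\<close>, since (1 -
  y + y^2/2)(1 + y + y^2/2) = 1 + y^4/4 is at least 1.\<close>

lemma exp_neg_taylor:
  assumes "0 \<le> (y::real)"
  shows "1 - y \<le> exp (- y)" "exp (- y) \<le> 1 - y + y\<^sup>2 / 2"
proof -
  show "1 - y \<le> exp (- y)" using exp_ge_add_one_self[of "- y"] by simp
  have 1: "1 + y + y\<^sup>2 / 2 \<le> exp y" by (rule exp_lower_Taylor_quadratic[OF assms])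
  have 2: "0 \<le> 1 - y + y\<^sup>2 / 2"
    using sum_squares_ge_zero[of "1 - y" 1] by (simp add: power2_eq_square algebra_simps)
  have "1 \<le> (1 - y + y\<^sup>2 / 2) * (1 + y + y\<^sup>2 / 2)"
  proof -
    have "(1 - y + y\<^sup>2 / 2) * (1 + y + y\<^sup>2 / 2) = 1 + (y\<^sup>2)\<^sup>2 / 4"
      by (simp add: power2_eq_square algebra_simps)
    then show ?thesis by simp
  qed
  also have "\<dots> \<le> (1 - y + y\<^sup>2 / 2) * exp y" using 1 2 by (rule mult_left_mono)
  finally have "exp (- y) * 1 \<le> exp (- y) * ((1 - y + y\<^sup>2 / 2) * exp y)" by (intro mult_left_mono) auto
  also have "\<dots> = 1 - y + y\<^sup>2 / 2" by (simp add: exp_minus)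
  finally show "exp (- y) \<le> 1 - y + y\<^sup>2 / 2" by simp
qed

lemma DERIV_cosT:
  assumes f: "integrable lborel f" and vf: "integrable lborel (\<lambda>v. v * f v)"
  shows "(cosT f has_real_derivative - sinT (\<lambda>v. v * f v) x) (at x)"
  unfolding DERIV_def tendsto_at_iff_sequentially
proof (intro allI impI)
  fix X :: "nat \<Rightarrow> real" assume X: "\<forall>i. X i \<in> UNIV - {0}" and lim: "X \<longlonglongrightarrow> 0"
  have [measurable]: "f \<in> borel_measurable borel" using f by auto
  have Xn: "X n \<noteq> 0" for n using X by auto
  have hz: "filterlim X (at 0) sequentially" unfolding filterlim_at using lim Xn by auto
  have "(\<lambda>n. LBINT v. (cos ((x + X n) * v) - cos (x * v)) / X n * f v) \<longlonglongrightarrow> (LBINT v. - (sin (x * v) * (v * f v)))"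
  proof (rule integral_dominated_convergence[where w="\<lambda>v. \<bar>v * f v\<bar>"])
    show "AE v in lborel. (\<lambda>n. (cos ((x + X n) * v) - cos (x * v)) / X n * f v) \<longlonglongrightarrow> - (sin (x * v) * (v * f v))"
    proof (rule AE_I2)
      fix v
      have "((\<lambda>x. cos (x * v)) has_real_derivative - sin (x * v) * v) (at x)"
        by (auto intro!: derivative_eq_intros)
      then have "((\<lambda>h. (cos ((x + h) * v) - cos (x * v)) / h) \<longlongrightarrow> - sin (x * v) * v) (at 0)"
        by (simp add: DERIV_def)
      from tendsto_mult_right[OF filterlim_compose[OF this hz], of "f v"]
      show "(\<lambda>n. (cos ((x + X n) * v) - cos (x * v)) / X n * f v) \<longlonglongrightarrow> - (sin (x * v) * (v * f v))"
        by (simp add: mult.assoc)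
    qed
    show "AE v in lborel. norm ((cos ((x + X n) * v) - cos (x * v)) / X n * f v) \<le> \<bar>v * f v\<bar>" for n
    proof (rule AE_I2)
      fix v
      have "norm (cos ((x + X n) * v) - cos (x * v)) \<le> 1 * norm ((x + X n) * v - x * v)"
        by (rule field_differentiable_bound[of UNIV cos "\<lambda>y. - sin y"])
          (auto intro!: derivative_eq_intros)
      then have "\<bar>cos ((x + X n) * v) - cos (x * v)\<bar> \<le> \<bar>X n\<bar> * \<bar>v\<bar>"
        by (simp add: algebra_simps abs_mult)
      then have "\<bar>cos ((x + X n) * v) - cos (x * v)\<bar> / \<bar>X n\<bar> \<le> \<bar>v\<bar>"
        using Xn[of n] by (simp add: divide_le_eq mult.commute)
      then have "\<bar>cos ((x + X n) * v) - cos (x * v)\<bar> / \<bar>X n\<bar> * \<bar>f v\<bar> \<le> \<bar>v\<bar> * \<bar>f v\<bar>"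
        by (rule mult_right_mono) simp
      then show "norm ((cos ((x + X n) * v) - cos (x * v)) / X n * f v) \<le> \<bar>v * f v\<bar>"
        by (simp add: abs_mult)
    qed
  qed (use vf in auto)
  also have "(LBINT v. - (sin (x * v) * (v * f v))) = - sinT (\<lambda>v. v * f v) x"
    by (simp add: sinT_def)
  also have "(\<lambda>n. LBINT v. (cos ((x + X n) * v) - cos (x * v)) / X n * f v) =
     (\<lambda>n. (cosT f (x + X n) - cosT f x) / X n)"
  proof
    fix n
    have "(LBINT v. (cos ((x + X n) * v) - cos (x * v)) / X n * f v) =
       (LBINT v. (cos ((x + X n) * v) * f v - cos (x * v) * f v) / X n)"
      by (intro Bochner_Integration.integral_cong refl) (simp add: left_diff_distrib)
    also have "\<dots> = (cosT f (x + X n) - cosT f x) / X n"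
      unfolding cosT_def using integrable_cosT[OF f] by simp
    finally show "(LBINT v. (cos ((x + X n) * v) - cos (x * v)) / X n * f v) = (cosT f (x + X n) - cosT f x) / X n" .
  qed
  finally show "((\<lambda>h. (cosT f (x + h) - cosT f x) / h) \<circ> X) \<longlonglongrightarrow> - sinT (\<lambda>v. v * f v) x"
    by (simp add: o_def)
qed

locale kac_datum =
  fixes f0 :: "real \<Rightarrow> real" and \<sigma> :: real
  assumes density: "prob_density f0"
    and fourth_moment: "integrable lborel (\<lambda>v. v ^ 4 * f0 v)"
    and tail: "\<exists>p>0. (\<lambda>\<xi>. norm (fourier f0 \<xi>)) \<in> o[at_infinity](\<lambda>\<xi>. \<bar>\<xi>\<bar> powr (- p))"
    and sigma: "\<sigma> = sqrt (LBINT v. v ^ 2 * f0 v)"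
begin

lemmas dens = prob_densityD[OF density]

lemma f0_measurable [measurable]: "f0 \<in> borel_measurable borel"
  using dens(2) by auto

lemma moment_integrable:
  assumes "b \<in> borel_measurable borel" "\<And>v. \<bar>b v\<bar> \<le> 1 + v ^ 4"
  shows "integrable lborel (\<lambda>v. b v * f0 v)"
proof (rule Bochner_Integration.integrable_bound)
  show "integrable lborel (\<lambda>v. f0 v + v ^ 4 * f0 v)"
    using dens(2) fourth_moment by auto
  show "AE v in lborel. norm (b v * f0 v) \<le> norm (f0 v + v ^ 4 * f0 v)"
  proof (rule AE_I2)
    fix v
    have "\<bar>b v\<bar> * f0 v \<le> (1 + v ^ 4) * f0 v" using assms(2) dens(1) by (rule mult_right_mono)
    then show "norm (b v * f0 v) \<le> norm (f0 v + v ^ 4 * f0 v)"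
      using dens(1)[of v] by (simp add: abs_mult distrib_right)
  qed
qed (use assms in measurable)

lemma sq_le: "(v::real)\<^sup>2 \<le> 1 + v ^ 4"
proof -
  have "v ^ 4 = v\<^sup>2 * v\<^sup>2" by (simp flip: power_add)
  then show ?thesis
    using sum_squares_ge_zero[of "v\<^sup>2 - 1" "v\<^sup>2"] zero_le_power2[of v] by (simp add: algebra_simps)
qed

lemma abs_le_quartic: "\<bar>v::real\<bar> \<le> 1 + v ^ 4"
proof (cases "\<bar>v\<bar> \<le> 1")
  case False
  then have "\<bar>v\<bar> ^ 1 \<le> \<bar>v\<bar> ^ 4" by (intro power_increasing) auto
  then show ?thesis by (simp add: power_even_abs)
qed (simp add: add_increasing2)

lemma m1_int: "integrable lborel (\<lambda>v. v * f0 v)"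
  by (rule moment_integrable) (auto simp: abs_le_quartic)

lemma m2_int: "integrable lborel (\<lambda>v. v\<^sup>2 * f0 v)"
  by (rule moment_integrable) (auto simp: sq_le)

text \<open>A density cannot be concentrated on a countable set. This yields both the positivity of
  the second moment and the strict bound on the transform away from 0.\<close>

lemma nonnull:
  assumes "AE v in lborel. g v * f0 v = 0" "countable {v. g v = 0}"
  shows False
proof -
  have "{v. g v = 0} \<in> null_sets lborel" by (rule countable_imp_null_set_lborel) (rule assms)
  then have "AE v in lborel. g v \<noteq> 0" by (rule AE_I') auto
  with assms(1) have "AE v in lborel. f0 v = 0" by eventually_elim auto
  then have "(LBINT v. f0 v) = (LBINT v::real. 0)" by (rule integral_cong_AE[rotated 2]) auto
  then show False using dens(3) by simp
qed

lemma sigma_sq: "\<sigma>\<^sup>2 = (LBINT v. v\<^sup>2 * f0 v)"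
  unfolding sigma using dens(1) by (intro real_sqrt_pow2 Bochner_Integration.integral_nonneg) auto

lemma sigma_pos: "0 < \<sigma>"
proof -
  have "(LBINT v. v\<^sup>2 * f0 v) \<noteq> 0"
  proof
    assume "(LBINT v. v\<^sup>2 * f0 v) = 0"
    then have "AE v in lborel. v\<^sup>2 * f0 v = 0"
      using m2_int dens(1) by (subst (asm) integral_nonneg_eq_0_iff_AE) auto
    then show False by (rule nonnull) simp
  qed
  moreover have "0 \<le> (LBINT v. v\<^sup>2 * f0 v)" using dens(1) by (intro Bochner_Integration.integral_nonneg) auto
  ultimately show ?thesis unfolding sigma by simp
qed

definition A :: "real \<Rightarrow> real" where "A = cosT f0"

definition A' :: "real \<Rightarrow> real" where "A' x = - sinT (\<lambda>v. v * f0 v) x"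

lemma A_deriv: "(A has_real_derivative A' x) (at x)"
  unfolding A_def A'_def by (rule DERIV_cosT[OF dens(2) m1_int])

lemma A_cont: "continuous_on UNIV A"
  unfolding A_def by (rule continuous_cosT[OF dens(2)])

lemma A'_cont: "continuous_on UNIV A'"
  unfolding A'_def by (intro continuous_intros continuous_sinT m1_int)

definition m4 :: real where "m4 = (LBINT v. v ^ 4 * f0 v)"

lemma m4_nonneg: "0 \<le> m4"
  unfolding m4_def using dens(1) by (intro Bochner_Integration.integral_nonneg) auto

lemma A_le_1: "\<bar>A x\<bar> \<le> 1"
  using abs_cosT_le[OF dens(2), of x] dens by (simp add: A_def)

text \<open>The cosine sees only even moments, so there is no cubic term and no centring is assumed;
  \<sigma>^2 is the raw second moment. The Gaussian has the same expansion to this order, hence the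
  fourth-order difference.\<close>

lemma A_taylor: "\<bar>A x - (1 - \<sigma>\<^sup>2 * x\<^sup>2 / 2)\<bar> \<le> m4 / 24 * x ^ 4"
proof -
  have i: "integrable lborel (\<lambda>v. cos (x * v) * f0 v)" by (rule integrable_cosT[OF dens(2)])
  have i2: "integrable lborel (\<lambda>v. f0 v - x\<^sup>2 / 2 * (v\<^sup>2 * f0 v))" using dens(2) m2_int by auto
  have "A x - (1 - \<sigma>\<^sup>2 * x\<^sup>2 / 2) = (LBINT v. cos (x * v) * f0 v) - (LBINT v. f0 v - x\<^sup>2 / 2 * (v\<^sup>2 * f0 v))"
    using dens(2,3) m2_int by (simp add: A_def cosT_def sigma_sq)
  also have "\<dots> = (LBINT v. cos (x * v) * f0 v - (f0 v - x\<^sup>2 / 2 * (v\<^sup>2 * f0 v)))"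
    by (rule Bochner_Integration.integral_diff[OF i i2, symmetric])
  finally have "\<bar>A x - (1 - \<sigma>\<^sup>2 * x\<^sup>2 / 2)\<bar> \<le> (LBINT v. \<bar>cos (x * v) * f0 v - (f0 v - x\<^sup>2 / 2 * (v\<^sup>2 * f0 v))\<bar>)"
    by (simp only: integral_abs_bound)
  also have "\<dots> \<le> (LBINT v. x ^ 4 / 24 * (v ^ 4 * f0 v))"
  proof (rule integral_mono)
    fix v
    have "cos (x * v) * f0 v - (f0 v - x\<^sup>2 / 2 * (v\<^sup>2 * f0 v)) = (cos (x * v) - (1 - (x * v)\<^sup>2 / 2)) * f0 v"
      unfolding power_mult_distrib left_diff_distrib by simp
    then have "\<bar>cos (x * v) * f0 v - (f0 v - x\<^sup>2 / 2 * (v\<^sup>2 * f0 v))\<bar> = \<bar>cos (x * v) - (1 - (x * v)\<^sup>2 / 2)\<bar> * f0 v"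
      by (simp only: abs_mult abs_of_nonneg[OF dens(1)])
    also have "\<dots> \<le> (x * v) ^ 4 / 24 * f0 v"
      by (rule mult_right_mono[OF cos_taylor dens(1)])
    also have "\<dots> = x ^ 4 / 24 * (v ^ 4 * f0 v)"
      by (simp only: power_mult_distrib) simp
    finally show "\<bar>cos (x * v) * f0 v - (f0 v - x\<^sup>2 / 2 * (v\<^sup>2 * f0 v))\<bar> \<le> x ^ 4 / 24 * (v ^ 4 * f0 v)" .
  next
    show "integrable lborel (\<lambda>v. \<bar>cos (x * v) * f0 v - (f0 v - x\<^sup>2 / 2 * (v\<^sup>2 * f0 v))\<bar>)"
      by (intro integrable_abs Bochner_Integration.integrable_diff i i2)
    show "integrable lborel (\<lambda>v. x ^ 4 / 24 * (v ^ 4 * f0 v))"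
      by (intro integrable_mult_right fourth_moment)
  qed
  finally show ?thesis by (simp add: m4_def mult.commute)
qed

lemma A'_taylor: "\<bar>A' x + \<sigma>\<^sup>2 * x\<bar> \<le> m4 / 6 * \<bar>x\<bar> ^ 3"
proof -
  have i: "integrable lborel (\<lambda>v. sin (x * v) * (v * f0 v))" by (rule integrable_sinT[OF m1_int])
  have i2: "integrable lborel (\<lambda>v. x * (v\<^sup>2 * f0 v))" using m2_int by auto
  have "A' x + \<sigma>\<^sup>2 * x = - ((LBINT v. sin (x * v) * (v * f0 v)) - (LBINT v. x * (v\<^sup>2 * f0 v)))"
    by (simp add: A'_def sinT_def sigma_sq)
  also have "\<dots> = - (LBINT v. sin (x * v) * (v * f0 v) - x * (v\<^sup>2 * f0 v))"
    by (subst Bochner_Integration.integral_diff[OF i i2]) simp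
  finally have "\<bar>A' x + \<sigma>\<^sup>2 * x\<bar> \<le> (LBINT v. \<bar>sin (x * v) * (v * f0 v) - x * (v\<^sup>2 * f0 v)\<bar>)"
    by (simp only: abs_minus_cancel integral_abs_bound)
  also have "\<dots> \<le> (LBINT v. \<bar>x\<bar> ^ 3 / 6 * (v ^ 4 * f0 v))"
  proof (rule integral_mono)
    fix v
    have "sin (x * v) * (v * f0 v) - x * (v\<^sup>2 * f0 v) = (sin (x * v) - x * v) * (v * f0 v)"
      unfolding power2_eq_square left_diff_distrib by simp
    then have "\<bar>sin (x * v) * (v * f0 v) - x * (v\<^sup>2 * f0 v)\<bar> = \<bar>sin (x * v) - x * v\<bar> * (\<bar>v\<bar> * f0 v)"
      by (simp only: abs_mult abs_of_nonneg[OF dens(1)])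
    also have "\<dots> \<le> \<bar>x * v\<bar> ^ 3 / 6 * (\<bar>v\<bar> * f0 v)"
      using dens(1)[of v] by (intro mult_right_mono sin_taylor) auto
    also have "\<dots> = \<bar>x\<bar> ^ 3 / 6 * (\<bar>v\<bar> ^ 4 * f0 v)"
      by (simp only: abs_mult power_mult_distrib power4_eq_xxxx power3_eq_cube) simp
    also have "\<bar>v\<bar> ^ 4 = v ^ 4" by (simp add: power_even_abs)
    finally show "\<bar>sin (x * v) * (v * f0 v) - x * (v\<^sup>2 * f0 v)\<bar> \<le> \<bar>x\<bar> ^ 3 / 6 * (v ^ 4 * f0 v)" .
  next
    show "integrable lborel (\<lambda>v. \<bar>sin (x * v) * (v * f0 v) - x * (v\<^sup>2 * f0 v)\<bar>)"
      by (intro integrable_abs Bochner_Integration.integrable_diff i i2)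
    show "integrable lborel (\<lambda>v. \<bar>x\<bar> ^ 3 / 6 * (v ^ 4 * f0 v))"
      by (intro integrable_mult_right fourth_moment)
  qed
  finally show ?thesis by (simp add: m4_def mult.commute)
qed

lemma A'_linear: "\<bar>A' x\<bar> \<le> \<sigma>\<^sup>2 * \<bar>x\<bar>"
proof -
  have "\<bar>A' x\<bar> = \<bar>LBINT v. sin (x * v) * (v * f0 v)\<bar>" by (simp add: A'_def sinT_def)
  also have "\<dots> \<le> (LBINT v. \<bar>sin (x * v) * (v * f0 v)\<bar>)" by (rule integral_abs_bound)
  also have "\<dots> \<le> (LBINT v. \<bar>x\<bar> * (v\<^sup>2 * f0 v))"
  proof (rule integral_mono)
    fix v
    have "\<bar>sin (x * v)\<bar> * (\<bar>v\<bar> * f0 v) \<le> \<bar>x * v\<bar> * (\<bar>v\<bar> * f0 v)"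
      using dens(1)[of v] by (intro mult_right_mono abs_sin_x_le_abs_x) auto
    then have "\<bar>sin (x * v) * (v * f0 v)\<bar> \<le> \<bar>x * v\<bar> * (\<bar>v\<bar> * f0 v)"
      by (simp only: abs_mult abs_of_nonneg[OF dens(1)])
    also have "\<dots> = \<bar>x\<bar> * ((\<bar>v\<bar> * \<bar>v\<bar>) * f0 v)"
      by (simp only: abs_mult mult.assoc)
    also have "\<bar>v\<bar> * \<bar>v\<bar> = v\<^sup>2" by (simp add: power2_eq_square)
    finally show "\<bar>sin (x * v) * (v * f0 v)\<bar> \<le> \<bar>x\<bar> * (v\<^sup>2 * f0 v)" .
  next
    show "integrable lborel (\<lambda>v. \<bar>sin (x * v) * (v * f0 v)\<bar>)"
      by (intro integrable_abs integrable_sinT m1_int)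
    show "integrable lborel (\<lambda>v. \<bar>x\<bar> * (v\<^sup>2 * f0 v))"
      by (intro integrable_mult_right m2_int)
  qed
  finally show ?thesis by (simp add: sigma_sq mult.commute)
qed

definition m1 :: real where "m1 = (LBINT v. \<bar>v * f0 v\<bar>)"

lemma A'_bounded: "\<bar>A' x\<bar> \<le> m1"
  using abs_sinT_le[OF m1_int, of x] by (simp add: A'_def m1_def)

lemma gam_taylor: "\<bar>gam \<sigma> x - (1 - \<sigma>\<^sup>2 * x\<^sup>2 / 2)\<bar> \<le> \<sigma> ^ 4 / 8 * x ^ 4"
proof -
  let ?y = "\<sigma>\<^sup>2 * x\<^sup>2 / 2"
  have "?y\<^sup>2 / 2 = \<sigma> ^ 4 / 8 * x ^ 4"
    by (simp add: power_mult_distrib power_divide flip: power_mult)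
  then show ?thesis using exp_neg_taylor[of ?y] by (simp add: gam_def)
qed

lemma gam'_taylor: "\<bar>- (\<sigma>\<^sup>2 * x) * gam \<sigma> x + \<sigma>\<^sup>2 * x\<bar> \<le> \<sigma> ^ 4 / 2 * \<bar>x\<bar> ^ 3"
proof -
  let ?y = "\<sigma>\<^sup>2 * x\<^sup>2 / 2"
  have "\<bar>1 - gam \<sigma> x\<bar> \<le> ?y"
    using exp_neg_taylor(1)[of ?y] by (simp add: gam_def)
  then have "\<sigma>\<^sup>2 * \<bar>x\<bar> * \<bar>1 - gam \<sigma> x\<bar> \<le> \<sigma>\<^sup>2 * \<bar>x\<bar> * ?y" by (rule mult_left_mono) simp
  moreover have "- (\<sigma>\<^sup>2 * x) * gam \<sigma> x + \<sigma>\<^sup>2 * x = \<sigma>\<^sup>2 * x * (1 - gam \<sigma> x)"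
    by (simp add: algebra_simps)
  moreover have "\<sigma>\<^sup>2 * \<bar>x\<bar> * ?y = \<sigma> ^ 4 / 2 * \<bar>x\<bar> ^ 3"
    by (simp add: power_numeral_reduce)
  ultimately show ?thesis by (simp add: abs_mult)
qed

text \<open>If the modulus were 1, then cos (x v) would equal one and the same sign on almost all of
  the mass of the density, which would sit on a countable set.\<close>

lemma A_lt_1:
  assumes x: "x \<noteq> 0"
  shows "\<bar>A x\<bar> < 1"
proof -
  have i: "integrable lborel (\<lambda>v. cos (x * v) * f0 v)" by (rule integrable_cosT[OF dens(2)])
  have key: "e * A x \<noteq> 1" if e: "e = 1 \<or> e = - 1" for e :: real
  proof
    assume eA: "e * A x = 1"
    have i': "integrable lborel (\<lambda>v. (1 - e * cos (x * v)) * f0 v)"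
      using i dens(2) by (auto simp: left_diff_distrib mult.assoc)
    have "(LBINT v. (1 - e * cos (x * v)) * f0 v) = 1 - e * A x"
      using i dens by (simp add: left_diff_distrib A_def cosT_def mult.assoc)
    moreover have "0 \<le> 1 - e * cos y" for y
      using e cos_le_one[of y] cos_ge_minus_one[of y] by auto
    ultimately have "AE v in lborel. (1 - e * cos (x * v)) * f0 v = 0"
      using integral_nonneg_eq_0_iff_AE[OF i'] dens(1) eA by simp
    then show False
    proof (rule nonnull)
      have "{v. 1 - e * cos (x * v) = 0} \<subseteq> range (\<lambda>i::int. of_int i * pi / x)"
      proof
        fix v assume "v \<in> {v. 1 - e * cos (x * v) = 0}"
        then have "e * cos (x * v) = 1" by simp
        then have "(cos (x * v))\<^sup>2 = 1" using e by auto
        then have "sin (x * v) = 0" using sin_cos_squared_add[of "x * v"] by simp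
        then obtain i :: int where "x * v = of_int i * pi" by (auto simp: sin_zero_iff_int2)
        then have "v = of_int i * pi / x" using x by (simp add: field_simps)
        then show "v \<in> range (\<lambda>i::int. of_int i * pi / x)" by blast
      qed
      then show "countable {v. 1 - e * cos (x * v) = 0}" by (rule countable_subset) auto
    qed
  qed
  have "A x \<noteq> 1" "A x \<noteq> - 1" using key[of 1] key[of "-1"] by auto
  then show ?thesis using A_le_1[of x] by (auto simp: abs_if split: if_splits)
qed

lemma A_tail:
  obtains p X where "0 < p" "2 \<le> X" "\<And>x. X \<le> \<bar>x\<bar> \<Longrightarrow> \<bar>A x\<bar> \<le> \<bar>x\<bar> powr (- p)"
proof -
  obtain p where p: "0 < p" "(\<lambda>\<xi>. norm (fourier f0 \<xi>)) \<in> o[at_infinity](\<lambda>\<xi>. \<bar>\<xi>\<bar> powr (- p))"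
    using tail by blast
  have "eventually (\<lambda>\<xi>. norm (norm (fourier f0 \<xi>)) \<le> 1 * norm (\<bar>\<xi>\<bar> powr (- p))) at_infinity"
    by (rule landau_o.smallD[OF p(2)]) simp
  then obtain b where b: "\<And>x. b \<le> \<bar>x\<bar> \<Longrightarrow> norm (fourier f0 x) \<le> \<bar>x\<bar> powr (- p)"
    by (auto simp: eventually_at_infinity)
  have "\<bar>A x\<bar> \<le> norm (fourier f0 x)" for x
  proof -
    have i: "complex_integrable lborel (\<lambda>v. exp (\<i> * complex_of_real (x * v)) * complex_of_real (f0 v))"
    proof (rule Bochner_Integration.integrable_bound[OF dens(2)])
      show "AE v in lborel. norm (exp (\<i> * complex_of_real (x * v)) * complex_of_real (f0 v)) \<le> norm (f0 v)"
        by (auto simp: norm_mult)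
    qed measurable
    have "Re (fourier f0 x) = (LBINT v. Re (exp (\<i> * complex_of_real (x * v)) * complex_of_real (f0 v)))"
      unfolding fourier_def by (rule integral_Re[OF i, symmetric])
    also have "\<dots> = A x"
      by (simp add: A_def cosT_def Re_exp)
    finally show ?thesis using abs_Re_le_cmod[of "fourier f0 x"] by simp
  qed
  then show ?thesis
    using b by (intro that[of p "max 2 b"] p) (auto intro: order_trans)
qed

lemma wgt_ge: "0 \<le> c \<Longrightarrow> 0 \<le> q \<Longrightarrow> exp (- (q * (c * x\<^sup>2))) \<le> wgt c q x"
proof -
  assume c: "0 \<le> c" "0 \<le> q"
  have pos: "0 < 1 + c * x\<^sup>2" using c by (intro add_pos_nonneg) auto
  have "ln (1 + c * x\<^sup>2) \<le> c * x\<^sup>2" using c by (intro ln_add_one_self_le_self) auto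
  then have "q * ln (1 + c * x\<^sup>2) \<le> q * (c * x\<^sup>2)" using c by (intro mult_left_mono)
  then show ?thesis using pos by (simp add: wgt_def powr_def)
qed

text \<open>Three regions. Near 0 the quadratic term of the expansion wins, on a compact annulus the
  modulus stays below 1 by compactness, and far out the assumed tail decides. The first two use
  \<open>1 - c * x\<^sup>2 \<le> wgt c q x\<close> with small c, the last uses small q.\<close>

lemma A_wgt:
  obtains c q where "0 < c" "c \<le> 1" "0 < q" "q \<le> 3/8" "\<And>x. \<bar>A x\<bar> \<le> wgt c q x" "\<And>x. gam \<sigma> x \<le> wgt c q x"
proof -
  obtain p X where p: "0 < p" and X: "2 \<le> X" and AX: "\<And>x. X \<le> \<bar>x\<bar> \<Longrightarrow> \<bar>A x\<bar> \<le> \<bar>x\<bar> powr (- p)"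
    using A_tail by blast
  \<comment> \<open>For |x| \<ge> 2 one has 1 + c x^2 \<le> |x|^4, so the weight is at least
    |x|^(-4q), which must dominate |x|^(-p).\<close>
  define q where "q = min (p / 4) (3/8)"
  have q: "0 < q" "q \<le> 3/8" "4 * q \<le> p" using p by (auto simp: q_def)
  define s where "s = \<sigma>\<^sup>2"
  have s: "0 < s" using sigma_pos by (simp add: s_def)
  \<comment> \<open>\<open>B * x\<^sup>2 \<le> 1\<close> encodes two conditions at once: the quartic
    remainder is at most half of the quadratic term, and s x^2 \<le> 1 takes care of the lower side
    of the absolute value.\<close>
  define B where "B = m4 / (6 * s) + s"
  have B: "0 < B" unfolding B_def using s m4_nonneg by (intro add_nonneg_pos) auto
  define d where "d = min 1 (1 / (sqrt B))"
  have d: "0 < d" "d \<le> 1" "B * d\<^sup>2 \<le> 1"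
  proof -
    show "0 < d" "d \<le> 1" using B by (auto simp: d_def)
    have "d\<^sup>2 \<le> (1 / sqrt B)\<^sup>2" using B by (intro power_mono) (auto simp: d_def)
    then show "B * d\<^sup>2 \<le> 1" using B by (simp add: power_divide field_simps)
  qed
  have near: "\<bar>A x\<bar> \<le> 1 - s * x\<^sup>2 / 4" if x: "\<bar>x\<bar> \<le> d" for x
  proof -
    have "x\<^sup>2 \<le> d\<^sup>2" using power_mono[OF x, of 2] by simp
    then have Bx: "B * x\<^sup>2 \<le> 1" using d(3) B mult_left_mono[of "x\<^sup>2" "d\<^sup>2" B] by linarith
    have "m4 / (6 * s) * x\<^sup>2 \<le> B * x\<^sup>2" "s * x\<^sup>2 \<le> B * x\<^sup>2"
      unfolding B_def using s m4_nonneg by (intro mult_right_mono; simp)+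
    then have 1: "m4 / (6 * s) * x\<^sup>2 \<le> 1" and 2: "s * x\<^sup>2 \<le> 1" using Bx by auto
    have "m4 / 24 * x ^ 4 = (s * x\<^sup>2 / 4) * (m4 / (6 * s) * x\<^sup>2)"
      using s by (simp add: power_numeral_reduce)
    also have "\<dots> \<le> (s * x\<^sup>2 / 4) * 1" using 1 s by (intro mult_left_mono) auto
    finally have "\<bar>A x - (1 - s * x\<^sup>2 / 2)\<bar> \<le> s * x\<^sup>2 / 4" using A_taylor[of x] by (simp add: s_def)
    then show ?thesis using 2 unfolding abs_le_iff by linarith
  qed
  define S where "S = {x::real. d \<le> \<bar>x\<bar> \<and> \<bar>x\<bar> \<le> X}"
  have "compact S"
  proof -
    have "S = {-X..-d} \<union> {d..X}" using d X by (auto simp: S_def)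
    then show ?thesis by (auto intro: compact_Un)
  qed
  moreover have "S \<noteq> {}" using d X by (auto simp: S_def intro!: exI[of _ 1])
  moreover have "continuous_on S (\<lambda>x. \<bar>A x\<bar>)" by (intro continuous_intros continuous_on_subset[OF A_cont]) auto
  ultimately obtain x0 where x0: "x0 \<in> S" "\<And>x. x \<in> S \<Longrightarrow> \<bar>A x\<bar> \<le> \<bar>A x0\<bar>"
    using continuous_attains_sup by metis
  define e where "e = 1 - \<bar>A x0\<bar>"
  have e: "0 < e" using A_lt_1[of x0] x0 d by (auto simp: e_def S_def)
  \<comment> \<open>The bound s / 4 serves the region near 0, and e / X^2 makes c x^2 at most the
    gap e on the annulus.\<close>
  define c where "c = min 1 (min (s / 4) (e / X\<^sup>2))"
  have c: "0 < c" "c \<le> 1" using s e X by (auto simp: c_def)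
  have cs: "c \<le> s / 4" and ce: "c \<le> e / X\<^sup>2"
    unfolding c_def by (meson min.cobounded1 min.cobounded2 order_trans)+
  have lower: "1 - c * x\<^sup>2 \<le> wgt c q x" for x
  proof -
    have "q * (c * x\<^sup>2) \<le> 1 * (c * x\<^sup>2)" using q c by (intro mult_right_mono) auto
    then show ?thesis
      using wgt_ge[OF less_imp_le[OF c(1)] less_imp_le[OF q(1)], of x]
        exp_ge_add_one_self[of "- (q * (c * x\<^sup>2))"] by linarith
  qed
  show ?thesis
  proof (rule that[OF c(1,2) q(1,2)])
    fix x
    consider "\<bar>x\<bar> \<le> d" | "x \<in> S" | "X \<le> \<bar>x\<bar>"
      unfolding S_def mem_Collect_eq using linear by blast
    then show "\<bar>A x\<bar> \<le> wgt c q x"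
    proof cases
      case 1
      have "c * x\<^sup>2 \<le> s / 4 * x\<^sup>2" using cs by (intro mult_right_mono) auto
      then show ?thesis using near[OF 1] lower[of x] by simp
    next
      case 2
      have "x\<^sup>2 \<le> X\<^sup>2" using 2 power_mono[of "\<bar>x\<bar>" X 2] by (simp add: S_def)
      then have "c * x\<^sup>2 \<le> e / X\<^sup>2 * X\<^sup>2" using ce c e by (intro mult_mono) auto
      also have "\<dots> = e" using X by simp
      finally show ?thesis using x0(2)[OF 2] lower[of x] by (simp add: e_def)
    next
      case 3
      have x: "2 \<le> \<bar>x\<bar>" using 3 X by simp
      have x2: "4 \<le> x\<^sup>2" using power_mono[OF x, of 2] by simp
      have "1 + c * x\<^sup>2 \<le> 1 + 1 * x\<^sup>2" using c by (intro add_left_mono mult_right_mono) auto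
      also have "\<dots> \<le> 4 * x\<^sup>2" using x2 by simp
      also have "\<dots> \<le> x\<^sup>2 * x\<^sup>2" using x2 by (intro mult_right_mono) auto
      also have "\<dots> = \<bar>x\<bar> powr 4" using x by (simp add: power_numeral_reduce)
      finally have "(\<bar>x\<bar> powr 4) powr (-q) \<le> wgt c q x"
        unfolding wgt_def using c q by (intro powr_mono2') (auto intro!: add_pos_nonneg)
      moreover have "\<bar>x\<bar> powr (- p) \<le> \<bar>x\<bar> powr (4 * (- q))" using x q by (intro powr_mono) auto
      moreover have "(\<bar>x\<bar> powr 4) powr (-q) = \<bar>x\<bar> powr (4 * (- q))" by (rule powr_powr)
      ultimately show ?thesis using AX[OF 3] by linarith
    qed
    have "q * (c * x\<^sup>2) \<le> 1 * (s / 4 * x\<^sup>2)" using q c cs by (intro mult_mono) auto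
    moreover have "0 \<le> s * x\<^sup>2" using s by simp
    ultimately have "q * (c * x\<^sup>2) \<le> s * x\<^sup>2 / 2" by linarith
    then have "gam \<sigma> x \<le> exp (- (q * (c * x\<^sup>2)))"
      by (simp add: gam_def s_def[symmetric])
    also have "\<dots> \<le> wgt c q x" using c q by (intro wgt_ge) auto
    finally show "gam \<sigma> x \<le> wgt c q x" .
  qed
qed

text \<open>For |x| \<le> 1 the weight is at least 1/2 and the Taylor estimates apply. For |x| \<ge>
  1 boundedness is enough: because \<open>q \<le> 3/8\<close> is below 1/2, the weight is at least 1
  / (2|x|), so x^2 times the weight dominates |x| / 2, and higher powers only help.\<close>

lemma kac_fourier_exists: "\<exists>c q M. kac_fourier A A' \<sigma> c q M"
proof -
  obtain c q where c: "0 < c" "c \<le> 1" and q: "0 < q" "q \<le> 3/8"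
    and Aw: "\<And>x. \<bar>A x\<bar> \<le> wgt c q x" and gw: "\<And>x. gam \<sigma> x \<le> wgt c q x"
    using A_wgt by metis
  have wnear: "1/2 \<le> wgt c q x" if "\<bar>x\<bar> \<le> 1" for x
  proof -
    have "x\<^sup>2 \<le> 1" using that by (simp add: abs_square_le_1)
    then have "c * x\<^sup>2 \<le> 1" using c mult_mono[of c 1 "x\<^sup>2" 1] by simp
    then have "q * (c * x\<^sup>2) \<le> 3/8 * 1" using q c by (intro mult_mono) auto
    then show ?thesis
      using wgt_ge[of c q x] exp_ge_add_one_self[of "- (q * (c * x\<^sup>2))"] c q by simp
  qed
  have wfar: "\<bar>x\<bar> / 2 \<le> \<bar>x\<bar>\<^sup>2 * wgt c q x" if "1 \<le> \<bar>x\<bar>" for x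
  proof -
    have x2: "1 \<le> x\<^sup>2" using power_mono[OF that, of 2] by simp
    have "1 + c * x\<^sup>2 \<le> 1 + 1 * x\<^sup>2" using c by (intro add_left_mono mult_right_mono) auto
    also have "\<dots> \<le> (2 * \<bar>x\<bar>)\<^sup>2" using x2 by (simp add: power_mult_distrib)
    also have "\<dots> = (2 * \<bar>x\<bar>) powr 2" using that by simp
    finally have "((2 * \<bar>x\<bar>) powr 2) powr (-q) \<le> wgt c q x"
      unfolding wgt_def using c q by (intro powr_mono2') (auto intro!: add_pos_nonneg)
    moreover have "(2 * \<bar>x\<bar>) powr (-1) \<le> (2 * \<bar>x\<bar>) powr (2 * (-q))" using that q by (intro powr_mono) auto
    moreover have "((2 * \<bar>x\<bar>) powr 2) powr (-q) = (2 * \<bar>x\<bar>) powr (2 * (-q))" by (rule powr_powr)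
    moreover have "(2 * \<bar>x\<bar>) powr (-1) = 1 / (2 * \<bar>x\<bar>)" using that by (intro powr_neg_one) auto
    ultimately have "1 / (2 * \<bar>x\<bar>) \<le> wgt c q x" by linarith
    then have "\<bar>x\<bar>\<^sup>2 * (1 / (2 * \<bar>x\<bar>)) \<le> \<bar>x\<bar>\<^sup>2 * wgt c q x" by (rule mult_left_mono) simp
    moreover have "y\<^sup>2 * (1 / (2 * y)) = y / 2" if "0 < y" for y :: real
      using that by (simp add: power2_eq_square)
    moreover have "0 < \<bar>x\<bar>" using that by linarith
    ultimately have "\<bar>x\<bar> / 2 \<le> \<bar>x\<bar>\<^sup>2 * wgt c q x" by metis
    then show ?thesis .
  qed
  define K where "K = m4 + \<sigma> ^ 4 + \<sigma>\<^sup>2 + m1 + 1"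
  have m1: "0 \<le> m1" unfolding m1_def by (intro Bochner_Integration.integral_nonneg) auto
  have s2: "0 \<le> \<sigma>\<^sup>2" and s4: "0 \<le> \<sigma> ^ 4" by simp_all
  have K: "1 \<le> K" "m4 \<le> K" "\<sigma> ^ 4 \<le> K" "\<sigma>\<^sup>2 \<le> K" "m1 \<le> K" "m4 / 24 + \<sigma> ^ 4 / 8 \<le> K" "m4 / 6 + \<sigma> ^ 4 / 2 \<le> K"
    unfolding K_def using m4_nonneg m1 s2 s4 by linarith+
  have grow: "\<bar>x\<bar>\<^sup>2 * wgt c q x \<le> \<bar>x\<bar>^4 * wgt c q x" if "1 \<le> \<bar>x\<bar>" for x
    using that by (intro mult_right_mono power_increasing wgt_nonneg) auto
  have scale: "B \<le> 4 * K * (y * wgt c q x)" if "B \<le> K * y" "0 \<le> y" "\<bar>x\<bar> \<le> 1" for B y x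
  proof -
    have "K * y * (1/2) \<le> K * y * wgt c q x" using K that wnear[OF that(3)] by (intro mult_left_mono) auto
    moreover have "0 \<le> K * y * wgt c q x" using K that wgt_nonneg by simp
    ultimately show ?thesis using that(1) by (simp add: mult.assoc)
  qed
  have A'2: "\<bar>x * A' x\<bar> \<le> 4 * K * (\<bar>x\<bar>\<^sup>2 * wgt c q x)" for x
  proof (cases "\<bar>x\<bar> \<le> 1")
    case True
    have "\<bar>x\<bar> * \<bar>A' x\<bar> \<le> \<bar>x\<bar> * (K * \<bar>x\<bar>)"
      using A'_linear[of x] mult_right_mono[OF K(4), of "\<bar>x\<bar>"] by (intro mult_left_mono) auto
    then show ?thesis using True by (intro scale) (auto simp: abs_mult power2_eq_square mult_ac)
  next
    case False
    then have x: "1 \<le> \<bar>x\<bar>" by simp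
    have "\<bar>x\<bar> * \<bar>A' x\<bar> \<le> \<bar>x\<bar> * K" using A'_bounded[of x] K by (intro mult_left_mono) auto
    also have "\<dots> = 2 * K * (\<bar>x\<bar> / 2)" by simp
    also have "\<dots> \<le> 2 * K * (\<bar>x\<bar>\<^sup>2 * wgt c q x)" using K wfar[OF x] by (intro mult_left_mono) auto
    also have "\<dots> \<le> 4 * K * (\<bar>x\<bar>\<^sup>2 * wgt c q x)" using K wgt_nonneg by (intro mult_right_mono) auto
    finally show ?thesis by (simp add: abs_mult)
  qed
  have "kac_fourier A A' \<sigma> c q (8 * K)"
  proof
    fix x :: real
    show "\<sigma> \<noteq> 0" using sigma_pos by simp
    show "\<sigma>\<^sup>2 \<le> 8 * K" using K by linarith
    show "\<bar>A' x\<bar> \<le> 8 * K" using A'_bounded[of x] K by linarith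
    show "\<bar>x * A' x\<bar> \<le> 8 * K * \<bar>x\<bar>\<^sup>2 * wgt c q x"
    proof -
      have "4 * K * (\<bar>x\<bar>\<^sup>2 * wgt c q x) \<le> 8 * K * (\<bar>x\<bar>\<^sup>2 * wgt c q x)"
        using K wgt_nonneg by (intro mult_right_mono) auto
      then show ?thesis using A'2[of x] by (simp only: mult.assoc)
    qed
    show "\<bar>A x - gam \<sigma> x\<bar> \<le> 8 * K * \<bar>x\<bar> ^ 4 * wgt c q x"
    proof (cases "\<bar>x\<bar> \<le> 1")
      case True
      have "\<bar>A x - gam \<sigma> x\<bar> \<le> (m4 / 24 + \<sigma> ^ 4 / 8) * x ^ 4"
        using A_taylor[of x] gam_taylor[of x] unfolding distrib_right abs_le_iff by linarith
      also have "\<dots> \<le> K * x ^ 4" by (intro mult_right_mono K) auto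
      finally have "\<bar>A x - gam \<sigma> x\<bar> \<le> K * \<bar>x\<bar> ^ 4" by (simp add: power_even_abs)
      from scale[OF this _ True] have "\<bar>A x - gam \<sigma> x\<bar> \<le> 4 * K * (\<bar>x\<bar> ^ 4 * wgt c q x)" by simp
      also have "\<dots> \<le> 8 * K * (\<bar>x\<bar> ^ 4 * wgt c q x)" using K wgt_nonneg by (intro mult_right_mono) auto
      finally show ?thesis by (simp only: mult.assoc)
    next
      case False
      then have "1 \<le> \<bar>x\<bar> ^ 4" by (intro one_le_power) auto
      then have "1 * wgt c q x \<le> \<bar>x\<bar> ^ 4 * wgt c q x" by (intro mult_right_mono wgt_nonneg)
      moreover have "\<bar>A x - gam \<sigma> x\<bar> \<le> 2 * wgt c q x"
      proof -
        have "\<bar>A x - gam \<sigma> x\<bar> \<le> \<bar>A x\<bar> + \<bar>gam \<sigma> x\<bar>" by (rule abs_triangle_ineq4)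
        moreover have "\<bar>gam \<sigma> x\<bar> = gam \<sigma> x" by (simp add: gam_def)
        ultimately show ?thesis using Aw[of x] gw[of x] by linarith
      qed
      moreover have "2 * (\<bar>x\<bar> ^ 4 * wgt c q x) \<le> 8 * K * (\<bar>x\<bar> ^ 4 * wgt c q x)"
        using K wgt_nonneg by (intro mult_right_mono) auto
      ultimately show ?thesis by (simp only: mult.assoc)
    qed
    show "\<bar>x * A' x - x * (- (\<sigma>\<^sup>2 * x) * gam \<sigma> x)\<bar> \<le> 8 * K * \<bar>x\<bar> ^ 4 * wgt c q x"
    proof (cases "\<bar>x\<bar> \<le> 1")
      case True
      have "\<bar>A' x - (- (\<sigma>\<^sup>2 * x) * gam \<sigma> x)\<bar> \<le> (m4 / 6 + \<sigma> ^ 4 / 2) * \<bar>x\<bar> ^ 3"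
        using A'_taylor[of x] gam'_taylor[of x] unfolding distrib_right abs_le_iff by linarith
      also have "\<dots> \<le> K * \<bar>x\<bar> ^ 3" by (intro mult_right_mono K) auto
      finally have "\<bar>x\<bar> * \<bar>A' x - (- (\<sigma>\<^sup>2 * x) * gam \<sigma> x)\<bar> \<le> \<bar>x\<bar> * (K * \<bar>x\<bar> ^ 3)"
        by (intro mult_left_mono) auto
      then have "\<bar>x * A' x - x * (- (\<sigma>\<^sup>2 * x) * gam \<sigma> x)\<bar> \<le> K * \<bar>x\<bar> ^ 4"
        by (simp only: right_diff_distrib[symmetric] abs_mult) (simp add: power_numeral_reduce mult_ac)
      from scale[OF this _ True]
      have "\<bar>x * A' x - x * (- (\<sigma>\<^sup>2 * x) * gam \<sigma> x)\<bar> \<le> 4 * K * (\<bar>x\<bar> ^ 4 * wgt c q x)" by simp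
      also have "\<dots> \<le> 8 * K * (\<bar>x\<bar> ^ 4 * wgt c q x)" using K wgt_nonneg by (intro mult_right_mono) auto
      finally show ?thesis by (simp only: mult.assoc)
    next
      case False
      then have x: "1 \<le> \<bar>x\<bar>" by simp
      have "\<bar>x * (- (\<sigma>\<^sup>2 * x) * gam \<sigma> x)\<bar> = \<sigma>\<^sup>2 * (\<bar>x\<bar>\<^sup>2 * gam \<sigma> x)"
        by (simp add: abs_mult gam_def power2_eq_square)
      also have "\<dots> \<le> K * (\<bar>x\<bar>\<^sup>2 * wgt c q x)"
        using K gw by (intro mult_mono) (auto simp: gam_def)
      finally have "\<bar>x * A' x - x * (- (\<sigma>\<^sup>2 * x) * gam \<sigma> x)\<bar> \<le> 4 * K * (\<bar>x\<bar>\<^sup>2 * wgt c q x) + K * (\<bar>x\<bar>\<^sup>2 * wgt c q x)"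
        using A'2[of x] by (intro order_trans[OF abs_triangle_ineq4 add_mono])
      also have "\<dots> \<le> 8 * K * (\<bar>x\<bar>\<^sup>2 * wgt c q x)"
      proof -
        have "0 \<le> K * (\<bar>x\<bar>\<^sup>2 * wgt c q x)"
          using K wgt_nonneg by (intro mult_nonneg_nonneg) auto
        then show ?thesis by linarith
      qed
      also have "\<dots> \<le> 8 * K * (\<bar>x\<bar> ^ 4 * wgt c q x)" using K by (intro mult_left_mono grow x) auto
      finally show ?thesis by (simp only: mult.assoc)
    qed
  qed (use A_deriv A'_cont c q Aw gw in auto)
  then show ?thesis by blast
qed

end

section \<open>Convergence to equilibrium\<close>

lemma sums_bound:
  fixes a b :: "nat \<Rightarrow> real"
  assumes a: "a sums s" and b: "b sums B" and b0: "\<And>n. 0 \<le> b n" and K: "0 \<le> K"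
    and le: "\<And>n. \<bar>a n\<bar> \<le> K * b (n + N)"
  shows "\<bar>s\<bar> \<le> K * B"
proof -
  have "(\<lambda>n. b (n + N)) sums (B - (\<Sum>i<N. b i))" by (rule sums_split_initial_segment[OF b])
  then have K': "(\<lambda>n. K * b (n + N)) sums (K * (B - (\<Sum>i<N. b i)))" by (rule sums_mult)
  have "s \<le> K * (B - (\<Sum>i<N. b i))"
    by (rule sums_le[OF _ a K']) (use le in \<open>auto simp: abs_le_iff\<close>)
  moreover have "- s \<le> K * (B - (\<Sum>i<N. b i))"
    by (rule sums_le[OF _ sums_minus[OF a] K']) (use le in \<open>auto simp: abs_le_iff\<close>)
  moreover have "K * (B - (\<Sum>i<N. b i)) \<le> K * B"
    using K b0 by (intro mult_left_mono) (auto intro: sum_nonneg)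
  ultimately show ?thesis by linarith
qed

text \<open>From x^2 \<le> 2 (z - x)^2 + 2 z^2. It transfers the bound on a derivative at an
  intermediate point z to the endpoint x.\<close>

lemma japanese_bracket_shift:
  fixes x z :: real
  assumes "\<bar>z - x\<bar> \<le> 1"
  shows "(1 + z\<^sup>2) powr (-(3/8)) \<le> 3 * (1 + x\<^sup>2) powr (-(3/8))"
proof -
  have "2 * (z - x)\<^sup>2 \<le> 2" using power_mono[OF assms, of 2] by simp
  moreover have "x\<^sup>2 + (2 * z - x)\<^sup>2 = 2 * (z - x)\<^sup>2 + 2 * z\<^sup>2"
    by (simp add: power2_eq_square algebra_simps)
  ultimately have "x\<^sup>2 + (2 * z - x)\<^sup>2 \<le> 2 + 2 * z\<^sup>2" by (simp only: add_right_mono)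
  then have "x\<^sup>2 \<le> 2 + 2 * z\<^sup>2" by (rule order_trans[rotated]) simp
  then have "1 + x\<^sup>2 \<le> 3 * (1 + z\<^sup>2)" using zero_le_power2[of z] by (simp only: distrib_left)
  then have "(1 + x\<^sup>2) / 3 \<le> 1 + z\<^sup>2" by simp
  then have "(1 + z\<^sup>2) powr (-(3/8)) \<le> ((1 + x\<^sup>2) / 3) powr (-(3/8))"
    using one_plus_sq_pos[of x] by (intro powr_mono2') auto
  also have "\<dots> = 3 powr (3/8) * (1 + x\<^sup>2) powr (-(3/8))"
    using one_plus_sq_pos[of x] by (simp add: powr_divide powr_minus field_simps)
  also have "\<dots> \<le> 3 powr 1 * (1 + x\<^sup>2) powr (-(3/8))"
    by (intro mult_right_mono powr_mono) auto
  finally show ?thesis by simp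
qed

lemma transforms_sum:
  assumes "\<And>i. i \<in> I \<Longrightarrow> integrable lborel (g i)"
  shows "cosT (\<lambda>v. \<Sum>i\<in>I. c i * g i v) x = (\<Sum>i\<in>I. c i * cosT (g i) x)"
    and "sinT (\<lambda>v. \<Sum>i\<in>I. c i * g i v) x = (\<Sum>i\<in>I. c i * sinT (g i) x)"
  using assms unfolding cosT_def sinT_def
  by (simp_all add: sum_distrib_left mult.left_commute[of _ "c _"] Bochner_Integration.integral_sum
      integrable_cosT integrable_sinT)

lemma L1_diff_prob:
  assumes "prob_density f" "prob_density g"
  shows "(LBINT v. \<bar>f v - g v\<bar>) \<le> 2"
proof -
  note F = prob_densityD[OF assms(1)] and G = prob_densityD[OF assms(2)]
  have "(LBINT v. \<bar>f v - g v\<bar>) \<le> (LBINT v. f v + g v)"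
    using F(1,2) G(1,2) by (intro integral_mono) (auto simp: abs_le_iff add_increasing add_increasing2)
  also have "\<dots> = 2" using F G by simp
  finally show ?thesis .
qed

lemma prob_density_normal: "0 < \<sigma> \<Longrightarrow> prob_density (normal_density 0 \<sigma>)"
  by (rule prob_densityI) (auto simp: integral_normal_density integrable_normal_density)

context kac_datum
begin

text \<open>The solution minus the Gaussian is split into \<open>r\<close> and the first terms
  \<open>w n * (\<rho> n v - g v)\<close>. Giving the Gaussian the leftover weight \<open>c\<close>
  makes the cosine transform of \<open>r\<close> the tail of the series of
  \<open>w n * u n x\<close>, so that every term of the tail decays.\<close>

lemma L1_distance_bound:
  assumes C: "0 \<le> C"
    and dec: "\<And>n x. n \<ge> N \<Longrightarrow> \<bar>wild A n x - gam \<sigma> x\<bar> \<le> C * pc n * (1 + x\<^sup>2) powr (-(3/8))"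
    and dec': "\<And>n x. n \<ge> N \<Longrightarrow> \<exists>d. ((\<lambda>x. wild A n x - gam \<sigma> x) has_real_derivative d) (at x)
        \<and> \<bar>d\<bar> \<le> C * pc n * (1 + x\<^sup>2) powr (-(3/8))"
    and sol: "kac_solution f0 f" and t: "0 < t"
  shows "(LBINT v. \<bar>f v t - normal_density 0 \<sigma> v\<bar>) \<le>
    (3 * (C + 1) * ((LBINT x. J x) * (1 + 10 * pi) / (4 * pi)) + 2 * real (Suc N)) * exp (- t / 4)"
proof -
  interpret flow: kac_flow f0 f by unfold_locales (rule density sol)+
  define g where "g = normal_density 0 \<sigma>"
  have g: "prob_density g" unfolding g_def by (rule prob_density_normal[OF sigma_pos])
  define w where "w = (\<lambda>n. exp (- t) * (1 - exp (- t)) ^ n)"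
  have tau: "0 \<le> 1 - exp (- t)" "1 - exp (- t) < 1" using t by auto
  have w0: "0 \<le> w n" for n using tau by (simp add: w_def)
  have wle: "w n \<le> exp (- t)" for n
    using tau by (simp add: w_def mult_left_le power_le_one)
  have wsum: "w sums 1"
  proof -
    have "(\<lambda>n. (1 - exp (- t)) ^ n) sums (1 / (1 - (1 - exp (- t))))"
      by (rule geometric_sums) (use tau in auto)
    from sums_mult[OF this, of "exp (- t)"] show ?thesis by (simp add: w_def)
  qed
  have wp: "(\<lambda>n. w n * pc n) sums exp (- t / 4)"
  proof -
    have "(\<lambda>n. exp (- t) * (pc n * (1 - exp (- t)) ^ n)) sums (exp (- t) * (1 - (1 - exp (- t))) powr (- 3/4))"
      by (intro sums_mult pc_sums tau)
    also have "exp (- t) * (1 - (1 - exp (- t))) powr (- 3/4) = exp (- t / 4)"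
      by (simp add: powr_def exp_add[symmetric])
    finally show ?thesis by (simp add: w_def mult_ac)
  qed
  have "\<forall>n. \<exists>\<rho>. prob_density \<rho> \<and> (\<forall>x. cosT \<rho> x = wild A n x) \<and> (n \<noteq> 0 \<longrightarrow> (\<forall>x. sinT \<rho> x = 0))"
    using wild_density[OF density] by (simp add: A_def)
  from choice[OF this] obtain \<rho>' where \<rho>': "\<And>n. prob_density (\<rho>' n)"
    "\<And>n x. cosT (\<rho>' n) x = wild A n x" "\<And>n x. n \<noteq> 0 \<Longrightarrow> sinT (\<rho>' n) x = 0" by blast
  \<comment> \<open>At n = 0 the datum itself is taken, because its sine transform has to be known
    and not only its cosine transform.\<close>
  define \<rho> where "\<rho> = (\<lambda>n. if n = 0 then f0 else \<rho>' n)"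
  have \<rho>: "prob_density (\<rho> n)" "cosT (\<rho> n) x = wild A n x" "sinT (\<rho> n) x = (if n = 0 then sinT f0 x else 0)" for n x
    using density \<rho>' by (auto simp: \<rho>_def A_def)
  define F where "F = flow.ft t"
  have F: "prob_density F" unfolding F_def using t by (intro flow.ft) simp
  \<comment> \<open>The sum runs to \<open>Suc N\<close> so that the term n = 0 is always removed,
    even for N = 0: it alone carries a sine transform, which cancels that of the solution.\<close>
  define P where "P = (\<lambda>v. \<Sum>n<Suc N. w n * \<rho> n v)"
  define c where "c = 1 - (\<Sum>n<Suc N. w n)"
  define r where "r = (\<lambda>v. (F v - P v) - c * g v)"
  have Pi: "integrable lborel P"
    unfolding P_def using prob_densityD(2)[OF \<rho>(1)] by (intro Bochner_Integration.integrable_sum integrable_mult_right)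
  have FPi: "integrable lborel (\<lambda>v. F v - P v)" using prob_densityD(2)[OF F] Pi by auto
  have cgi: "integrable lborel (\<lambda>v. c * g v)" using prob_densityD(2)[OF g] by auto
  have ri: "integrable lborel r" unfolding r_def by (intro Bochner_Integration.integrable_diff FPi cgi)
  have gT: "cosT g x = gam \<sigma> x" "sinT g x = 0" for x
    unfolding g_def by (rule normal_density_transforms[OF sigma_pos])+
  have rs: "sinT r x = 0" for x
  proof -
    have "sinT P x = (\<Sum>n<Suc N. w n * sinT (\<rho> n) x)"
      unfolding P_def by (rule transforms_sum) (rule prob_densityD[OF \<rho>(1)])
    also have "\<dots> = w 0 * sinT f0 x"
      by (subst sum.lessThan_Suc_shift) (simp add: \<rho>)
    finally have "sinT P x = exp (- t) * sinT f0 x" by (simp add: w_def)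
    moreover have "sinT F x = exp (- t) * sinT f0 x" unfolding F_def by (rule flow.sinT_flow[OF t])
    ultimately show ?thesis
      unfolding r_def transforms_diff(2)[OF FPi cgi] transforms_diff(2)[OF prob_densityD(2)[OF F] Pi] cosT_cmult
      by (simp add: gT)
  qed
  define u where "u = (\<lambda>n x. wild A n x - gam \<sigma> x)"
  have rc: "(\<lambda>n. w (n + Suc N) * u (n + Suc N) x) sums cosT r x" for x
  proof -
    have "(\<lambda>n. w n * wild A n x) sums cosT F x"
      using flow.wild_series[OF t, of x] by (simp add: w_def F_def A_def)
    from sums_diff[OF this sums_mult2[OF wsum, of "gam \<sigma> x"]]
    have "(\<lambda>n. w n * u n x) sums (cosT F x - gam \<sigma> x)" by (simp add: u_def right_diff_distrib)
    from sums_split_initial_segment[OF this, of "Suc N"]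
    have "(\<lambda>n. w (n + Suc N) * u (n + Suc N) x) sums (cosT F x - gam \<sigma> x - (\<Sum>n<Suc N. w n * u n x))" .
    also have "cosT F x - gam \<sigma> x - (\<Sum>n<Suc N. w n * u n x) = cosT r x"
    proof -
      have "cosT P x = (\<Sum>n<Suc N. w n * cosT (\<rho> n) x)"
        unfolding P_def by (rule transforms_sum) (rule prob_densityD[OF \<rho>(1)])
      then have "cosT r x = cosT F x - (\<Sum>n<Suc N. w n * wild A n x) - c * gam \<sigma> x"
        unfolding r_def transforms_diff(1)[OF FPi cgi] transforms_diff(1)[OF prob_densityD(2)[OF F] Pi] cosT_cmult
        by (simp add: gT \<rho> del: sum.lessThan_Suc)
      then show ?thesis
        by (simp add: c_def u_def right_diff_distrib left_diff_distrib sum_subtractf sum_distrib_right del: sum.lessThan_Suc)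
    qed
    finally show ?thesis .
  qed
  \<comment> \<open>The 3 comes from \<open>japanese_bracket_shift\<close>; \<open>C + 1\<close>
    instead of \<open>C\<close> makes \<open>M\<close> strictly positive.\<close>
  define M where "M = 3 * (C + 1) * exp (- t / 4)"
  have M: "0 < M" using C by (simp add: M_def)
  have b0: "0 \<le> w n * pc n" for n using w0[of n] pc_pos[of n] by simp
  have R: "\<bar>cosT r x\<bar> \<le> M * (1 + x\<^sup>2) powr (-(3/8))" for x
  proof -
    let ?j = "(1 + x\<^sup>2) powr (-(3/8))"
    have "\<bar>cosT r x\<bar> \<le> (C * ?j) * exp (- t / 4)"
    proof (rule sums_bound[OF rc wp b0, where N="Suc N"])
      fix n
      have "w (n + Suc N) * \<bar>u (n + Suc N) x\<bar> \<le> w (n + Suc N) * (C * pc (n + Suc N) * ?j)"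
        unfolding u_def by (intro mult_left_mono dec w0) auto
      then show "\<bar>w (n + Suc N) * u (n + Suc N) x\<bar> \<le> C * ?j * (w (n + Suc N) * pc (n + Suc N))"
        using w0[of "n + Suc N"] by (simp add: abs_mult mult_ac)
    qed (use C in auto)
    also have "\<dots> = C * (exp (- t / 4) * ?j)" by simp
    also have "\<dots> \<le> (3 * (C + 1)) * (exp (- t / 4) * ?j)"
      using C by (intro mult_right_mono) auto
    finally show ?thesis by (simp add: M_def mult_ac)
  qed
  have L: "\<bar>cosT r (x + h) - cosT r x\<bar> \<le> M * h * (1 + x\<^sup>2) powr (-(3/8))" if h: "0 < h" "h \<le> 1" for x h
  proof -
    let ?j = "(1 + x\<^sup>2) powr (-(3/8))"
    have "\<bar>cosT r (x + h) - cosT r x\<bar> \<le> (C * 3 * ?j * h) * exp (- t / 4)"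
    proof (rule sums_bound[OF sums_diff[OF rc rc] wp b0, where N="Suc N"])
      fix n
      let ?n = "n + Suc N"
      \<comment> \<open>The mean value inequality on [x, x + h]. Only the existence of a bounded
        derivative at each point is known, so one is selected by choice.\<close>
      have "norm (u ?n (x + h) - u ?n x) \<le> (C * pc ?n * (3 * ?j)) * norm (x + h - x)"
      proof (rule field_differentiable_bound[of "{x..x+h}" "u ?n" "\<lambda>z. SOME d. ((\<lambda>x. u ?n x) has_real_derivative d) (at z)
          \<and> \<bar>d\<bar> \<le> C * pc ?n * (1 + z\<^sup>2) powr (-(3/8))"])
        fix z assume z: "z \<in> {x..x+h}"
        let ?d = "SOME d. ((\<lambda>x. u ?n x) has_real_derivative d) (at z) \<and> \<bar>d\<bar> \<le> C * pc ?n * (1 + z\<^sup>2) powr (-(3/8))"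
        have *: "(u ?n has_real_derivative ?d) (at z) \<and> \<bar>?d\<bar> \<le> C * pc ?n * (1 + z\<^sup>2) powr (-(3/8))"
          using someI_ex[OF dec'[of ?n z]] by (simp add: u_def)
        then show "(u ?n has_field_derivative ?d) (at z within {x..x+h})"
          by (auto intro: DERIV_subset)
        have "\<bar>?d\<bar> \<le> C * pc ?n * (1 + z\<^sup>2) powr (-(3/8))" using * by blast
        also have "\<dots> \<le> C * pc ?n * (3 * ?j)"
          using C pc_pos[of ?n] z h by (intro mult_left_mono japanese_bracket_shift) auto
        finally show "norm ?d \<le> C * pc ?n * (3 * ?j)" by simp
      qed (use h in auto)
      then have "w ?n * \<bar>u ?n (x + h) - u ?n x\<bar> \<le> w ?n * (C * pc ?n * (3 * ?j) * h)"
        using h by (intro mult_left_mono w0) auto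
      then show "\<bar>w ?n * u ?n (x + h) - w ?n * u ?n x\<bar> \<le> C * 3 * ?j * h * (w ?n * pc ?n)"
        using w0[of ?n] by (simp add: abs_mult mult_ac flip: right_diff_distrib)
    qed (use C h in auto)
    also have "\<dots> = C * 3 * (exp (- t / 4) * h * ?j)" by simp
    also have "\<dots> \<le> (3 * (C + 1)) * (exp (- t / 4) * h * ?j)"
      using C h by (intro mult_right_mono) auto
    finally show ?thesis by (simp add: M_def mult_ac)
  qed
  define K where "K = (LBINT x. J x) * (1 + 10 * pi) / (4 * pi)"
  have rL1: "(LBINT v. \<bar>r v\<bar>) \<le> M * K"
    unfolding K_def by (rule L1_bound_of_transform[OF ri rs M R L])
  have eq: "F v - g v = r v + (\<Sum>n<Suc N. w n * (\<rho> n v - g v))" for v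
    by (simp add: r_def P_def c_def right_diff_distrib left_diff_distrib sum_subtractf sum_distrib_right del: sum.lessThan_Suc)
  have \<rho>gi: "integrable lborel (\<lambda>v. \<bar>\<rho> n v - g v\<bar>)" for n
    by (intro integrable_abs Bochner_Integration.integrable_diff prob_densityD(2) \<rho>(1) g)
  have "(LBINT v. \<bar>F v - g v\<bar>) \<le> (LBINT v. \<bar>r v\<bar> + (\<Sum>n<Suc N. w n * \<bar>\<rho> n v - g v\<bar>))"
  proof (rule integral_mono)
    show "integrable lborel (\<lambda>v. \<bar>F v - g v\<bar>)" using prob_densityD(2)[OF F] prob_densityD(2)[OF g] by auto
    show "integrable lborel (\<lambda>v. \<bar>r v\<bar> + (\<Sum>n<Suc N. w n * \<bar>\<rho> n v - g v\<bar>))"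
      by (rule Bochner_Integration.integrable_add[OF integrable_abs[OF ri]
            Bochner_Integration.integrable_sum[OF integrable_mult_right[OF \<rho>gi]]])
    fix v
    have "\<bar>\<Sum>n<Suc N. w n * (\<rho> n v - g v)\<bar> \<le> (\<Sum>n<Suc N. \<bar>w n * (\<rho> n v - g v)\<bar>)" by (rule sum_abs)
    also have "\<dots> = (\<Sum>n<Suc N. w n * \<bar>\<rho> n v - g v\<bar>)" by (simp only: abs_mult abs_of_nonneg[OF w0])
    finally show "\<bar>F v - g v\<bar> \<le> \<bar>r v\<bar> + (\<Sum>n<Suc N. w n * \<bar>\<rho> n v - g v\<bar>)"
      unfolding eq by linarith
  qed
  also have "\<dots> = (LBINT v. \<bar>r v\<bar>) + (\<Sum>n<Suc N. w n * (LBINT v. \<bar>\<rho> n v - g v\<bar>))"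
  proof -
    have i: "integrable lborel (\<lambda>v. w n * \<bar>\<rho> n v - g v\<bar>)" for n by (rule integrable_mult_right[OF \<rho>gi])
    have "(LBINT v. \<bar>r v\<bar> + (\<Sum>n<Suc N. w n * \<bar>\<rho> n v - g v\<bar>)) =
      (LBINT v. \<bar>r v\<bar>) + (LBINT v. \<Sum>n<Suc N. w n * \<bar>\<rho> n v - g v\<bar>)"
      by (rule Bochner_Integration.integral_add[OF integrable_abs[OF ri] Bochner_Integration.integrable_sum[OF i]])
    also have "(LBINT v. \<Sum>n<Suc N. w n * \<bar>\<rho> n v - g v\<bar>) = (\<Sum>n<Suc N. LBINT v. w n * \<bar>\<rho> n v - g v\<bar>)"
      by (rule Bochner_Integration.integral_sum[OF i])
    finally show ?thesis by simp
  qed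
  also have "\<dots> \<le> M * K + (\<Sum>n<Suc N. exp (- t / 4) * 2)"
  proof (intro add_mono sum_mono rL1 mult_mono)
    have "exp (- t) \<le> exp (- t / 4)" using t by simp
    then show "w n \<le> exp (- t / 4)" for n by (rule order_trans[OF wle])
    show "(LBINT v. \<bar>\<rho> n v - g v\<bar>) \<le> 2" for n by (rule L1_diff_prob[OF \<rho>(1) g])
  qed auto
  also have "\<dots> = (3 * (C + 1) * K + 2 * real (Suc N)) * exp (- t / 4)"
    by (simp add: M_def algebra_simps)
  finally show ?thesis by (simp add: F_def flow.ft_def g_def K_def)
qed

end

theorem theorem2p1:
  fixes f0 :: "real \<Rightarrow> real" and \<sigma> :: real
  assumes density: "prob_density f0"
    and fourth_moment: "integrable lborel (\<lambda>v. v ^ 4 * f0 v)"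
    and tail: "\<exists>p>0. (\<lambda>\<xi>. norm (fourier f0 \<xi>)) \<in> o[at_infinity](\<lambda>\<xi>. \<bar>\<xi>\<bar> powr (- p))"
    and sigma: "\<sigma> = sqrt (LBINT v. v ^ 2 * f0 v)"
  shows "\<exists>C. \<forall>f. kac_solution f0 f \<longrightarrow>
           (\<forall>t\<ge>0. (LBINT v. \<bar>f v t - normal_density 0 \<sigma> v\<bar>) \<le> C * exp (- t / 4))"
proof -
  interpret kac_datum f0 \<sigma>
    by unfold_locales (rule density fourth_moment tail sigma)+
  obtain c q M where "kac_fourier A A' \<sigma> c q M"
    using kac_fourier_exists by blast
  then interpret kf: kac_fourier A A' \<sigma> c q M .
  obtain C N where C: "0 \<le> C"
    and dec: "\<And>n x. n \<ge> N \<Longrightarrow> \<bar>wild A n x - gam \<sigma> x\<bar> \<le> C * pc n * (1 + x\<^sup>2) powr (-(3/8))"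
    and dec': "\<And>n x. n \<ge> N \<Longrightarrow> \<exists>d. ((\<lambda>x. wild A n x - gam \<sigma> x) has_real_derivative d) (at x)
        \<and> \<bar>d\<bar> \<le> C * pc n * (1 + x\<^sup>2) powr (-(3/8))"
    by (rule kf.wild_decay) blast
  \<comment> \<open>Fixed before any solution or time is introduced, so the constant depends on the
    datum alone.\<close>
  define B where "B = 3 * (C + 1) * ((LBINT x. J x) * (1 + 10 * pi) / (4 * pi)) + 2 * real (Suc N)"
  show ?thesis
  proof (intro exI allI impI)
    fix f and t :: real assume sol: "kac_solution f0 f" and t: "0 \<le> t"
    \<comment> \<open>The estimate by \<open>B\<close> is for positive times; at t = 0 the distance
      of two probability densities is at most 2.\<close>
    show "(LBINT v. \<bar>f v t - normal_density 0 \<sigma> v\<bar>) \<le> max 2 B * exp (- t / 4)"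
    proof (cases "t = 0")
      case True
      have "prob_density (\<lambda>v. f v 0)" using sol by (simp add: kac_solution_def)
      then show ?thesis
        using L1_diff_prob[OF _ prob_density_normal[OF sigma_pos], of "\<lambda>v. f v 0"] True by simp
    next
      case False
      with t have "0 < t" by simp
      from L1_distance_bound[OF C dec dec' sol this]
      have "(LBINT v. \<bar>f v t - normal_density 0 \<sigma> v\<bar>) \<le> B * exp (- t / 4)"
        by (simp add: B_def)
      also have "\<dots> \<le> max 2 B * exp (- t / 4)" by (intro mult_right_mono) auto
      finally show ?thesis .
    qed
  qed
qed

end
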